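(* Let $1<p<\infty$ and let $f=h+\overline{g}:\mathbb{D}\to\mathbb{C}$ be a univalent sense-preserving harmonic mapping whose dilatation $w$ belongs to $\mathcal{B}_p$ and satisfies $\|w\|<1$. Assume that for some $\lambda\in\partial\mathbb{D}$ the analytic function $\varphi=h+\lambda g$ is a conformal map of $\mathbb{D}$ such that $\varphi(\partial\mathbb{D})$ is a closed Jordan curve. Then $F=\log J_f\in\widetilde{\mathcal{B}}_p$ if and only if $$I(f):=\int_{\mathbb{D}}|S_f(z)|^p(1-|z|^2)^{2p-2}\,dA(z)<\infty.$$
   Context: $\mathbb{D}$ is the unit disk and $dA$ is Lebesgue area measure. A sense-preserving locally univalent harmonic mapping $f:\mathbb{D}\to\mathbb{C}$ is written $f=h+\overline{g}$ with $h,g$ analytic in $\mathbb{D}$, $h(0)=g(0)=0$, $h'\neq 0$ in $\mathbb{D}$; its dilatation is $w=g'/h'$, an analytic function with $|w|<1$ in $\mathbb{D}$, and its Jacobian is $J_f=|h'|^2-|g'|^2>0$. Write $\|w\|=\sup_{z\in\mathbb{D}}|w(z)|$. With $\partial_z=\frac12(\partial_x-i\partial_y)$, $\partial_{\bar z}=\frac12(\partial_x+i\partial_y)$ and $F=\log J_f$, the Schwarzian derivative of $f$ is $S_f=F_{zz}-\frac12 F_z^2$; explicitly $S_f=S_h+\frac{\overline{w}}{1-|w|^2}\big(w'\frac{h''}{h'}-w''\big)-\frac32\big(\frac{w'\overline{w}}{1-|w|^2}\big)^2$, where $S_h=(h''/h')'-\frac12(h''/h')^2$ is the classical Schwarzian.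 For $1<p<\infty$: the analytic Besov space $\mathcal{B}_p$ consists of analytic $u$ on $\mathbb{D}$ with $\int_{\mathbb{D}}|u'(z)|^p(1-|z|^2)^{p-2}dA(z)<\infty$; $\widetilde{\mathcal{B}}_p$ consists of smooth $G:\mathbb{D}\to\mathbb{C}$ with $\int_{\mathbb{D}}(|G_z(z)|+|G_{\bar z}(z)|)^p(1-|z|^2)^{p-2}dA(z)<\infty$. *)

theory Defs
  imports "HOL-Analysis.Analysis"
begin

abbreviation unit_disk :: "complex set" where "unit_disk \<equiv> ball 0 1"

definition dz :: "(complex \<Rightarrow> complex) \<Rightarrow> complex \<Rightarrow> complex" where
  "dz G z = (frechet_derivative G (at z) 1 - \<i> * frechet_derivative G (at z) \<i>) / 2"

definition dzbar :: "(complex \<Rightarrow> complex) \<Rightarrow> complex \<Rightarrow> complex" where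
  "dzbar G z = (frechet_derivative G (at z) 1 + \<i> * frechet_derivative G (at z) \<i>) / 2"

fun wirt :: "bool list \<Rightarrow> (complex \<Rightarrow> complex) \<Rightarrow> complex \<Rightarrow> complex" where
  "wirt [] G = G"
| "wirt (b # bs) G = (if b then dz else dzbar) (wirt bs G)"

definition smooth_on :: "complex set \<Rightarrow> (complex \<Rightarrow> complex) \<Rightarrow> bool" where
  "smooth_on S G \<longleftrightarrow> (\<forall>bs. \<forall>z\<in>S. wirt bs G differentiable (at z))"

definition besov :: "real \<Rightarrow> (complex \<Rightarrow> complex) \<Rightarrow> bool" where
  "besov p u \<longleftrightarrow> u holomorphic_on unit_disk \<and>
     (\<integral>\<^sup>+ z. ennreal (norm (deriv u z) powr p * (1 - norm z ^ 2) powr (p - 2))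
        * indicator unit_disk z \<partial>lborel) < \<infinity>"

definition besov_tilde :: "real \<Rightarrow> (complex \<Rightarrow> complex) \<Rightarrow> bool" where
  "besov_tilde p G \<longleftrightarrow> smooth_on unit_disk G \<and>
     (\<integral>\<^sup>+ z. ennreal ((norm (dz G z) + norm (dzbar G z)) powr p * (1 - norm z ^ 2) powr (p - 2))
        * indicator unit_disk z \<partial>lborel) < \<infinity>"

text \<open>Jacobian and log-Jacobian of f = h + conj g.\<close>
definition jac :: "(complex \<Rightarrow> complex) \<Rightarrow> (complex \<Rightarrow> complex) \<Rightarrow> complex \<Rightarrow> real" where
  "jac h g z = norm (deriv h z) ^ 2 - norm (deriv g z) ^ 2"

definition logjac :: "(complex \<Rightarrow> complex) \<Rightarrow> (complex \<Rightarrow> complex) \<Rightarrow> complex \<Rightarrow> complex" where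
  "logjac h g z = complex_of_real (ln (jac h g z))"

definition harm_schwarzian :: "(complex \<Rightarrow> complex) \<Rightarrow> (complex \<Rightarrow> complex) \<Rightarrow> complex \<Rightarrow> complex" where
  "harm_schwarzian h g z = dz (dz (logjac h g)) z - (1/2) * (dz (logjac h g) z) ^ 2"

end

theory Submission
  imports Defs "HOL-Complex_Analysis.Complex_Analysis"
begin

text \<open>
  Write $P = \varphi''/\varphi'$ and $S = P' - P^2/2$ for the pre-Schwarzian and Schwarzian of
  $\varphi = h + \lambda g$. Since $\|w\| < 1$ and $w$ is a Besov function, $F_z - P$ and
  $S_f - S$ are controlled by $w'$, $w''$ and $w'/(1-|z|^2)$, so the claim reduces to: $P$ is
  $p$-integrable with weight $(1-|z|^2)^{p-2}$ iff $S$ is with weight $(1-|z|^2)^{2p-2}$.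
  The forward direction is a Cauchy estimate for $P'$ together with the bound of $(1-|z|)|P|$ for
  univalent functions. For the converse, integrability of $S$ gives $(1-|z|)^2 S \to 0$ at the
  boundary; a phase-line analysis of the Riccati equation $P' = S + P^2/2$ on rays, using that
  $\varphi$ is bounded, upgrades this to $(1-|z|) P \to 0$. A Hardy inequality along horizontal
  segments then absorbs the term $P^2/2$.
\<close>

section \<open>Univalent functions\<close>

text \<open>Univalence bounds the term P^2/2 of P' = S + P^2/2 by a fixed multiple of |P|/(1-|z|),
  which is of the same order as P'. The Hardy inequality can absorb such a term only if the multiple
  is small; hence the detour through (1-|z|) P -> 0. Smallness of S alone cannot give this: for the
  half-plane map z/(1-z) one has S = 0 and P = 2/(1-z), so (1-r) P = 2 along the ray to 1, and the
  integral of P diverges. Boundedness of \<phi> excludes this behaviour, through |\<phi>'| <=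
  C/(1-|z|). In the forward direction any absolute constant K with (1-|z|)|P| <= K will do, so a
  Schottky bound can stand in for the sharp coefficient estimate.

  Area estimates run in Cartesian coordinates: disc means come from rotation invariance, and on a
  horizontal segment at height y the weight 1-|z|^2 is b^2 - x^2 with b^2 = 1 - y^2, so that Fubini
  reduces the Hardy inequality to one variable.\<close>

lemma normalized_univalent_omits:
  assumes hol: "f holomorphic_on ball 0 1" and inj: "inj_on f (ball 0 1)"
    and f0: "f 0 = 0" and f1: "deriv f 0 = 1"
  obtains w where "norm w \<le> 2" "w \<notin> f ` ball 0 1"
proof -
  \<comment> \<open>If the image contained the closed disc of radius 2, the inverse \<open>g\<close>
    would be bounded by 1 there, and Cauchy's estimate at 0 would give |g'(0)| <= 1/2, against g'(0)
    = 1.\<close>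
  have "\<not> cball 0 2 \<subseteq> f ` ball 0 1"
  proof
    assume sub: "cball 0 2 \<subseteq> f ` ball 0 1"
    obtain g where hg: "g holomorphic_on (f ` ball 0 1)"
      and dg: "\<And>z. z \<in> ball 0 1 \<Longrightarrow> deriv f z * deriv g (f z) = 1"
      and gf: "\<And>z. z \<in> ball 0 1 \<Longrightarrow> g (f z) = z"
      using holomorphic_has_inverse[OF hol open_ball inj] by metis
    have g1: "deriv g 0 = 1"
      using dg[of 0] f0 f1 by simp
    have "norm ((deriv ^^ 1) g 0) \<le> fact 1 * 1 / 2 ^ 1"
    proof (rule Cauchy_inequality)
      show "g holomorphic_on ball 0 2"
        using hg sub ball_subset_cball holomorphic_on_subset by (metis subset_trans)
      show "continuous_on (cball 0 2) g"
        using hg sub holomorphic_on_imp_continuous_on holomorphic_on_subset by blast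
      fix x :: complex assume "norm (0 - x) = 2"
      then have "x \<in> f ` ball 0 1" using sub by auto
      then show "norm (g x) \<le> 1" using gf by auto
    qed auto
    then show False using g1 by simp
  qed
  then obtain w where "w \<in> cball 0 2" "w \<notin> f ` ball 0 1" by blast
  then show ?thesis using that by simp
qed

text \<open>A coarse substitute for the Bieberbach bound |f''(0)| <= 4. If f omits w, a square root
  q of 1 - f/w with q(0) = 1 omits 0 and, because f vanishes only at 0, also -1. Schottky's theorem
  then bounds q, hence f, near 0.\<close>

lemma univalent_second_deriv_bound:
  obtains K :: real where
    "\<And>f. \<lbrakk>f holomorphic_on ball 0 1; inj_on f (ball 0 1); f 0 = 0; deriv f 0 = 1\<rbrakk>
      \<Longrightarrow> norm (deriv (deriv f) 0) \<le> K"
proof -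
  \<comment> \<open>The bound of Schottky's theorem for a function with |G(0)| <= 1 on the disc |z|
    <= 1/2.\<close>
  define B where "B = exp(pi * exp(pi * (2 + 2 * 1 + 12 * (1/2) / (1 - 1/2))))"
  show ?thesis
  proof (rule that)
    fix f :: "complex \<Rightarrow> complex"
    assume hol: "f holomorphic_on ball 0 1" and inj: "inj_on f (ball 0 1)"
      and f0: "f 0 = 0" and f1: "deriv f 0 = 1"
    obtain w where w: "norm w \<le> 2" "w \<notin> f ` ball 0 1"
      using normalized_univalent_omits[OF hol inj f0 f1] by blast
    have w0: "w \<noteq> 0" using w f0 by force
    have h: "(\<lambda>z. 1 - f z / w) holomorphic_on ball 0 1"
      using w0 by (intro holomorphic_intros hol) auto
    have nz: "1 - f z / w \<noteq> 0" if "z \<in> ball 0 1" for z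
      using w w0 that by auto
    obtain q0 where q0: "q0 holomorphic_on ball 0 1" "\<And>z. z \<in> ball 0 1 \<Longrightarrow> 1 - f z / w = (q0 z)\<^sup>2"
      using contractible_imp_holomorphic_sqrt[OF h convex_imp_contractible[OF convex_ball] nz] by metis
    define q where "q z = q0 z / q0 0" for z
    have q00: "(q0 0)\<^sup>2 = 1" using q0(2)[of 0] f0 by simp
    then have q0n: "q0 0 \<noteq> 0" by auto
    have q: "q holomorphic_on ball 0 1"
      unfolding q_def using q0n by (intro holomorphic_intros q0) 
    have q2: "1 - f z / w = (q z)\<^sup>2" if "z \<in> ball 0 1" for z
      unfolding q_def using q0(2)[OF that] q00 by (simp add: power_divide)
    have qm: "q z \<noteq> -1" if "z \<in> ball 0 1" for z
    proof
      assume "q z = -1"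
      then have "f z = f 0" using q2[OF that] w0 f0 by simp
      then have "z = 0" using inj that by (auto dest: inj_onD)
      then show False using \<open>q z = -1\<close> q0n by (simp add: q_def)
    qed
    have qn: "q z \<noteq> 0" if "z \<in> ball 0 1" for z
      using q2[OF that] nz[OF that] by auto
    \<comment> \<open>The sign turns the omitted value -1 into 1; the factor 1/2 makes
      \<open>G\<close> holomorphic on the closed unit disc, at the price of bounding q only for |z|
      <= 1/4.\<close>
    define G where "G z = - q (z / 2)" for z
    have sub: "z / 2 \<in> ball 0 1" if "z \<in> cball 0 1" for z :: complex
      using that by (auto simp: norm_divide)
    have "norm (G z) \<le> B" if "norm z \<le> 1/2" for z
      unfolding B_def
    proof (rule Schottky[OF _ _ _ _ _ that])
      show "G holomorphic_on cball 0 1"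
      proof -
        have "(q \<circ> (\<lambda>z. z / 2)) holomorphic_on cball 0 1"
          by (rule holomorphic_on_compose_gen[OF _ q]) (use sub in \<open>auto intro!: holomorphic_intros\<close>)
        then show ?thesis unfolding G_def o_def by (rule holomorphic_on_minus)
      qed
      show "norm (G 0) \<le> 1" using q0n by (simp add: G_def q_def)
      show "\<not> (G z = 0 \<or> G z = 1)" if "z \<in> cball 0 1" for z
        using qn[OF sub[OF that]] qm[OF sub[OF that]] unfolding G_def
        by (metis minus_minus neg_equal_0_iff_equal)
    qed auto
    note GB = this
    have qB: "norm (q z) \<le> B" if "norm z \<le> 1/4" for z
      using GB[of "2 * z"] that by (simp add: G_def norm_mult)
    have fB: "norm (f z) \<le> 2 * (1 + B\<^sup>2)" if "norm z \<le> 1/4" for z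
    proof -
      have "f z = w * (1 - (q z)\<^sup>2)"
        using q2[of z] w0 that by (simp add: field_simps)
      also have "norm \<dots> \<le> 2 * (1 + B\<^sup>2)"
        unfolding norm_mult
      proof (rule mult_mono)
        have "norm (1 - (q z)\<^sup>2) \<le> 1 + norm (q z)^2"
          using norm_triangle_ineq4[of 1 "(q z)\<^sup>2"] by (simp add: norm_power)
        also have "\<dots> \<le> 1 + B\<^sup>2" using qB[OF that] by (simp add: power_mono)
        finally show "norm (1 - (q z)\<^sup>2) \<le> 1 + B\<^sup>2" .
      qed (use w in auto)
      finally show ?thesis .
    qed
    have "norm ((deriv ^^ 2) f 0) \<le> fact 2 * (2 * (1 + B\<^sup>2)) / (1/4) ^ 2"
    proof (rule Cauchy_inequality)
      show "f holomorphic_on ball 0 (1/4)"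
        by (rule holomorphic_on_subset[OF hol]) auto
      show "continuous_on (cball 0 (1/4)) f"
        by (rule holomorphic_on_imp_continuous_on, rule holomorphic_on_subset[OF hol]) auto
    qed (use fB in auto)
    then show "norm (deriv (deriv f) 0) \<le> fact 2 * (2 * (1 + B\<^sup>2)) / (1/4) ^ 2"
      by (simp add: numeral_2_eq_2)
  qed
qed

text \<open>The disc of radius d = 1 - |z| about z is rescaled to the unit disc and f is normalized
  there. The second derivative at 0 becomes d f''(z)/f'(z), so the bound at the origin gives one
  constant for all z.\<close>

lemma univalent_pre_schwarzian_bound:
  obtains K :: real where "K > 0"
    "\<And>f z. \<lbrakk>f holomorphic_on ball 0 1; inj_on f (ball 0 1); z \<in> ball 0 1\<rbrakk>
      \<Longrightarrow> norm (deriv (deriv f) z / deriv f z) * (1 - norm z) \<le> K"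
proof -
  obtain K :: real where K: 
    "\<And>f. \<lbrakk>f holomorphic_on ball 0 1; inj_on f (ball 0 1); f 0 = 0; deriv f 0 = 1\<rbrakk>
      \<Longrightarrow> norm (deriv (deriv f) 0) \<le> K"
    using univalent_second_deriv_bound by blast
  show ?thesis
  proof (rule that[of "max K 1"])
    fix f :: "complex \<Rightarrow> complex" and z :: complex
    assume hol: "f holomorphic_on ball 0 1" and inj: "inj_on f (ball 0 1)" and z: "z \<in> ball 0 1"
    define d where "d = 1 - norm z"
    have d: "d > 0" using z by (simp add: d_def)
    have f': "deriv f z \<noteq> 0"
      using holomorphic_injective_imp_regular[OF hol open_ball inj z] .
    define F where "F \<zeta> = (f (z + of_real d * \<zeta>) - f z) / (of_real d * deriv f z)" for \<zeta>
    have in_ball: "z + of_real d * \<zeta> \<in> ball 0 1" if "\<zeta> \<in> ball 0 1" for \<zeta>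
    proof -
      have "norm (z + of_real d * \<zeta>) \<le> norm z + d * norm \<zeta>"
        using norm_triangle_ineq[of z "of_real d * \<zeta>"] d by (simp add: norm_mult)
      also have "\<dots> < norm z + d * 1" using that d by simp
      finally show ?thesis by (simp add: d_def)
    qed
    have D1: "(F has_field_derivative deriv f (z + of_real d * \<zeta>) / deriv f z) (at \<zeta>)"
      if "\<zeta> \<in> ball 0 1" for \<zeta>
    proof -
      have "(f has_field_derivative deriv f (z + of_real d * \<zeta>)) (at (z + of_real d * \<zeta>))"
        using hol in_ball[OF that] by (simp add: holomorphic_derivI)
      then have "((\<lambda>\<zeta>. f (z + of_real d * \<zeta>)) has_field_derivative 
          deriv f (z + of_real d * \<zeta>) * of_real d) (at \<zeta>)"
        by (rule DERIV_chain2) (auto intro!: derivative_eq_intros)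
      then show ?thesis
        unfolding F_def using d f'
        by (auto intro!: derivative_eq_intros simp: field_simps)
    qed
    have D1': "deriv F \<zeta> = deriv f (z + of_real d * \<zeta>) / deriv f z" if "\<zeta> \<in> ball 0 1" for \<zeta>
      using D1[OF that] DERIV_imp_deriv by blast
    have holF: "F holomorphic_on ball 0 1"
      using D1 by (meson holomorphic_onI DERIV_subset field_differentiable_at_within field_differentiable_def)
    have injF: "inj_on F (ball 0 1)"
    proof (rule inj_onI)
      fix a b assume ab: "a \<in> ball 0 1" "b \<in> ball 0 1" "F a = F b"
      then have "f (z + of_real d * a) = f (z + of_real d * b)"
        using d f' by (simp add: F_def)
      then show "a = b" using inj_onD[OF inj] in_ball ab d by fastforce
    qed
    have "deriv (deriv F) 0 = of_real d * deriv (deriv f) z / deriv f z"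
    proof (rule DERIV_imp_deriv)
      have "(deriv f has_field_derivative deriv (deriv f) z) (at z)"
        by (rule holomorphic_derivI[OF holomorphic_deriv[OF hol open_ball] open_ball z])
      then have "(deriv f has_field_derivative deriv (deriv f) z) (at (z + of_real d * 0))" by simp
      then have "((\<lambda>\<zeta>. deriv f (z + of_real d * \<zeta>)) has_field_derivative 
          deriv (deriv f) z * of_real d) (at 0)"
        by (rule DERIV_chain2) (auto intro!: derivative_eq_intros)
      then have "((\<lambda>\<zeta>. deriv f (z + of_real d * \<zeta>) / deriv f z) has_field_derivative 
          of_real d * deriv (deriv f) z / deriv f z) (at 0)"
        using f' by (auto intro!: derivative_eq_intros simp: field_simps)
      then show "(deriv F has_field_derivative of_real d * deriv (deriv f) z / deriv f z) (at 0)"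
        by (rule has_field_derivative_transform_within_open[of _ _ _ "ball 0 1"]) (auto simp: D1')
    qed
    moreover have "norm (deriv (deriv F) 0) \<le> K"
      using K[OF holF injF] D1'[of 0] f' by (simp add: F_def)
    ultimately show "norm (deriv (deriv f) z / deriv f z) * (1 - norm z) \<le> max K 1"
      using d by (simp add: norm_mult norm_divide mult.commute le_max_iff_disj flip: d_def)
  qed simp
qed

section \<open>Area integrals and mean values\<close>

lemma lborel_complex_eq:
  "(lborel :: complex measure) = distr (lborel \<Otimes>\<^sub>M lborel) borel (\<lambda>(x, y). Complex x y)"
proof (rule lborel_eqI)
  fix l u :: complex
  assume le: "\<And>b. b \<in> Basis \<Longrightarrow> l \<bullet> b \<le> u \<bullet> b"
  have [measurable]: "(\<lambda>(x, y). Complex x y) \<in> borel_measurable (lborel \<Otimes>\<^sub>M lborel)"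
    unfolding lborel_prod split_beta' Complex_eq 
    by (subst measurable_lborel2) (intro borel_measurable_continuous_onI continuous_intros)
  have le': "Re l \<le> Re u" "Im l \<le> Im u"
    using le[of 1] le[of \<i>] by (simp_all add: Basis_complex_def)
  have eq: "(\<lambda>(x, y). Complex x y) -` box l u = {Re l<..<Re u} \<times> {Im l<..<Im u}"
    by (auto simp: box_def Basis_complex_def)
  have "emeasure (distr (lborel \<Otimes>\<^sub>M lborel) borel (\<lambda>(x, y). Complex x y)) (box l u)
      = emeasure (lborel \<Otimes>\<^sub>M lborel) ({Re l<..<Re u} \<times> {Im l<..<Im u})"
    by (subst emeasure_distr) (auto simp: eq space_pair_measure)
  also have "\<dots> = ennreal (Re u - Re l) * ennreal (Im u - Im l)"
    using le' by (subst lborel.emeasure_pair_measure_Times) auto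
  also have "\<dots> = ennreal (\<Prod>b\<in>Basis. (u - l) \<bullet> b)"
    using le' by (simp add: Basis_complex_def ennreal_mult'[symmetric])
  finally show "emeasure (distr (lborel \<Otimes>\<^sub>M lborel) borel (\<lambda>(x, y). Complex x y)) (box l u)
      = ennreal (\<Prod>b\<in>Basis. (u - l) \<bullet> b)" .
qed simp

lemma measurable_Complex [measurable]:
  "(\<lambda>(x, y). Complex x y) \<in> borel_measurable (borel \<Otimes>\<^sub>M borel)"
  unfolding borel_prod split_beta' Complex_eq
  by (intro borel_measurable_continuous_onI continuous_intros)

lemma nn_integral_complex_eq:
  fixes f :: "complex \<Rightarrow> ennreal"
  assumes [measurable]: "f \<in> borel_measurable borel"
  shows "(\<integral>\<^sup>+z. f z \<partial>lborel) = (\<integral>\<^sup>+y. \<integral>\<^sup>+x. f (Complex x y) \<partial>lborel \<partial>lborel)"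
proof -
  have m [measurable]: "(\<lambda>(x, y). f (Complex x y)) \<in> borel_measurable (lborel \<Otimes>\<^sub>M lborel)"
    using measurable_compose[OF measurable_Complex assms] by (simp add: split_beta' lborel_prod borel_prod)
  have [measurable]: "(\<lambda>(x, y). Complex x y) \<in> borel_measurable (lborel \<Otimes>\<^sub>M lborel)"
    using measurable_Complex by (simp add: lborel_prod borel_prod)
  have "(\<integral>\<^sup>+z. f z \<partial>lborel) = (\<integral>\<^sup>+w. f (case w of (x, y) \<Rightarrow> Complex x y) \<partial>(lborel \<Otimes>\<^sub>M lborel))"
    by (subst lborel_complex_eq, subst nn_integral_distr) auto
  also have "\<dots> = (\<integral>\<^sup>+w. (case w of (x, y) \<Rightarrow> f (Complex x y)) \<partial>(lborel \<Otimes>\<^sub>M lborel))"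
    by (simp add: split_beta')
  also have "\<dots> = (\<integral>\<^sup>+y. \<integral>\<^sup>+x. f (Complex x y) \<partial>lborel \<partial>lborel)"
    using lborel_pair.nn_integral_snd[OF m] by simp
  finally show ?thesis .
qed

lemma nn_integral_complex_eq':
  fixes f :: "complex \<Rightarrow> ennreal"
  assumes [measurable]: "f \<in> borel_measurable borel"
  shows "(\<integral>\<^sup>+z. f z \<partial>lborel) = (\<integral>\<^sup>+x. \<integral>\<^sup>+y. f (Complex x y) \<partial>lborel \<partial>lborel)"
proof -
  have m [measurable]: "(\<lambda>(x, y). f (Complex x y)) \<in> borel_measurable (lborel \<Otimes>\<^sub>M lborel)"
    using measurable_compose[OF measurable_Complex assms] by (simp add: split_beta' lborel_prod borel_prod)
  show ?thesis
    using nn_integral_complex_eq[OF assms] lborel_pair.Fubini'[OF m] by simp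
qed

lemma nn_integral_shear_Re:
  fixes f :: "complex \<Rightarrow> ennreal"
  assumes [measurable]: "f \<in> borel_measurable borel"
  shows "(\<integral>\<^sup>+z. f (z + of_real (t * Im z)) \<partial>lborel) = (\<integral>\<^sup>+z. f z \<partial>lborel)"
proof -
  have [measurable]: "(\<lambda>x. f (Complex x y)) \<in> borel_measurable borel" for y
    unfolding Complex_eq by measurable
  have e: "Complex x y + of_real (t * y) = Complex (t * y + 1 * x) y" for x y
    by (simp add: complex_eq_iff)
  have "(\<integral>\<^sup>+x. f (Complex x y + of_real (t * y)) \<partial>lborel) = (\<integral>\<^sup>+x. f (Complex x y) \<partial>lborel)" for y
    using nn_integral_real_affine[of "\<lambda>x. f (Complex x y)" 1 "t * y"] unfolding e by simp
  then show ?thesis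
    by (subst (1 2) nn_integral_complex_eq) (auto simp del: of_real_mult)
qed

lemma nn_integral_shear_Im:
  fixes f :: "complex \<Rightarrow> ennreal"
  assumes [measurable]: "f \<in> borel_measurable borel"
  shows "(\<integral>\<^sup>+z. f (z + \<i> * of_real (t * Re z)) \<partial>lborel) = (\<integral>\<^sup>+z. f z \<partial>lborel)"
proof -
  have [measurable]: "(\<lambda>y. f (Complex x y)) \<in> borel_measurable borel" for x
    unfolding Complex_eq by measurable
  have e: "Complex x y + \<i> * of_real (t * x) = Complex x (t * x + 1 * y)" for x y
    by (simp add: complex_eq_iff)
  have "(\<integral>\<^sup>+y. f (Complex x y + \<i> * of_real (t * x)) \<partial>lborel) = (\<integral>\<^sup>+y. f (Complex x y) \<partial>lborel)" for x
    using nn_integral_real_affine[of "\<lambda>y. f (Complex x y)" 1 "t * x"] unfolding e by simp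
  then show ?thesis
    by (subst (1 2) nn_integral_complex_eq') (auto simp del: of_real_mult)
qed

text \<open>A rotation is a composition of three shears, each of which preserves area by Fubini.\<close>

lemma nn_integral_rotate:
  fixes f :: "complex \<Rightarrow> ennreal"
  assumes [measurable]: "f \<in> borel_measurable borel" and "norm u = 1"
  shows "(\<integral>\<^sup>+z. f (u * z) \<partial>lborel) = (\<integral>\<^sup>+z. f z \<partial>lborel)"
proof -
  have main: "(\<integral>\<^sup>+z. f (v * z) \<partial>lborel) = (\<integral>\<^sup>+z. f z \<partial>lborel)"
    if v: "norm v = 1" "v \<noteq> -1" and [measurable]: "f \<in> borel_measurable borel"
    for v and f :: "complex \<Rightarrow> ennreal"
  proof -
    have n: "(Re v)\<^sup>2 + (Im v)\<^sup>2 = 1"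
      using v by (simp add: cmod_def)
    have nz: "1 + Re v \<noteq> 0"
    proof
      assume "1 + Re v = 0"
      then have r: "Re v = -1" by simp
      with n have "Im v = 0" by simp
      with r v show False by (simp add: complex_eq_iff)
    qed
    \<comment> \<open>For v = exp(i a) this is tan(a/2). The shears have slopes -t, sin a, -t, and t
      sin a = 1 - cos a makes their composition the rotation. At the excluded v = -1 the tangent is
      infinite.\<close>
    define t where "t = Im v / (1 + Re v)"
    have t1: "t * (1 + Re v) = Im v" using nz by (simp add: t_def)
    have "(t * Im v - (1 - Re v)) * (1 + Re v) = 0"
      using n t1 by algebra
    then have t2: "t * Im v = 1 - Re v" using nz by simp
    define A where "A z = z + of_real (- t * Im z)" for z
    define B where "B z = z + \<i> * of_real (Im v * Re z)" for z
    have [measurable]: "A \<in> borel_measurable borel" "B \<in> borel_measurable borel"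
      unfolding A_def B_def by measurable
    have vz: "v * z = A (B (A z))" for z
    proof -
      have "t * (Im z + Im v * (Re z - t * Im z)) = t * Im z + (t * Im v) * (Re z - t * Im z)"
        by (simp add: algebra_simps)
      also have "Re z - t * Im z - \<dots> = Re v * Re z - (t * (1 + Re v)) * Im z"
        unfolding t2 by (simp add: algebra_simps)
      finally have "Re v * Re z - Im v * Im z = Re z - t * Im z - t * (Im z + Im v * (Re z - t * Im z))"
        unfolding t1 by simp
      moreover have "Im z + Im v * (Re z - t * Im z) = Im z + Im v * Re z - (t * Im v) * Im z"
        by (simp add: algebra_simps)
      then have "Re v * Im z + Im v * Re z = Im z + Im v * (Re z - t * Im z)"
        unfolding t2 by (simp add: algebra_simps)
      ultimately show ?thesis
        by (simp add: complex_eq_iff A_def B_def algebra_simps)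
    qed
    have "(\<integral>\<^sup>+z. f (v * z) \<partial>lborel) = (\<integral>\<^sup>+z. (\<lambda>z. f (A (B z))) (z + of_real (- t * Im z)) \<partial>lborel)"
      by (simp add: vz A_def)
    also have "\<dots> = (\<integral>\<^sup>+z. f (A (B z)) \<partial>lborel)"
      by (rule nn_integral_shear_Re) measurable
    also have "\<dots> = (\<integral>\<^sup>+z. (\<lambda>z. f (A z)) (z + \<i> * of_real (Im v * Re z)) \<partial>lborel)"
      by (simp add: B_def)
    also have "\<dots> = (\<integral>\<^sup>+z. f (A z) \<partial>lborel)"
      by (rule nn_integral_shear_Im) measurable
    also have "\<dots> = (\<integral>\<^sup>+z. f z \<partial>lborel)"
      unfolding A_def by (rule nn_integral_shear_Re) measurable
    finally show ?thesis .
  qed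
  show ?thesis
  proof (cases "u = -1")
    case False
    then show ?thesis using main assms by blast
  next
    case True
    \<comment> \<open>The half-turn is done as two quarter-turns.\<close>
    have "(\<integral>\<^sup>+z. f (u * z) \<partial>lborel) = (\<integral>\<^sup>+z. (\<lambda>z. f (\<i> * z)) (\<i> * z) \<partial>lborel)"
      using True by (simp add: mult.assoc[symmetric])
    also have "\<dots> = (\<integral>\<^sup>+z. f (\<i> * z) \<partial>lborel)"
      by (rule main) (auto simp: complex_eq_iff)
    also have "\<dots> = (\<integral>\<^sup>+z. f z \<partial>lborel)"
      by (rule main) (auto simp: complex_eq_iff)
    finally show ?thesis .
  qed
qed

lemma borel_measurable_ennreal_indicator:
  fixes f :: "'a::topological_space \<Rightarrow> real"
  assumes "A \<in> sets borel" "continuous_on A f"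
  shows "(\<lambda>x. ennreal (f x) * indicator A x) \<in> borel_measurable borel"
proof -
  have [measurable]: "(\<lambda>x. indicator A x *\<^sub>R f x) \<in> borel_measurable borel"
    by (rule borel_measurable_continuous_on_indicator[OF assms])
  have "(\<lambda>x. ennreal (f x) * indicator A x) = (\<lambda>x. ennreal (indicator A x *\<^sub>R f x))"
    by (auto simp: fun_eq_iff split: split_indicator)
  then show ?thesis by (simp del: real_scaleR_def)
qed

text \<open>The circle is written as the set of rotations of one point z about c, and Cauchy's
  formula is applied in the rotation variable. The average can then be integrated over z as well,
  and z = 0 is no special case.\<close>

lemma mean_value_circle:
  assumes hol: "u holomorphic_on ball c r" and z: "norm z < r"
  shows "((\<lambda>t. u (c + exp (2 * of_real pi * \<i> * of_real t) * z)) has_integral u c) {0..1}"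
proof -
  define V where "V \<zeta> = u (c + \<zeta> * z)" for \<zeta>
  have sub: "c + \<zeta> * z \<in> ball c r" if "\<zeta> \<in> cball 0 1" for \<zeta>
  proof -
    have "norm (\<zeta> * z) \<le> 1 * norm z"
      unfolding norm_mult using that by (intro mult_right_mono) auto
    then show ?thesis using z by (simp add: dist_norm)
  qed
  have "(u \<circ> (\<lambda>\<zeta>. c + \<zeta> * z)) holomorphic_on cball 0 1"
    by (rule holomorphic_on_compose_gen[OF _ hol]) (use sub in \<open>auto intro!: holomorphic_intros\<close>)
  then have hV: "V holomorphic_on cball 0 1" by (simp add: V_def[abs_def] o_def)
  have "((\<lambda>\<zeta>. V \<zeta> / (\<zeta> - 0)) has_contour_integral 2 * of_real pi * \<i> * V 0) (circlepath 0 1)"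
    by (rule Cauchy_integral_circlepath)
       (auto intro: holomorphic_on_imp_continuous_on[OF hV] holomorphic_on_subset[OF hV])
  then have "((\<lambda>t. (2 * of_real pi * \<i>) * V (exp (2 * of_real pi * \<i> * of_real t)))
      has_integral (2 * of_real pi * \<i>) * V 0) {0..1}"
    by (simp add: has_contour_integral vector_derivative_circlepath mult_ac)
       (simp add: circlepath mult_ac)
  then have "((\<lambda>t. V (exp (2 * of_real pi * \<i> * of_real t))) has_integral V 0) {0..1}"
    by (drule_tac c = "1 / (2 * of_real pi * \<i>)" in has_integral_mult_right) simp
  then show ?thesis by (simp add: V_def)
qed

text \<open>Jensen's inequality for x^p applied to the mean value property, with the tangent line of
  x^p at m = |u(c)| supplied by Young's inequality.\<close>

lemma norm_powr_le_circle_mean: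
  assumes hol: "u holomorphic_on ball c r" and z: "norm z < r" and p: "1 < p"
  shows "ennreal (norm (u c) powr p) \<le>
     (\<integral>\<^sup>+t. ennreal (norm (u (c + exp (2 * of_real pi * \<i> * of_real t) * z)) powr p) * indicator {0..1} t \<partial>lborel)"
proof (cases "u c = 0")
  case True
  then show ?thesis by simp
next
  case False
  define m where "m = norm (u c)"
  have m: "m > 0" using False by (simp add: m_def)
  define e where "e t = exp (2 * of_real pi * \<i> * of_real t)" for t
  define U where "U t = u (c + e t * z)" for t
  have ne: "norm (e t) = 1" for t
    by (simp add: e_def norm_exp_eq_Re)
  have sub: "c + e t * z \<in> ball c r" for t
    using z ne by (simp add: dist_norm norm_mult)
  have cU: "continuous_on {0..1} U"
    unfolding U_def e_def
    by (rule continuous_on_compose2[OF holomorphic_on_imp_continuous_on[OF hol]])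
       (use sub in \<open>auto intro!: continuous_intros simp: e_def\<close>)
  have hU: "(U has_integral u c) {0..1}"
    using mean_value_circle[OF hol z] by (simp add: U_def[abs_def] e_def)
  have i1: "(\<lambda>t. norm (U t)) integrable_on {0..1}"
    by (intro integrable_continuous_interval continuous_intros cU)
  have ip: "(\<lambda>t. norm (U t) powr p) integrable_on {0..1}"
    by (intro integrable_continuous_interval continuous_on_powr' continuous_intros cU) (use p in auto)
  \<comment> \<open>The tangent line at m, solved for x. Equality holds at x = m, so nothing is lost
    when the term (1 - 1/p) m is moved to the left after integration.\<close>
  have young: "x \<le> (m powr (1 - p) / p) * x powr p + (1 - 1 / p) * m" if "x \<ge> 0" for x
  proof -
    have "(x / m) * 1 \<le> (x / m) powr p / p + 1 powr (p / (p - 1)) / (p / (p - 1))"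
      by (rule Youngs_inequality) (use p that m in \<open>auto simp: field_simps\<close>)
    also have "\<dots> = x powr p / (m powr p * p) + (1 - 1 / p)"
      using p m that by (simp add: powr_divide field_simps)
    finally have "x \<le> m * (x powr p / (m powr p * p) + (1 - 1 / p))"
      using m by (simp add: field_simps)
    also have "\<dots> = (m powr (1 - p) / p) * x powr p + (1 - 1 / p) * m"
      using m by (simp add: powr_diff field_simps)
    finally show ?thesis .
  qed
  have "m \<le> integral {0..1} (\<lambda>t. norm (U t))"
    using integral_norm_bound_integral[OF has_integral_integrable[OF hU] i1] hU
    by (simp add: m_def integral_unique)
  also have "\<dots> \<le> integral {0..1} (\<lambda>t. (m powr (1 - p) / p) * norm (U t) powr p + (1 - 1 / p) * m)"
    by (intro integral_le i1 integrable_add integrable_on_mult_right ip young) auto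
  also have "\<dots> = (m powr (1 - p) / p) * integral {0..1} (\<lambda>t. norm (U t) powr p) + (1 - 1 / p) * m"
    using integral_add[OF integrable_on_mult_right[OF ip, of "m powr (1 - p) / p"]
      integrable_const_ivl[of "(1 - 1 / p) * m" 0 1]] by simp
  finally have "m / p \<le> (m powr (1 - p) / p) * integral {0..1} (\<lambda>t. norm (U t) powr p)"
    by (simp add: field_simps)
  then have "m \<le> m powr (1 - p) * integral {0..1} (\<lambda>t. norm (U t) powr p)"
    using p by (simp add: field_simps)
  then have mp: "m powr p \<le> integral {0..1} (\<lambda>t. norm (U t) powr p)"
    using m by (simp add: powr_diff field_simps)
  have "((\<lambda>t. norm (U t) powr p) has_integral integral {0..1} (\<lambda>t. norm (U t) powr p)) {0..1}"
    using ip by blast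
  then have "(\<integral>\<^sup>+t. ennreal (norm (U t) powr p) * indicator {0..1} t \<partial>lborel) 
      = ennreal (integral {0..1} (\<lambda>t. norm (U t) powr p))"
    by (intro nn_integral_has_integral_lebesgue') auto
  then show ?thesis
    using mp by (simp add: m_def U_def e_def ennreal_leI)
qed


text \<open>The circle mean is integrated over all z in the disc and the two integrals are
  exchanged; rotation invariance makes the area integral independent of the angle t, so polar
  coordinates do not enter.\<close>

lemma norm_powr_le_disc_mean:
  assumes hol: "u holomorphic_on ball c s" and p: "1 < p" and s: "0 < s"
  shows "ennreal (norm (u c) powr p * (pi * s\<^sup>2)) \<le>
     (\<integral>\<^sup>+z. ennreal (norm (u z) powr p) * indicator (ball c s) z \<partial>lborel)"
proof -
  define F where "F z = ennreal (norm (u z) powr p) * indicator (ball c s) z" for z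
  define e where "e t = exp (2 * of_real pi * \<i> * of_real t)" for t :: real
  have ne: "norm (e t) = 1" for t
    by (simp add: e_def norm_exp_eq_Re)
  have [measurable]: "F \<in> borel_measurable borel"
    unfolding F_def
    by (intro borel_measurable_ennreal_indicator continuous_on_powr' continuous_intros
         holomorphic_on_imp_continuous_on[OF hol]) (use p in auto)
  have [measurable]: "e \<in> borel_measurable borel"
    unfolding e_def by measurable
  have tr: "(\<integral>\<^sup>+z. F (c + z) \<partial>lborel) = (\<integral>\<^sup>+z. F z \<partial>lborel)"
    by (subst (2) lborel_distr_plus[of c, symmetric], subst nn_integral_distr) auto
  have "ennreal (norm (u c) powr p * (pi * s\<^sup>2)) = (\<integral>\<^sup>+z. ennreal (norm (u c) powr p) * indicator (ball 0 s) (z :: complex) \<partial>lborel)"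
    using s by (subst nn_integral_cmult_indicator) (auto simp: emeasure_ball ennreal_mult unit_ball_vol_2)
  also have "\<dots> \<le> (\<integral>\<^sup>+z. \<integral>\<^sup>+t. F (c + e t * z) * indicator {0..1} t \<partial>lborel \<partial>lborel)"
  proof (rule nn_integral_mono)
    fix z :: complex
    show "ennreal (norm (u c) powr p) * indicator (ball 0 s) z \<le> (\<integral>\<^sup>+t. F (c + e t * z) * indicator {0..1} t \<partial>lborel)"
    proof (cases "norm z < s")
      case True
      then have "F (c + e t * z) = ennreal (norm (u (c + e t * z)) powr p)" for t
        by (simp add: F_def dist_norm norm_mult ne)
      then show ?thesis
        using norm_powr_le_circle_mean[OF hol True p] True by (simp add: e_def)
    qed (simp add: indicator_def)
  qed
  also have "\<dots> = (\<integral>\<^sup>+t. \<integral>\<^sup>+z. F (c + e t * z) * indicator {0..1} t \<partial>lborel \<partial>lborel)"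
  proof (rule lborel_pair.Fubini')
    show "(\<lambda>(t, z). F (c + e t * z) * indicator {0..1} t) \<in> borel_measurable (lborel \<Otimes>\<^sub>M lborel)"
      by measurable
  qed
  also have "\<dots> = (\<integral>\<^sup>+t. (\<integral>\<^sup>+z. F (c + e t * z) \<partial>lborel) * indicator {0..1} t \<partial>lborel)"
    by (intro nn_integral_cong nn_integral_multc) measurable
  also have "\<dots> = (\<integral>\<^sup>+t. (\<integral>\<^sup>+z. F z \<partial>lborel) * indicator {0..1} (t::real) \<partial>lborel)"
  proof (rule nn_integral_cong)
    fix t :: real
    have "(\<integral>\<^sup>+z. F (c + e t * z) \<partial>lborel) = (\<integral>\<^sup>+z. F (c + z) \<partial>lborel)"
      using nn_integral_rotate[of "\<lambda>z. F (c + z)" "e t"] ne by simp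
    then show "(\<integral>\<^sup>+z. F (c + e t * z) \<partial>lborel) * indicator {0..1} t = (\<integral>\<^sup>+z. F z \<partial>lborel) * indicator {0..1} t"
      using tr by simp
  qed
  also have "\<dots> = (\<integral>\<^sup>+z. F z \<partial>lborel)"
    by (subst nn_integral_cmult_indicator) auto
  finally show ?thesis by (simp add: F_def)
qed

text \<open>Disc means of radius s/2 bound u on the closed ball of radius s/2 about c, and Cauchy's
  estimate on that ball bounds the derivative. The power s^(p+2) is s^p from the derivative times
  s^2 from the area.\<close>

lemma norm_deriv_powr_le_disc_mean:
  assumes hol: "u holomorphic_on ball c s" and p: "1 < p" and s: "s > 0"
  shows "ennreal (norm (deriv u c) powr p) \<le> ennreal (2 powr p * 4 / (pi * s powr (p + 2))) *
     (\<integral>\<^sup>+z. ennreal (norm (u z) powr p) * indicator (ball c s) z \<partial>lborel)"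
proof -
  define I where "I = (\<integral>\<^sup>+z. ennreal (norm (u z) powr p) * indicator (ball c s) z \<partial>lborel)"
  show ?thesis
  proof (cases "I = \<infinity>")
    case True
    then show ?thesis using s unfolding I_def by (simp add: ennreal_mult_top)
  next
    case False
    then obtain J where J: "I = ennreal J" "J \<ge> 0" by (cases I) auto
    define M where "M = (4 * J / (pi * s\<^sup>2)) powr (1 / p)"
    have bd: "norm (u z) \<le> M" if z: "z \<in> cball c (s / 2)" for z
    proof -
      have sub: "ball z (s / 2) \<subseteq> ball c s"
      proof
        fix x assume "x \<in> ball z (s / 2)"
        then show "x \<in> ball c s" using z dist_triangle[of c x z] by simp
      qed
      have "ennreal (norm (u z) powr p * (pi * (s / 2)\<^sup>2)) \<le>
        (\<integral>\<^sup>+x. ennreal (norm (u x) powr p) * indicator (ball z (s / 2)) x \<partial>lborel)"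
        by (rule norm_powr_le_disc_mean[OF holomorphic_on_subset[OF hol sub] p]) (use s in simp)
      also have "\<dots> \<le> I"
        unfolding I_def using sub by (intro nn_integral_mono) (auto split: split_indicator)
      finally have "norm (u z) powr p * (pi * (s / 2)\<^sup>2) \<le> J"
        using J by simp
      then have "norm (u z) powr p \<le> 4 * J / (pi * s\<^sup>2)"
        using s by (simp add: field_simps power2_eq_square)
      then have "(norm (u z) powr p) powr (1 / p) \<le> M"
        unfolding M_def using p by (intro powr_mono2) auto
      then show ?thesis using p by (simp add: powr_powr)
    qed
    have M: "M \<ge> 0" by (simp add: M_def)
    have sub2: "cball c (s / 2) \<subseteq> ball c s" using s by (auto simp: dist_norm)
    have "norm ((deriv ^^ 1) u c) \<le> fact 1 * M / (s / 2) ^ 1"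
    proof (rule Cauchy_inequality)
      show "u holomorphic_on ball c (s / 2)"
        by (rule holomorphic_on_subset[OF hol]) (use sub2 in auto)
      show "continuous_on (cball c (s / 2)) u"
        by (rule holomorphic_on_imp_continuous_on, rule holomorphic_on_subset[OF hol sub2])
      show "norm (u x) \<le> M" if "norm (c - x) = s / 2" for x
        using bd[of x] that by (simp add: dist_norm)
    qed (use s in auto)
    then have "norm (deriv u c) powr p \<le> (2 * M / s) powr p"
      using p by (intro powr_mono2) (auto simp: mult.commute)
    also have "\<dots> = 2 powr p * M powr p / s powr p"
      using M s by (simp add: powr_mult powr_divide)
    also have "M powr p = 4 * J / (pi * s\<^sup>2)"
      using p J s by (simp add: M_def powr_powr)
    also have "2 powr p * (4 * J / (pi * s\<^sup>2)) / s powr p = 2 powr p * 4 / (pi * s powr (p + 2)) * J"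
      using s by (simp add: powr_add mult_ac)
    finally show ?thesis
      using J s unfolding I_def[symmetric] by (simp add: ennreal_mult'[symmetric])
  qed
qed

section \<open>Weighted integrals\<close>

text \<open>The exponent is a = p - 2 for first-order quantities such as w' and the pre-Schwarzian,
  and a = 2 p - 2 for second-order ones such as w'' and the Schwarzian: one more derivative costs
  one factor 1-|z|^2, that is, p in the exponent.\<close>

definition weighted_integral :: "real \<Rightarrow> real \<Rightarrow> (complex \<Rightarrow> complex) \<Rightarrow> ennreal" where
  "weighted_integral p a G =
     (\<integral>\<^sup>+ z. ennreal (norm (G z) powr p * (1 - norm z ^ 2) powr a) * indicator unit_disk z \<partial>lborel)"

text \<open>The absolute value covers both signs of the exponent; it is applied with a = p -
  4.\<close>

lemma powr_le_of_comparable: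
  fixes x y k a :: real
  assumes "0 < x" "x \<le> k * y" "y \<le> k * x" "0 < k"
  shows "x powr a \<le> k powr \<bar>a\<bar> * y powr a"
proof (cases "a \<ge> 0")
  case True
  have y: "y > 0" using assms by (metis linorder_not_le mult_nonneg_nonpos order_less_le_trans less_imp_le not_less_iff_gr_or_eq order.trans)
  have "x powr a \<le> (k * y) powr a" using assms True by (intro powr_mono2) auto
  then show ?thesis using assms y True by (simp add: powr_mult)
next
  case False
  have y: "y > 0" using assms by (metis linorder_not_le mult_nonneg_nonpos order_less_le_trans less_imp_le not_less_iff_gr_or_eq order.trans)
  have "x powr a \<le> (y / k) powr a"
    using assms False y by (intro powr_mono2') (auto simp: field_simps)
  also have "\<dots> = k powr \<bar>a\<bar> * y powr a"
    using False assms y by (simp add: powr_divide powr_minus field_simps)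
  finally show ?thesis .
qed

lemma disk_weight_bounds:
  assumes "norm (z :: complex) < 1"
  shows "1 - norm z \<le> 1 - norm z ^ 2" "1 - norm z ^ 2 \<le> 2 * (1 - norm z)" "0 < 1 - norm z ^ 2"
proof -
  have e: "1 - norm z ^ 2 = (1 - norm z) * (1 + norm z)" by (simp add: power2_eq_square algebra_simps)
  show "1 - norm z \<le> 1 - norm z ^ 2"
    unfolding e using mult_left_mono[of 1 "1 + norm z" "1 - norm z"] assms by simp
  show "1 - norm z ^ 2 \<le> 2 * (1 - norm z)"
    unfolding e using mult_left_mono[of "1 + norm z" 2 "1 - norm z"] assms by simp
  show "0 < 1 - norm z ^ 2"
    unfolding e using assms by (intro mult_pos_pos) (auto simp: add_pos_nonneg)
qed

lemma borel_measurable_weighted: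
  fixes u :: "complex \<Rightarrow> complex"
  assumes "continuous_on (ball 0 1) u" "1 < p"
  shows "(\<lambda>z. ennreal (norm (u z) powr p * (1 - norm z ^ 2) powr a) * indicator (ball 0 1) z) \<in> borel_measurable borel"
proof -
  have "continuous_on (ball 0 1) (\<lambda>z. norm (u z) powr p)"
    by (rule continuous_on_powr') (use assms in \<open>auto intro!: continuous_intros\<close>)
  moreover have "continuous_on (ball 0 1) (\<lambda>z::complex. (1 - norm z ^ 2) powr a)"
    by (rule continuous_on_powr) (use disk_weight_bounds(3) in \<open>force intro!: continuous_intros\<close>)+
  ultimately show ?thesis
    by (intro borel_measurable_ennreal_indicator continuous_on_mult) auto
qed

lemma ball_half_distance:
  assumes "z \<in> ball 0 1" "x \<in> ball z ((1 - norm z) / 2)"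
  shows "(1 - norm z) / 2 \<le> 1 - norm x" "1 - norm x \<le> 3 * ((1 - norm z) / 2)" "norm (x :: complex) < 1"
proof -
  have "\<bar>norm z - norm x\<bar> < (1 - norm z) / 2"
    using assms(2) norm_triangle_ineq3[of z x] by (simp add: dist_norm)
  then show "(1 - norm z) / 2 \<le> 1 - norm x" "1 - norm x \<le> 3 * ((1 - norm z) / 2)" "norm x < 1"
    using assms(1) unfolding abs_less_iff by auto
qed

text \<open>The derivative at z is bounded by a mean of |u|^p over a disc of radius comparable to
  1-|z|, and the order of integration is exchanged. The mean leaves the exponent (2p - 2) - (p + 2)
  = p - 4; integrating over z gives back the area of a disc of radius 1-|x|^2, which raises it to p
  - 2.\<close>

lemma weighted_integral_deriv:
  assumes hol: "u holomorphic_on ball 0 1" and p: "1 < p"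
    and fin: "weighted_integral p (p - 2) u < \<infinity>"
  shows "weighted_integral p (2 * p - 2) (deriv u) < \<infinity>"
proof -
  \<comment> \<open>The factors come from 1-|z|^2 <= 4 s, from the mean value estimate for the
    derivative, and from s and 1-|x|^2 being comparable up to the factor 6.\<close>
  define K where "K = 4 powr (2 * p - 2) * (2 powr p * 4 / pi) * 6 powr \<bar>p - 4\<bar>"
  have K: "K > 0" using p by (simp add: K_def)
  define H where "H x = ennreal (norm (u x) powr p * (1 - norm x ^ 2) powr (p - 4)) * indicator (ball 0 1) x" for x
  have cu: "continuous_on (ball 0 1) u" by (rule holomorphic_on_imp_continuous_on[OF hol])
  have Hm [measurable]: "H \<in> borel_measurable borel"
    unfolding H_def by (rule borel_measurable_weighted[OF cu p])
  have pt: "ennreal (norm (deriv u z) powr p * (1 - norm z ^ 2) powr (2 * p - 2)) * indicator (ball 0 1) z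
      \<le> ennreal K * (\<integral>\<^sup>+x. H x * indicator {x. norm (x - z) < 1 - norm x ^ 2} x \<partial>lborel)" for z
  proof (cases "z \<in> ball 0 1")
    case True
    define s where "s = (1 - norm z) / 2"
    have s: "s > 0" using True by (simp add: s_def)
    have hs: "u holomorphic_on ball z s"
      by (rule holomorphic_on_subset[OF hol]) (use ball_half_distance(3)[OF True] in \<open>auto simp: s_def\<close>)
    have "(1 - norm z ^ 2) powr (2 * p - 2) \<le> (4 * s) powr (2 * p - 2)"
      using True p disk_weight_bounds[of z] by (intro powr_mono2) (auto simp: s_def)
    also have "\<dots> = 4 powr (2 * p - 2) * s powr (2 * p - 2)" using s by (simp add: powr_mult)
    finally have 1: "(1 - norm z ^ 2) powr (2 * p - 2) \<le> 4 powr (2 * p - 2) * s powr (2 * p - 2)" .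
    have "ennreal (norm (deriv u z) powr p * (1 - norm z ^ 2) powr (2 * p - 2))
        \<le> ennreal (norm (deriv u z) powr p) * ennreal (4 powr (2 * p - 2) * s powr (2 * p - 2))"
      using 1 by (subst ennreal_mult'[symmetric]) (auto intro!: ennreal_leI mult_left_mono)
    also have "\<dots> \<le> (ennreal (2 powr p * 4 / (pi * s powr (p + 2))) *
        (\<integral>\<^sup>+x. ennreal (norm (u x) powr p) * indicator (ball z s) x \<partial>lborel)) * ennreal (4 powr (2 * p - 2) * s powr (2 * p - 2))"
      by (intro mult_right_mono norm_deriv_powr_le_disc_mean[OF hs p s]) simp
    also have "\<dots> = ennreal (4 powr (2 * p - 2) * (2 powr p * 4 / pi) * s powr (p - 4)) *
        (\<integral>\<^sup>+x. ennreal (norm (u x) powr p) * indicator (ball z s) x \<partial>lborel)"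
    proof -
      have "2 powr p * 4 / (pi * s powr (p + 2)) * (4 powr (2 * p - 2) * s powr (2 * p - 2))
         = 4 powr (2 * p - 2) * (2 powr p * 4 / pi) * (s powr (2 * p - 2) / s powr (p + 2))"
        by simp
      also have "s powr (2 * p - 2) / s powr (p + 2) = s powr (p - 4)"
        by (simp add: powr_diff[symmetric])
      finally show ?thesis
        by (simp add: ennreal_mult'[symmetric] mult.commute mult.left_commute) 
    qed
    also have "\<dots> = (\<integral>\<^sup>+x. ennreal (4 powr (2 * p - 2) * (2 powr p * 4 / pi) * s powr (p - 4)) *
         (ennreal (norm (u x) powr p) * indicator (ball z s) x) \<partial>lborel)"
      by (rule nn_integral_cmult[symmetric], subst measurable_lborel2, 
          intro borel_measurable_ennreal_indicator continuous_on_powr' continuous_intros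
           holomorphic_on_imp_continuous_on[OF hs]) (use p in auto)
    also have "\<dots> \<le> (\<integral>\<^sup>+x. ennreal K * (H x * indicator {x. norm (x - z) < 1 - norm x ^ 2} x) \<partial>lborel)"
    proof (rule nn_integral_mono)
      fix x :: complex
      show "ennreal (4 powr (2 * p - 2) * (2 powr p * 4 / pi) * s powr (p - 4)) *
         (ennreal (norm (u x) powr p) * indicator (ball z s) x)
         \<le> ennreal K * (H x * indicator {x. norm (x - z) < 1 - norm x ^ 2} x)"
      proof (cases "x \<in> ball z s")
        case x: True
        note b = ball_half_distance[OF True x[unfolded s_def], folded s_def]
        note w = disk_weight_bounds[OF b(3)]
        have c: "s powr (p - 4) \<le> 6 powr \<bar>p - 4\<bar> * (1 - norm x ^ 2) powr (p - 4)"
          by (rule powr_le_of_comparable) (use s b w in auto)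
        have "norm (x - z) < s" using x by (simp add: dist_norm norm_minus_commute)
        then have i: "norm (x - z) < 1 - norm x ^ 2" using b w by linarith
        have "4 powr (2 * p - 2) * (2 powr p * 4 / pi) * s powr (p - 4) * norm (u x) powr p
           \<le> 4 powr (2 * p - 2) * (2 powr p * 4 / pi) * (6 powr \<bar>p - 4\<bar> * (1 - norm x ^ 2) powr (p - 4)) * norm (u x) powr p"
          by (intro mult_right_mono mult_left_mono c) auto
        also have "\<dots> = K * (norm (u x) powr p * (1 - norm x ^ 2) powr (p - 4))" by (simp add: K_def)
        finally show ?thesis
          using x i b(3) K by (simp add: H_def ennreal_mult'[symmetric] ennreal_leI)
      qed simp
    qed
    also have "\<dots> = ennreal K * (\<integral>\<^sup>+x. H x * indicator {x. norm (x - z) < 1 - norm x ^ 2} x \<partial>lborel)"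
      by (rule nn_integral_cmult) measurable
    finally show ?thesis using True by simp
  qed simp
  have m: "(\<lambda>(z, x). H x * indicator {x. norm (x - z) < 1 - norm x ^ 2} x) \<in> borel_measurable (lborel \<Otimes>\<^sub>M lborel)"
  proof -
    have "(\<lambda>(z, x). H x * indicator {x. norm (x - z) < 1 - norm x ^ 2} x) =
      (\<lambda>w. if norm (snd w - fst w) < 1 - norm (snd w) ^ 2 then H (snd w) else 0)"
      by (auto simp: fun_eq_iff)
    then show ?thesis by simp
  qed
  have "weighted_integral p (2 * p - 2) (deriv u) 
      \<le> (\<integral>\<^sup>+z. ennreal K * (\<integral>\<^sup>+x. H x * indicator {x. norm (x - z) < 1 - norm x ^ 2} x \<partial>lborel) \<partial>lborel)"
    unfolding weighted_integral_def by (rule nn_integral_mono) (rule pt)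
  also have "\<dots> = ennreal K * (\<integral>\<^sup>+z. \<integral>\<^sup>+x. H x * indicator {x. norm (x - z) < 1 - norm x ^ 2} x \<partial>lborel \<partial>lborel)"
    using lborel.borel_measurable_nn_integral[OF m] by (intro nn_integral_cmult) simp
  also have "(\<integral>\<^sup>+z. \<integral>\<^sup>+x. H x * indicator {x. norm (x - z) < 1 - norm x ^ 2} x \<partial>lborel \<partial>lborel)
     = (\<integral>\<^sup>+x. \<integral>\<^sup>+z. H x * indicator {x. norm (x - z) < 1 - norm x ^ 2} x \<partial>lborel \<partial>lborel)"
    by (rule lborel_pair.Fubini'[OF m, symmetric])
  also have "\<dots> = (\<integral>\<^sup>+x. ennreal pi * (ennreal (norm (u x) powr p * (1 - norm x ^ 2) powr (p - 2)) * indicator (ball 0 1) x) \<partial>lborel)"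
  proof (rule nn_integral_cong)
    fix x :: complex
    have e: "H x * indicator {x. norm (x - z) < 1 - norm x ^ 2} x = H x * indicator (ball x (1 - norm x ^ 2)) z" for z
      by (simp add: indicator_def dist_norm)
    show "(\<integral>\<^sup>+z. H x * indicator {x. norm (x - z) < 1 - norm x ^ 2} x \<partial>lborel)
      = ennreal pi * (ennreal (norm (u x) powr p * (1 - norm x ^ 2) powr (p - 2)) * indicator (ball 0 1) x)"
    proof (cases "norm x < 1")
      case True
      note w = disk_weight_bounds(3)[OF True]
      have "(1 - norm x ^ 2) powr (p - 2) = (1 - norm x ^ 2) powr (p - 4) * (1 - norm x ^ 2)\<^sup>2"
        using w powr_add[of "1 - norm x ^ 2" "p - 4" 2] by simp
      then show ?thesis
        unfolding e using True w
        by (subst nn_integral_cmult_indicator)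
           (auto simp: emeasure_ball unit_ball_vol_2 H_def ennreal_mult'[symmetric] mult_ac)
    qed (simp add: H_def)
  qed
  also have "\<dots> = ennreal pi * weighted_integral p (p - 2) u"
    unfolding weighted_integral_def
    by (rule nn_integral_cmult) (use borel_measurable_weighted[OF cu p] in simp)
  finally show ?thesis
    using fin by (auto simp: ennreal_mult_less_top intro: le_less_trans)
qed

text \<open>The integral over a thin boundary annulus tends to 0, and the disc of radius s =
  (1-|z|)/2 about z lies in such an annulus. Its mean value estimate has the scale-invariant form
  s^(2p-2) |S|^p \<pi> s^2 = \<pi> (|S| s^2)^p.\<close>

lemma weighted_integral_imp_vanishing:
  assumes hol: "S holomorphic_on ball 0 1" and p: "1 < p"
    and fin: "weighted_integral p (2 * p - 2) S < \<infinity>" and e: "\<epsilon> > 0"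
  shows "\<exists>R<1. \<forall>z. R \<le> norm z \<and> norm z < 1 \<longrightarrow> norm (S z) * (1 - norm z)\<^sup>2 \<le> \<epsilon>"
proof -
  define W where "W z = ennreal (norm (S z) powr p * (1 - norm z ^ 2) powr (2 * p - 2)) * indicator (ball 0 1) z" for z
  have cS: "continuous_on (ball 0 1) S" by (rule holomorphic_on_imp_continuous_on[OF hol])
  have [measurable]: "W \<in> borel_measurable borel"
    unfolding W_def by (rule borel_measurable_weighted[OF cS p])
  define T where "T n z = W z * indicator {z. 1 - 1 / real (Suc n) \<le> norm z} z" for n z
  \<comment> \<open>With s = (1-|z|)/2, the wanted |S| (1-|z|)^2 <= \<epsilon> is |S| s^2 <=
    \<epsilon>/4.\<close>
  define \<tau> where "\<tau> = pi * (\<epsilon> / 4) powr p"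
  have tau: "\<tau> > 0" using e by (simp add: \<tau>_def)
  have "(\<lambda>n. \<integral>\<^sup>+z. T n z \<partial>lborel) \<longlonglongrightarrow> (\<integral>\<^sup>+z. 0 \<partial>(lborel :: complex measure))"
  proof (rule nn_integral_dominated_convergence[where w = W])
    show "(\<integral>\<^sup>+z. W z \<partial>lborel) < \<infinity>" using fin by (simp add: W_def weighted_integral_def)
    show "T n \<in> borel_measurable lborel" for n unfolding T_def by measurable
    show "AE z in lborel. T n z \<le> W z" for n
      unfolding T_def by (auto simp: indicator_def)
    show "AE z in lborel. (\<lambda>n. T n z) \<longlonglongrightarrow> 0"
    proof (rule AE_I2)
      fix z :: complex
      show "(\<lambda>n. T n z) \<longlonglongrightarrow> 0"
      proof (cases "norm z < 1")
        case True
        have "(\<lambda>n. 1 / real (Suc n)) \<longlonglongrightarrow> 0" using LIMSEQ_inverse_real_of_nat by (simp add: inverse_eq_divide)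
        then have "eventually (\<lambda>n. 1 / real (Suc n) < 1 - norm z) sequentially"
          using True by (intro order_tendstoD) auto
        then have "eventually (\<lambda>n. T n z = 0) sequentially"
          by eventually_elim (auto simp: T_def)
        then show ?thesis by (simp add: tendsto_eventually)
      qed (simp add: T_def W_def)
    qed
  qed auto
  then have "(\<lambda>n. \<integral>\<^sup>+z. T n z \<partial>lborel) \<longlonglongrightarrow> 0" by simp
  then have "eventually (\<lambda>n. (\<integral>\<^sup>+z. T n z \<partial>lborel) < ennreal \<tau>) sequentially"
    using tau by (intro order_tendstoD) auto
  then obtain n where n: "(\<integral>\<^sup>+z. T n z \<partial>lborel) < ennreal \<tau>"
    by (auto simp: eventually_sequentially)
  \<comment> \<open>Twice as close to the circle as the annulus of \<open>T n\<close>: points x of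
    the disc about z satisfy 1-|x| <= (3/2)(1-|z|), which must not exceed 1/(n+1).\<close>
  define R where "R = 1 - 1 / (2 * real (Suc n))"
  show ?thesis
  proof (intro exI[of _ R] conjI allI impI)
    show "R < 1" by (simp add: R_def)
    fix z :: complex assume z: "R \<le> norm z \<and> norm z < 1"
    then have zb: "z \<in> ball 0 1" by simp
    define s where "s = (1 - norm z) / 2"
    have s: "s > 0" using z by (simp add: s_def)
    have hs: "S holomorphic_on ball z s"
      by (rule holomorphic_on_subset[OF hol]) (use ball_half_distance(3)[OF zb] in \<open>auto simp: s_def\<close>)
    have "ennreal (s powr (2 * p - 2)) * ennreal (norm (S z) powr p * (pi * s\<^sup>2))
       \<le> ennreal (s powr (2 * p - 2)) * (\<integral>\<^sup>+x. ennreal (norm (S x) powr p) * indicator (ball z s) x \<partial>lborel)"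
      by (intro mult_left_mono norm_powr_le_disc_mean[OF hs p s]) simp
    also have "\<dots> = (\<integral>\<^sup>+x. ennreal (s powr (2 * p - 2)) * (ennreal (norm (S x) powr p) * indicator (ball z s) x) \<partial>lborel)"
      by (rule nn_integral_cmult[symmetric], subst measurable_lborel2, 
          intro borel_measurable_ennreal_indicator continuous_on_powr' continuous_intros
           holomorphic_on_imp_continuous_on[OF hs]) (use p in auto)
    also have "\<dots> \<le> (\<integral>\<^sup>+x. T n x \<partial>lborel)"
    proof (rule nn_integral_mono)
      fix x :: complex
      show "ennreal (s powr (2 * p - 2)) * (ennreal (norm (S x) powr p) * indicator (ball z s) x) \<le> T n x"
      proof (cases "x \<in> ball z s")
        case x: True
        note b = ball_half_distance[OF zb x[unfolded s_def], folded s_def]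
        note w = disk_weight_bounds[OF b(3)]
        have "s powr (2 * p - 2) \<le> (1 - norm x ^ 2) powr (2 * p - 2)"
          using s b w p by (intro powr_mono2) auto
        then have "s powr (2 * p - 2) * norm (S x) powr p \<le> norm (S x) powr p * (1 - norm x ^ 2) powr (2 * p - 2)"
          by (simp add: mult.commute mult_left_mono)
        moreover have "1 - norm x \<le> 1 / real (Suc n)"
        proof -
          define X where "X = 1 / (2 * real (Suc n))"
          have "3 * s \<le> 3/2 * X" using z unfolding s_def R_def X_def[symmetric] by simp
          also have "\<dots> \<le> 1 / real (Suc n)" by (simp add: X_def field_simps)
          finally show ?thesis using b by simp
        qed
        ultimately show ?thesis
          using x b(3) by (simp add: T_def W_def ennreal_mult'[symmetric] ennreal_leI)
      qed simp
    qed
    finally have "ennreal (s powr (2 * p - 2) * (norm (S z) powr p * (pi * s\<^sup>2))) < ennreal \<tau>"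
      using n by (simp add: ennreal_mult'[symmetric])
    then have "s powr (2 * p - 2) * (norm (S z) powr p * (pi * s\<^sup>2)) < pi * (\<epsilon> / 4) powr p"
      using tau by (subst (asm) ennreal_less_iff) (auto simp: \<tau>_def)
    moreover have "s powr (2 * p - 2) * s\<^sup>2 = (s\<^sup>2) powr p"
    proof -
      have "s\<^sup>2 = s powr 2" using s by simp
      then show ?thesis using s by (simp only: powr_powr powr_add[symmetric]) simp
    qed
    moreover have "(norm (S z) * s\<^sup>2) powr p = norm (S z) powr p * (s\<^sup>2) powr p"
      by (simp add: powr_mult)
    ultimately have "pi * (norm (S z) * s\<^sup>2) powr p < pi * (\<epsilon> / 4) powr p"
      by (metis mult.assoc mult.commute)
    then have "(norm (S z) * s\<^sup>2) powr p < (\<epsilon> / 4) powr p" by simp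
    then have "norm (S z) * s\<^sup>2 < \<epsilon> / 4"
      using p e s by (metis powr_mono2 not_le divide_nonneg_nonneg less_imp_le zero_le_numeral order.strict_trans zero_less_one)
    then show "norm (S z) * (1 - norm z)\<^sup>2 \<le> \<epsilon>"
      by (simp add: s_def power_divide)
  qed
qed

section \<open>Boundary decay of the pre-Schwarzian\<close>

text \<open>For S = 0 the quotient u = P/(y - 2), with y = (1-r) P, is constant along solutions; in
  general u' = -2 S/(y - 2)^2 has no term quadratic in P. Since |y|/|y - 2| = (1-r)|u|, a bound on u
  shows decay proportional to 1 - r up to an error from S.\<close>

lemma riccati_attracting:
  fixes P S :: "real \<Rightarrow> complex"
  assumes P': "\<And>r. a \<le> r \<Longrightarrow> r < 1 \<Longrightarrow> (P has_vector_derivative S r + (P r)\<^sup>2 / 2) (at r)"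
    and S: "\<And>r. a \<le> r \<Longrightarrow> r < 1 \<Longrightarrow> norm (S r) * (1 - r)\<^sup>2 \<le> \<epsilon>"
    and start: "norm (of_real (1 - a) * P a - 2) \<ge> 1/2"
    and e: "\<epsilon> \<le> 1 / 100" and r: "a \<le> r" "r < 1"
  shows "(1 - r) * norm (P r) \<le> (5 * (1 - r) / (1 - a) + 25 * \<epsilon>) * norm (of_real (1 - r) * P r - 2)"
proof -
  have e0: "\<epsilon> \<ge> 0" by (rule order_trans[OF _ S[OF r]]) simp
  define y where "y r = of_real (1 - r) * P r" for r
  define u where "u r = P r / (y r - 2)" for r
  have cP: "continuous_on {a..b} P" if "b < 1" for b
  proof (rule continuous_at_imp_continuous_on, intro ballI)
    fix x assume "x \<in> {a..b}"
    then show "isCont P x"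
      using P'[of x] that by (auto intro: has_vector_derivative_continuous)
  qed
  have cy: "continuous_on {a..b} y" if "b < 1" for b
    unfolding y_def by (intro continuous_intros cP that)
  have nu: "norm (y r) = (1 - r) * norm (P r)" if "r < 1" for r
    using that unfolding y_def norm_mult norm_of_real by simp
  \<comment> \<open>From |y| <= |y - 2| + 2 and 2 <= 4 |y - 2|.\<close>
  have start': "norm (y a) \<le> 5 * norm (y a - 2)"
  proof -
    have "norm (y a) \<le> norm (y a - 2) + 2"
      using norm_triangle_sub[of "y a" 2] by simp
    then show ?thesis using start by (simp add: y_def)
  qed
  \<comment> \<open>A priori estimate: while |y| <= 6 |y - 2|, the value y keeps distance 2/7 from
    2, so |u'| <= (49/2) |S| <= 25 \<epsilon>/(1-x)^2, and this integrates to the claim.\<close>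
  have step: "norm (y b) \<le> (5 * (1 - b) / (1 - a) + 25 * \<epsilon>) * norm (y b - 2)"
    if b: "a \<le> b" "b < 1" and nz: "\<And>x. a \<le> x \<Longrightarrow> x \<le> b \<Longrightarrow> norm (y x) \<le> 6 * norm (y x - 2)" for b
  proof (cases "a = b")
    case True
    have "0 \<le> 25 * \<epsilon> * norm (y b - 2)" using e0 by simp
    moreover have "5 * (1 - b) / (1 - a) = 5" using b True by (simp add: field_simps)
    ultimately show ?thesis using start' True unfolding distrib_right by simp
  next
    case False
    with b have ab: "a < b" by simp
    have nz2: "y x \<noteq> 2" if "a \<le> x" "x \<le> b" for x
      using nz[OF that] by auto
    have u': "(u has_vector_derivative - S x * (2 / (y x - 2))\<^sup>2 / 2) (at x)" if x: "a \<le> x" "x \<le> b" for x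
    proof -
      have d: "(P has_vector_derivative S x + (P x)\<^sup>2 / 2) (at x)" using P' x b by simp
      have dy: "(y has_vector_derivative (of_real (1 - x) * (S x + (P x)\<^sup>2 / 2) - P x)) (at x)"
        unfolding y_def 
        by (rule derivative_eq_intros d refl | simp)+
      have "((\<lambda>x. inverse (y x - 2)) has_vector_derivative 
         - (of_real (1 - x) * (S x + (P x)\<^sup>2 / 2) - P x) / (y x - 2)\<^sup>2) (at x)"
      proof -
        have "((\<lambda>w. inverse (w - 2)) has_field_derivative - (1 / (y x - 2)\<^sup>2)) (at (y x))"
          using nz2[OF x] by (auto intro!: derivative_eq_intros simp: power2_eq_square field_simps)
        from field_vector_diff_chain_at[OF dy this] show ?thesis by (simp add: o_def) (simp add: minus_divide_left)
      qed
      then have "((\<lambda>x. P x * inverse (y x - 2)) has_vector_derivative 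
         P x * (- (of_real (1 - x) * (S x + (P x)\<^sup>2 / 2) - P x) / (y x - 2)\<^sup>2)
         + (S x + (P x)\<^sup>2 / 2) * inverse (y x - 2)) (at x)"
        by (rule has_vector_derivative_mult[OF d])
      also have "P x * (- (of_real (1 - x) * (S x + (P x)\<^sup>2 / 2) - P x) / (y x - 2)\<^sup>2)
         + (S x + (P x)\<^sup>2 / 2) * inverse (y x - 2) = - S x * (2 / (y x - 2))\<^sup>2 / 2"
      proof -
        have n: "y x - 2 \<noteq> 0" using nz2[OF x] by simp
        have "P x * (- (of_real (1 - x) * (S x + (P x)\<^sup>2 / 2) - P x))
         + (S x + (P x)\<^sup>2 / 2) * (y x - 2) = - S x * 2"
        proof -
          have "p * (- (c * Q - p)) + Q * (c * p - 2) = p * p - 2 * Q" for p c Q :: complex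
            by (simp add: algebra_simps)
          then show ?thesis unfolding y_def by (simp add: power2_eq_square)
        qed
        then have "(P x * (- (of_real (1 - x) * (S x + (P x)\<^sup>2 / 2) - P x))
         + (S x + (P x)\<^sup>2 / 2) * (y x - 2)) / (y x - 2)\<^sup>2 = - S x * 2 / (y x - 2)\<^sup>2" by simp
        moreover have "p * (- K / m\<^sup>2) + Q * inverse m = (p * (- K) + Q * m) / m\<^sup>2"
          if "m \<noteq> 0" for p K Q m :: complex
          using that by (simp add: field_simps power2_eq_square)
        moreover have "- s * (2 / m)\<^sup>2 / 2 = - s * 2 / m\<^sup>2" for s m :: complex
          by (simp add: power_divide)
        ultimately show ?thesis using n by metis
      qed
      finally show ?thesis unfolding u_def divide_inverse[of "P _"] .
    qed
    have "norm (u b - u a) \<le> 25 * \<epsilon> / (1 - b) - 25 * \<epsilon> / (1 - a)"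
    proof (rule differentiable_bound_general[OF ab])
      show "continuous_on {a..b} u"
        unfolding u_def by (intro continuous_intros cP cy b) (use nz2 in auto)
      show "continuous_on {a..b} (\<lambda>x. 25 * \<epsilon> / (1 - x))"
        using b by (intro continuous_intros) auto
      fix x assume x: "a < x" "x < b"
      show "(u has_vector_derivative - S x * (2 / (y x - 2))\<^sup>2 / 2) (at x)" using u' x by simp
      show "((\<lambda>x. 25 * \<epsilon> / (1 - x)) has_vector_derivative 25 * \<epsilon> / (1 - x)\<^sup>2) (at x)"
        unfolding has_real_derivative_iff_has_vector_derivative[symmetric]
        using x b by (auto intro!: derivative_eq_intros simp: power2_eq_square)
      have n: "norm (y x - 2) > 0" using nz2[of x] x by simp
      have "2 \<le> norm (y x - 2) + norm (y x)"
        using norm_triangle_ineq4[of "y x" "y x - 2"] by simp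
      then have "2 \<le> 7 * norm (y x - 2)" using nz[of x] x by simp
      then have "2 / norm (y x - 2) \<le> 7" using n by (simp add: field_simps)
      then have "(2 / norm (y x - 2))\<^sup>2 \<le> 7\<^sup>2" by (intro power_mono) auto
      then have "(2 / norm (y x - 2))\<^sup>2 \<le> 49" by simp
      then have "norm (S x) * (2 / norm (y x - 2))\<^sup>2 / 2 \<le> norm (S x) * 25"
        using mult_left_mono[of "(2 / norm (y x - 2))\<^sup>2" 49 "norm (S x)"] norm_ge_zero[of "S x"]
        by linarith
      also have "\<dots> \<le> 25 * \<epsilon> / (1 - x)\<^sup>2"
        using S[of x] x b by (simp add: field_simps)
      finally show "norm (- S x * (2 / (y x - 2))\<^sup>2 / 2) \<le> 25 * \<epsilon> / (1 - x)\<^sup>2"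
        by (simp add: norm_mult norm_divide norm_power)
    qed
    then have "norm (u b) \<le> norm (u a) + 25 * \<epsilon> / (1 - b)"
    proof -
      have "0 \<le> 25 * \<epsilon> / (1 - a)" using e0 ab b by simp
      then show ?thesis
        using \<open>norm (u b - u a) \<le> _\<close> norm_triangle_sub[of "u b" "u a"] by linarith
    qed
    then have "(1 - b) * norm (u b) \<le> (1 - b) * (norm (u a) + 25 * \<epsilon> / (1 - b))"
      using b by (intro mult_left_mono) auto
    also have "\<dots> = (1 - b) * norm (u a) + 25 * \<epsilon>" using b by (simp add: distrib_left)
    also have "norm (u a) \<le> 5 / (1 - a)"
    proof -
      have n: "norm (y a - 2) > 0" using nz2[of a] b by simp
      have "(1 - a) * norm (P a) \<le> 5 * norm (y a - 2)" using start' nu[of a] ab b by simp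
      then show ?thesis using n ab b by (simp add: u_def norm_divide field_simps)
    qed
    finally have "(1 - b) * norm (u b) \<le> 5 * (1 - b) / (1 - a) + 25 * \<epsilon>"
      using b by (simp add: mult_ac)
    moreover have "norm (y b) = (1 - b) * norm (u b) * norm (y b - 2)"
      using nz2[of b] b nu[of b] by (simp add: u_def norm_divide)
    ultimately show ?thesis by (simp add: mult_right_mono)
  qed
  \<comment> \<open>Continuity argument: at the first violation the a priori estimate is still
    available and, by \<epsilon> <= 1/100, yields the constant 5 + 1/4, which is below 6.\<close>
  have inv: "norm (y x) < 6 * norm (y x - 2)" if x: "a \<le> x" "x < 1" for x
  proof (rule ccontr)
    assume contra: "\<not> ?thesis"
    define T where "T = {t \<in> {a..x}. 6 * norm (y t - 2) \<le> norm (y t)}"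
    have "closed T"
      unfolding T_def using x by (intro continuous_on_closed_Collect_le continuous_intros cy) auto
    moreover have "x \<in> T" using contra x by (auto simp: T_def)
    moreover have "T \<subseteq> {a..x}" by (auto simp: T_def)
    ultimately have "compact T" "T \<noteq> {}"
      by (auto simp: compact_eq_bounded_closed intro: bounded_subset[OF bounded_closed_interval])
    then obtain b where b: "b \<in> T" "\<And>t. t \<in> T \<Longrightarrow> b \<le> t"
      using compact_attains_inf by metis
    have ab: "a \<le> b" "b \<le> x" "b < 1" using b x by (auto simp: T_def)
    have lt: "norm (y t) < 6 * norm (y t - 2)" if "a \<le> t" "t < b" for t
      using b(2)[of t] that ab unfolding T_def by force
    have le: "norm (y b) \<le> 6 * norm (y b - 2)"
    proof (cases "a = b")
      case True
      then show ?thesis using start' norm_ge_zero[of "y b - 2"] by (simp del: norm_ge_zero)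
    next
      case False
      have "closure {a..<b} \<subseteq> {t \<in> {a..b}. norm (y t) \<le> 6 * norm (y t - 2)}"
      proof (rule closure_minimal)
        show "closed {t \<in> {a..b}. norm (y t) \<le> 6 * norm (y t - 2)}"
          using ab by (intro continuous_on_closed_Collect_le continuous_intros cy) auto
      qed (use lt in \<open>auto intro: less_imp_le\<close>)
      moreover have "b \<in> closure {a..<b}" using False ab by simp
      ultimately show ?thesis by blast
    qed
    have "norm (y b) \<le> (5 * (1 - b) / (1 - a) + 25 * \<epsilon>) * norm (y b - 2)"
      proof (rule step[OF ab(1,3)])
      show "norm (y t) \<le> 6 * norm (y t - 2)" if "a \<le> t" "t \<le> b" for t
        using lt[of t] le that by (cases "t = b") auto
    qed
    also have "\<dots> \<le> (5 + 1/4) * norm (y b - 2)"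
    proof (intro mult_right_mono add_mono)
      show "5 * (1 - b) / (1 - a) \<le> 5" using ab by (simp add: field_simps)
    qed (use e in auto)
    finally have 54: "norm (y b) \<le> (5 + 1/4) * norm (y b - 2)" .
    moreover have "6 * norm (y b - 2) \<le> norm (y b)" using b(1) by (simp add: T_def)
    moreover have "4 * norm (y b) \<le> 21 * norm (y b - 2)" using 54 by simp
    ultimately have "norm (y b - 2) \<le> 0" by linarith
    then have "y b = 2" by simp
    with 54 show False by simp
  qed
  have "norm (y r) \<le> (5 * (1 - r) / (1 - a) + 25 * \<epsilon>) * norm (y r - 2)"
    by (rule step[OF r]) (use inv r in \<open>auto intro: less_imp_le\<close>)
  then show ?thesis using nu[OF r(2)] by (simp add: y_def)
qed

text \<open>If y = (1-r) P stayed within 1/2 of 2, then Re y >= 3/2, and |F|^2 (1-r)^3 would be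
  nondecreasing, its logarithmic derivative being (2 Re y - 3)/(1-r). Then |F| would grow at least
  like (1-r)^(-3/2), faster than C/(1-r); \<open>big\<close> says that b is close enough to 1 for
  the contradiction.\<close>

lemma exists_ray_point_off_pole:
  fixes F P :: "real \<Rightarrow> complex"
  assumes F': "\<And>r. a \<le> r \<Longrightarrow> r \<le> b \<Longrightarrow> (F has_vector_derivative F r * P r) (at r)"
    and ab: "a \<le> b" "b < 1"
    and m: "m \<le> norm (F a)" "0 \<le> m"
    and C: "norm (F b) * (1 - b) \<le> C"
    and big: "C\<^sup>2 * (1 - b) < m\<^sup>2 * (1 - a) ^ 3"
  obtains r where "a \<le> r" "r \<le> b" "norm (of_real (1 - r) * P r - 2) \<ge> 1/2"
proof -
  have "\<exists>r. a \<le> r \<and> r \<le> b \<and> norm (of_real (1 - r) * P r - 2) \<ge> 1/2"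
  proof (rule ccontr)
    assume "\<not> ?thesis"
    then have near: "norm (of_real (1 - r) * P r - 2) < 1/2" if "a \<le> r" "r \<le> b" for r
      using that by force
    define W where "W r = (F r \<bullet> F r) * (1 - r) ^ 3" for r
    have "W a \<le> W b"
    proof (rule DERIV_nonneg_imp_nondecreasing[OF ab(1)])
      fix r assume r: "a \<le> r" "r \<le> b"
      have "(F has_derivative (\<lambda>h. h *\<^sub>R (F r * P r))) (at r)"
        using F'[OF r] by (simp add: has_vector_derivative_def)
      then have "((\<lambda>r. F r \<bullet> F r) has_derivative (\<lambda>h. F r \<bullet> (h *\<^sub>R (F r * P r)) + (h *\<^sub>R (F r * P r)) \<bullet> F r)) (at r)"
        by (rule has_derivative_inner) fact
      also have "(\<lambda>h. F r \<bullet> (h *\<^sub>R (F r * P r)) + (h *\<^sub>R (F r * P r)) \<bullet> F r)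
        = (\<lambda>h. h * (2 * Re (P r) * (F r \<bullet> F r)))"
        by (auto simp: fun_eq_iff inner_complex_def algebra_simps)
      finally have d: "((\<lambda>r. F r \<bullet> F r) has_real_derivative 2 * Re (P r) * (F r \<bullet> F r)) (at r)"
        by (simp add: has_field_derivative_def mult.commute[of _ "2 * _ * _"] mult_commute_abs)
      have "(W has_real_derivative (F r \<bullet> F r) * (1 - r)\<^sup>2 * (2 * ((1 - r) * Re (P r)) - 3)) (at r)"
        unfolding W_def
        by (rule derivative_eq_intros d refl)+ (simp add: algebra_simps power2_eq_square power3_eq_cube)
      moreover have "\<bar>(1 - r) * Re (P r) - 2\<bar> < 1/2"
      proof -
        have "Re (of_real (1 - r) * P r - 2) = (1 - r) * Re (P r) - 2" by simp
        then show ?thesis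
          using near[OF r] abs_Re_le_cmod[of "of_real (1 - r) * P r - 2"] by simp
      qed
      then have "2 * ((1 - r) * Re (P r)) - 3 \<ge> 0"
        by linarith
      ultimately show "\<exists>y. (W has_real_derivative y) (at r) \<and> 0 \<le> y"
        by (intro exI conjI) auto
    qed
    moreover have "W b \<le> C\<^sup>2 * (1 - b)"
    proof -
      have "W b = (norm (F b) * (1 - b))\<^sup>2 * (1 - b)"
        by (simp add: W_def power2_norm_eq_inner[symmetric] power_mult_distrib power2_eq_square power3_eq_cube)
      also have "\<dots> \<le> C\<^sup>2 * (1 - b)"
        using C ab by (intro mult_right_mono power_mono) auto
      finally show ?thesis .
    qed
    moreover have "m\<^sup>2 * (1 - a) ^ 3 \<le> W a"
      unfolding W_def power2_norm_eq_inner[symmetric]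
      using m ab by (intro mult_right_mono power_mono) auto
    ultimately show False using big by simp
  qed
  then show ?thesis using that by blast
qed

text \<open>In the variable $y = (1-r)P$ the Riccati equation $P' = S + P^2/2$ on a ray is a small
  perturbation of $(1-r)y' = y(y-2)/2$, whose fixed point 0 attracts and whose fixed point 2 repels.
  Staying near 2 would make $|F|$ grow like $(1-r)^{-2}$, which the growth bound on $F$ forbids.\<close>

lemma pre_schwarzian_vanishes_at_boundary:
  assumes hol: "F holomorphic_on ball 0 1" and nz: "\<And>z. z \<in> ball 0 1 \<Longrightarrow> F z \<noteq> 0"
    and growth: "\<And>z. z \<in> ball 0 1 \<Longrightarrow> norm (F z) * (1 - norm z) \<le> C"
    and P: "\<And>z. z \<in> ball 0 1 \<Longrightarrow> P z = deriv F z / F z"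
    and S: "\<And>z. z \<in> ball 0 1 \<Longrightarrow> S z = deriv P z - (P z)\<^sup>2 / 2"
    and small: "\<And>\<epsilon>. \<epsilon> > 0 \<Longrightarrow> \<exists>R<1. \<forall>z. R \<le> norm z \<and> norm z < 1 \<longrightarrow> norm (S z) * (1 - norm z)\<^sup>2 \<le> \<epsilon>"
    and eta: "\<eta> > 0"
  shows "\<exists>R<1. \<forall>z. R \<le> norm z \<and> norm z < 1 \<longrightarrow> norm (P z) * (1 - norm z) \<le> \<eta>"
proof -
  \<comment> \<open>Chosen so that 25 \<epsilon> is at most the \<open>k\<close> defined below and
    \<epsilon> <= 1/100, as \<open>riccati_attracting\<close> requires.\<close>
  define \<epsilon> where "\<epsilon> = min (1/100) (\<eta> / 200)"
  have e: "\<epsilon> > 0" "\<epsilon> \<le> 1/100" "\<epsilon> \<le> \<eta> / 200" using eta by (auto simp: \<epsilon>_def)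
  obtain R0 where R0: "R0 < 1" "\<And>z. R0 \<le> norm z \<Longrightarrow> norm z < 1 \<Longrightarrow> norm (S z) * (1 - norm z)\<^sup>2 \<le> \<epsilon>"
    using small[OF e(1)] by blast
  define a where "a = max R0 0"
  have a: "0 \<le> a" "a < 1" "R0 \<le> a" using R0 by (auto simp: a_def)
  have cF: "continuous_on (sphere 0 a) (\<lambda>z. norm (F z))"
    by (intro continuous_intros holomorphic_on_imp_continuous_on holomorphic_on_subset[OF hol])
       (use a in auto)
  have ne: "sphere 0 a \<noteq> ({} :: complex set)"
    using a by simp
  obtain z0 where z0: "z0 \<in> sphere 0 a" "\<And>z. z \<in> sphere 0 a \<Longrightarrow> norm (F z0) \<le> norm (F z)"
    using continuous_attains_inf[OF compact_sphere ne cF] by blast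
  define m where "m = norm (F z0)"
  have m: "m > 0" using nz[of z0] z0 a by (simp add: m_def)
  \<comment> \<open>Makes C^2 (1-b) at most half of m^2 (1-a)^3; the added 1 covers C = 0. As m is a
    minimum over a whole circle, b is the same for all rays, and so is R below.\<close>
  define b where "b = max a (1 - m\<^sup>2 * (1 - a) ^ 3 / (2 * (C\<^sup>2 + 1)))"
  have C1: "C\<^sup>2 + 1 > 0" by (simp add: add_nonneg_pos)
  have q: "m\<^sup>2 * (1 - a) ^ 3 > 0" using m a by simp
  have b: "a \<le> b" "b < 1" using a q C1 by (auto simp: b_def)
  have big: "C\<^sup>2 * (1 - b) < m\<^sup>2 * (1 - a) ^ 3"
  proof -
    have "C\<^sup>2 * (1 - b) \<le> (C\<^sup>2 + 1) * (m\<^sup>2 * (1 - a) ^ 3 / (2 * (C\<^sup>2 + 1)))"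
      using b by (intro mult_mono) (auto simp: b_def)
    also have "\<dots> = m\<^sup>2 * (1 - a) ^ 3 / 2" using C1 by (simp add: field_simps)
    also have "\<dots> < m\<^sup>2 * (1 - a) ^ 3" using q by simp
    finally show ?thesis .
  qed
  \<comment> \<open>The final inequality is (1-x)|P| <= 2 k ((1-x)|P| + 2): k <= 1/4 lets half of
    the left side absorb the first term, and k <= \<eta>/8 leaves \<eta>/2. The choice of
    \<open>R\<close> makes 5 (1-x)/(1-r) <= k for every starting point r <= b.\<close>
  define k where "k = min (\<eta> / 8) (1/4)"
  define R where "R = max b (1 - (1 - b) * k / 5)"
  have kpos: "k > 0" using eta by (simp add: k_def)
  have R: "R < 1" "b \<le> R" "1 - R \<le> (1 - b) * k / 5" using b kpos by (auto simp: R_def max_def)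
  show ?thesis
  proof (intro exI[of _ R] conjI allI impI)
    show "R < 1" by fact
    fix z :: complex assume z: "R \<le> norm z \<and> norm z < 1"
    \<comment> \<open>The value 1 at z = 0 keeps |e| = 1, which \<open>sgn 0 = 0\<close> would
      break.\<close>
    define e where "e = (if z = 0 then 1 else sgn z)"
    have ne: "norm e = 1" by (simp add: e_def norm_sgn)
    have ze: "z = of_real (norm z) * e" by (simp add: e_def sgn_eq)
    have inb: "of_real r * e \<in> ball 0 1" if "a \<le> r" "r < 1" for r
      using that a ne by (simp add: norm_mult)
    have nre: "norm (of_real r * e) = r" if "a \<le> r" for r :: real
      using that a ne by (simp add: norm_mult)
    have ray: "((\<lambda>r. G (of_real r * e)) has_vector_derivative e * deriv G (of_real r * e)) (at r)"
      if G: "G holomorphic_on ball 0 1" and r: "a \<le> r" "r < 1" for G r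
    proof -
      have "((\<lambda>r. of_real r * e) has_vector_derivative e) (at r)"
        by (rule derivative_eq_intros refl | simp)+
      from field_vector_diff_chain_at[OF this holomorphic_derivI[OF G open_ball inb[OF r]]]
      show ?thesis by (simp add: o_def)
    qed
    have holP: "P holomorphic_on ball 0 1"
      using P by (subst holomorphic_cong[OF refl P]) (use nz in \<open>auto intro!: holomorphic_on_divide holomorphic_deriv hol\<close>)
    define Fr where "Fr r = F (of_real r * e)" for r
    \<comment> \<open>The factors e here and e^2 in \<open>Sr\<close> are those by which
      pre-Schwarzian and Schwarzian change under the rotation z -> e z, so the Riccati equation
      keeps its form on the ray.\<close>
    define Pr where "Pr r = e * P (of_real r * e)" for r
    define Sr where "Sr r = e\<^sup>2 * S (of_real r * e)" for r
    have dF: "(Fr has_vector_derivative Fr r * Pr r) (at r)" if "a \<le> r" "r < 1" for r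
      using ray[OF hol that] P[OF inb[OF that]] nz[OF inb[OF that]]
      unfolding Fr_def Pr_def by simp
    have dP: "(Pr has_vector_derivative Sr r + (Pr r)\<^sup>2 / 2) (at r)" if "a \<le> r" "r < 1" for r
    proof -
      have "(Pr has_vector_derivative e * (e * deriv P (of_real r * e))) (at r)"
        unfolding Pr_def by (intro has_vector_derivative_mult_right ray holP that)
      also have "e * (e * deriv P (of_real r * e)) = Sr r + (Pr r)\<^sup>2 / 2"
      proof -
        have dP: "deriv P (of_real r * e) = S (of_real r * e) + (P (of_real r * e))\<^sup>2 / 2"
          using S[OF inb[OF that]] by simp
        show ?thesis
          unfolding Sr_def Pr_def dP power_mult_distrib by (simp add: power2_eq_square distrib_left)
      qed
      finally show ?thesis .
    qed
    obtain r where r: "a \<le> r" "r \<le> b" "norm (of_real (1 - r) * Pr r - 2) \<ge> 1/2"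
    proof (rule exists_ray_point_off_pole[where F = Fr and P = Pr and a = a and b = b and m = m and C = C])
      show "(Fr has_vector_derivative Fr r * Pr r) (at r)" if "a \<le> r" "r \<le> b" for r
        using dF that b by simp
      show "m \<le> norm (Fr a)" unfolding m_def Fr_def
        by (rule z0(2)) (use nre[of a] in simp)
      show "norm (Fr b) * (1 - b) \<le> C"
        using growth[OF inb[of b]] nre[of b] b by (simp add: Fr_def)
    qed (use b big m that in auto)
    define x where "x = norm z"
    have x: "r \<le> x" "x < 1" using z R r by (auto simp: x_def)
    have "(1 - x) * norm (Pr x) \<le> (5 * (1 - x) / (1 - r) + 25 * \<epsilon>) * norm (of_real (1 - x) * Pr x - 2)"
    proof (rule riccati_attracting[where P = Pr and S = Sr and a = r])
      show "(Pr has_vector_derivative Sr s + (Pr s)\<^sup>2 / 2) (at s)" if "r \<le> s" "s < 1" for s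
        using dP that r by simp
      show "norm (Sr s) * (1 - s)\<^sup>2 \<le> \<epsilon>" if "r \<le> s" "s < 1" for s
        using R0(2)[of "of_real s * e"] nre[of s] that r a ne by (simp add: Sr_def norm_mult norm_power)
    qed (use r e x in auto)
    also have "5 * (1 - x) / (1 - r) + 25 * \<epsilon> \<le> 2 * k"
    proof -
      have "5 * (1 - x) \<le> 5 * ((1 - b) * k / 5)" using R z by (auto simp: x_def)
      also have "\<dots> \<le> (1 - r) * k" using r kpos by (simp add: mult_right_mono)
      finally have "5 * (1 - x) / (1 - r) \<le> k" using r b by (simp add: field_simps)
      moreover have "25 * \<epsilon> \<le> k" using e by (auto simp: k_def)
      ultimately show ?thesis by simp
    qed
    finally have "(1 - x) * norm (Pr x) \<le> 2 * k * norm (of_real (1 - x) * Pr x - 2)"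
      by (simp add: mult_right_mono)
    also have "norm (of_real (1 - x) * Pr x - 2) \<le> (1 - x) * norm (Pr x) + 2"
      using norm_triangle_ineq4[of "of_real (1 - x) * Pr x" 2] x by (simp only: norm_mult norm_of_real) simp
    finally have "(1 - x) * norm (Pr x) \<le> 2 * k * ((1 - x) * norm (Pr x) + 2)"
      using kpos by (simp add: mult_left_mono)
    also have "\<dots> \<le> (1/2) * ((1 - x) * norm (Pr x)) + \<eta> / 2"
    proof -
      have "2 * k * ((1 - x) * norm (Pr x)) \<le> (1/2) * ((1 - x) * norm (Pr x))"
        using x by (intro mult_right_mono) (auto simp: k_def)
      moreover have "2 * k * 2 \<le> \<eta> / 2" by (auto simp: k_def)
      ultimately show ?thesis unfolding distrib_left by linarith
    qed
    finally have "(1 - x) * norm (Pr x) \<le> \<eta>" by simp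
    moreover have "norm (Pr x) = norm (P z)"
      using ze ne by (simp add: Pr_def x_def norm_mult)
    ultimately show "norm (P z) * (1 - norm z) \<le> \<eta>"
      by (simp add: x_def mult.commute)
  qed
qed

section \<open>A Hardy inequality\<close>

text \<open>Obtained by integrating the derivative of -q^p D^(p-1) with D = b^2 - x^2.
  Differentiating the weight produces 2 x (p-1) q^p D^(p-2), at least p - 1 times the integrand on
  the left because x >= 1/2; the term with q' consumes half of that. The boundary term at c has a
  favourable sign and is dropped, so the bound is uniform in c.\<close>

lemma hardy_interval:
  fixes q q' s :: "real \<Rightarrow> real"
  assumes p: "1 < p" and ab: "1/2 \<le> a" "a \<le> c" "c < b"
    and q': "\<And>x. a \<le> x \<Longrightarrow> x \<le> c \<Longrightarrow> (q has_real_derivative q' x) (at x)"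
    and q: "\<And>x. a \<le> x \<Longrightarrow> x \<le> c \<Longrightarrow> q x > 0"
    and bnd: "\<And>x. a \<le> x \<Longrightarrow> x \<le> c \<Longrightarrow> \<bar>q' x\<bar> \<le> s x + (p - 1) / (4 * p) / (b\<^sup>2 - x\<^sup>2) * q x"
    and s: "continuous_on {a..c} s" "\<And>x. a \<le> x \<Longrightarrow> x \<le> c \<Longrightarrow> 0 \<le> s x"
  shows "(p - 1) / 2 * integral {a..c} (\<lambda>x. q x powr p * (b\<^sup>2 - x\<^sup>2) powr (p - 2))
    \<le> q a powr p * (b\<^sup>2 - a\<^sup>2) powr (p - 1)
      + p * ((p - 1) / (4 * p)) powr (1 - p) * integral {a..c} (\<lambda>x. s x powr p * (b\<^sup>2 - x\<^sup>2) powr (2 * p - 2))"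
proof -
  \<comment> \<open>Since p \<tau> = (p-1)/4, each of the two parts of the bound on |q'| costs a
    quarter of p - 1, which leaves (p-1)/2.\<close>
  define \<tau> where "\<tau> = (p - 1) / (4 * p)"
  define M where "M = p * \<tau> powr (1 - p)"
  define D where "D x = b\<^sup>2 - x\<^sup>2" for x
  define G where "G x = - (q x powr p * D x powr (p - 1))" for x
  define G' where "G' x = - (p * q x powr (p - 1) * q' x * D x powr (p - 1)
      + q x powr p * ((p - 1) * D x powr (p - 2) * (- 2 * x)))" for x
  define L where "L x = (p - 1) / 2 * (q x powr p * D x powr (p - 2)) - M * (s x powr p * D x powr (2 * p - 2))" for x
  have tau: "\<tau> > 0" using p by (simp add: \<tau>_def)
  have D: "D x > 0" if "a \<le> x" "x \<le> c" for x
    using that ab power_strict_mono[of x b 2] by (simp add: D_def)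
  have cq: "continuous_on {a..c} q"
    by (rule continuous_at_imp_continuous_on) (auto intro!: DERIV_isCont[OF q'])
  have cD: "continuous_on {a..c} D" unfolding D_def by (intro continuous_intros)
  have c1: "continuous_on {a..c} (\<lambda>x. q x powr p * D x powr (p - 2))"
    by (intro continuous_on_mult continuous_on_powr cq cD continuous_on_const) (use q D in force)+
  have c2: "continuous_on {a..c} (\<lambda>x. s x powr p * D x powr (2 * p - 2))"
    by (intro continuous_on_mult continuous_on_powr'[OF s(1)] continuous_on_powr[OF cD] continuous_on_const)
       (use s D p in force)+
  have i1: "(\<lambda>x. q x powr p * D x powr (p - 2)) integrable_on {a..c}"
    by (rule integrable_continuous_interval[OF c1])
  have i2: "(\<lambda>x. s x powr p * D x powr (2 * p - 2)) integrable_on {a..c}"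
    by (rule integrable_continuous_interval[OF c2])
  have FTC: "(G' has_integral (G c - G a)) {a..c}"
  proof (rule fundamental_theorem_of_calculus[OF ab(2)])
    fix x assume x: "x \<in> {a..c}"
    have dD: "(D has_real_derivative - 2 * x) (at x)"
      unfolding D_def by (auto intro!: derivative_eq_intros)
    have 1: "((\<lambda>x. q x powr p) has_real_derivative p * q x powr (p - 1) * q' x) (at x)"
      by (rule DERIV_chain2[OF has_real_derivative_powr q']) (use q x in auto)
    have 2: "((\<lambda>x. D x powr (p - 1)) has_real_derivative (p - 1) * D x powr (p - 1 - 1) * (- 2 * x)) (at x)"
      by (rule DERIV_chain2[OF has_real_derivative_powr dD]) (use D x in auto)
    have "(G has_real_derivative G' x) (at x)"
      unfolding G_def using DERIV_minus[OF DERIV_mult[OF 1 2]] by (simp add: G'_def algebra_simps)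
    then show "(G has_vector_derivative G' x) (at x within {a..c})"
      by (simp add: has_real_derivative_iff_has_vector_derivative has_vector_derivative_at_within)
  qed
  have pt: "L x \<le> G' x" if x: "a \<le> x" "x \<le> c" for x
  proof -
    note d = D[OF x] and qx = q[OF x] and sx = s(2)[OF x]
    define A where "A = q x powr p * D x powr (p - 2)"
    define B where "B = s x powr p * D x powr (2 * p - 2)"
    have A0: "A \<ge> 0" by (simp add: A_def)
    have qA: "q x powr (p - 1) * D x powr (p - 1) * (q x / D x) = A"
    proof -
      have "q x powr (p - 1) * q x = q x powr p" using powr_add[of "q x" "p - 1" 1] qx by simp
      moreover have "D x powr (p - 1) / D x = D x powr (p - 2)" using powr_diff[of "D x" "p - 1" 1] d by simp
      ultimately show ?thesis unfolding A_def by (metis times_divide_times_eq times_divide_eq_right mult.commute mult.left_commute)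
    qed
    \<comment> \<open>A weighted Young inequality by cases: either s <= \<tau> q/D and the product
      is at most \<tau> A, or q <= D s/\<tau> and q^(p-1) is traded for a multiple of (D
      s)^(p-1).\<close>
    have sB: "q x powr (p - 1) * D x powr (p - 1) * s x \<le> \<tau> * A + \<tau> powr (1 - p) * B"
    proof (cases "s x \<le> \<tau> * (q x / D x)")
      case True
      have "q x powr (p - 1) * D x powr (p - 1) * s x \<le> q x powr (p - 1) * D x powr (p - 1) * (\<tau> * (q x / D x))"
        using True by (intro mult_left_mono) auto
      also have "\<dots> = \<tau> * A" using qA by (metis mult.left_commute)
      also have "\<dots> \<le> \<tau> * A + \<tau> powr (1 - p) * B" by (simp add: B_def)
      finally show ?thesis .
    next
      case False
      then have "q x \<le> D x * s x / \<tau>" using tau d by (simp add: field_simps)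
      then have "q x powr (p - 1) \<le> (D x * s x / \<tau>) powr (p - 1)"
        using qx p by (intro powr_mono2) auto
      also have "\<dots> = \<tau> powr (1 - p) * (D x powr (p - 1) * s x powr (p - 1))"
        using d sx tau by (simp add: powr_mult powr_divide powr_diff)
      finally have "q x powr (p - 1) * D x powr (p - 1) * s x
         \<le> \<tau> powr (1 - p) * (D x powr (p - 1) * s x powr (p - 1)) * D x powr (p - 1) * s x"
        using sx by (intro mult_right_mono) auto
      also have "\<dots> = \<tau> powr (1 - p) * B"
      proof -
        have "s x powr (p - 1) * s x = s x powr p" using powr_add[of "s x" "p - 1" 1] sx by (cases "s x = 0") auto
        moreover have "D x powr (p - 1) * D x powr (p - 1) = D x powr (2 * p - 2)" by (simp add: powr_add[symmetric])
        ultimately show ?thesis unfolding B_def by (metis mult.assoc mult.commute)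
      qed
      also have "\<dots> \<le> \<tau> * A + \<tau> powr (1 - p) * B" using tau A0 by simp
      finally show ?thesis .
    qed
    have "q x powr (p - 1) * D x powr (p - 1) * q' x \<le> q x powr (p - 1) * D x powr (p - 1) * (s x + \<tau> * (q x / D x))"
    proof (intro mult_left_mono)
      show "q' x \<le> s x + \<tau> * (q x / D x)" using bnd[OF x] by (simp add: \<tau>_def D_def)
    qed auto
    also have "\<dots> \<le> (\<tau> * A + \<tau> powr (1 - p) * B) + \<tau> * A"
    proof -
      have "q x powr (p - 1) * D x powr (p - 1) * (s x + \<tau> * (q x / D x))
        = q x powr (p - 1) * D x powr (p - 1) * s x + \<tau> * A"
        unfolding qA[symmetric] by (simp add: algebra_simps)
      then show ?thesis using sB by linarith
    qed
    finally have 1: "p * (q x powr (p - 1) * D x powr (p - 1) * q' x) \<le> p * ((\<tau> * A + \<tau> powr (1 - p) * B) + \<tau> * A)"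
      using p by (intro mult_left_mono) auto
    have 2: "p * (\<tau> * A) = (p - 1) / 4 * A" using p by (simp add: \<tau>_def field_simps)
    have 3: "(p - 1) * A \<le> (p - 1) * A * (2 * x)"
      using mult_left_mono[of 1 "2 * x" "(p - 1) * A"] x ab p A0 by simp
    have "G' x = (p - 1) * A * (2 * x) - p * (q x powr (p - 1) * D x powr (p - 1) * q' x)"
      by (simp add: G'_def A_def)
    moreover have "p * ((\<tau> * A + \<tau> powr (1 - p) * B) + \<tau> * A) = (p - 1) / 2 * A + M * B"
    proof -
      have "p * ((\<tau> * A + \<tau> powr (1 - p) * B) + \<tau> * A) = p * (\<tau> * A) + M * B + p * (\<tau> * A)"
        by (simp add: distrib_left M_def)
      also have "\<dots> = (p - 1) / 2 * A + M * B" unfolding 2 by simp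
      finally show ?thesis .
    qed
    moreover have "L x = (p - 1) / 2 * A - M * B" by (simp add: L_def A_def B_def)
    ultimately show ?thesis using 1 3 by (simp add: field_simps)
  qed
  have "integral {a..c} L \<le> integral {a..c} G'"
  proof (rule integral_le)
    show "L integrable_on {a..c}" unfolding L_def
      by (intro integrable_diff integrable_on_mult_right i1 i2)
  qed (use FTC pt in auto)
  also have "\<dots> = G c - G a" using FTC by (rule integral_unique)
  also have "\<dots> \<le> q a powr p * D a powr (p - 1)" by (simp add: G_def)
  finally have "integral {a..c} L \<le> q a powr p * D a powr (p - 1)" .
  moreover have "integral {a..c} L = (p - 1) / 2 * integral {a..c} (\<lambda>x. q x powr p * D x powr (p - 2))
     - M * integral {a..c} (\<lambda>x. s x powr p * D x powr (2 * p - 2))"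
    unfolding L_def using integral_diff[OF integrable_on_mult_right[OF i1, of "(p-1)/2"] integrable_on_mult_right[OF i2, of M]] by simp
  ultimately show ?thesis by (simp add: D_def M_def \<tau>_def)
qed

text \<open>Lets the right end point of the Hardy inequality tend to the unit circle, where the
  weight degenerates, by monotone convergence.\<close>

lemma nn_integral_Ico_le_of_Icc:
  fixes f :: "real \<Rightarrow> ennreal"
  assumes [measurable]: "f \<in> borel_measurable borel" and ab: "a < b"
    and le: "\<And>c. a \<le> c \<Longrightarrow> c < b \<Longrightarrow> (\<integral>\<^sup>+x. f x * indicator {a..c} x \<partial>lborel) \<le> B"
  shows "(\<integral>\<^sup>+x. f x * indicator {a..<b} x \<partial>lborel) \<le> B"
proof -
  define c where "c n = b - (b - a) / real (Suc n)" for n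
  have c: "a \<le> c n" "c n < b" for n
    proof -
    have "(b - a) / real (Suc n) \<le> (b - a) / 1" using ab by (intro divide_left_mono) auto
    then show "a \<le> c n" "c n < b" using ab by (auto simp: c_def)
  qed
  have mono: "c m \<le> c n" if "m \<le> n" for m n
    using that ab by (simp add: c_def frac_le)
  have "(\<integral>\<^sup>+x. f x * indicator {a..<b} x \<partial>lborel) = (\<integral>\<^sup>+x. (SUP n. f x * indicator {a..c n} x) \<partial>lborel)"
  proof (rule nn_integral_cong)
    fix x
    have "(SUP n. f x * indicator {a..c n} x) = f x * (SUP n. indicator {a..c n} x)"
      by (simp add: SUP_mult_left_ennreal)
    also have "(SUP n. indicator {a..c n} x) = (indicator {a..<b} x :: ennreal)"
    proof (cases "x \<in> {a..<b}")
      case True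
      have "(\<lambda>n. (b - a) * (1 / real (Suc n))) \<longlonglongrightarrow> (b - a) * 0" 
        using LIMSEQ_inverse_real_of_nat by (intro tendsto_mult_left) (simp add: inverse_eq_divide)
      then have "eventually (\<lambda>n. (b - a) * (1 / real (Suc n)) < b - x) sequentially"
        using True by (intro order_tendstoD) auto
      then obtain n where "(b - a) * (1 / real (Suc n)) < b - x" by (auto simp: eventually_sequentially)
      then have "x \<le> c n" by (simp add: c_def)
      then have "indicator {a..c n} x = (1::ennreal)" using True by simp
      then have "1 \<le> (SUP n. indicator {a..c n} x :: ennreal)" by (metis SUP_upper UNIV_I)
      moreover have "(SUP n. indicator {a..c n} x :: ennreal) \<le> 1" by (auto intro!: SUP_least simp: indicator_def)
      ultimately show ?thesis using True by simp
    next
      case False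
      then have "indicator {a..c n} x = (0::ennreal)" for n using c(2)[of n] by (auto simp: indicator_def)
      then show ?thesis using False by simp
    qed
    finally show "f x * indicator {a..<b} x = (SUP n. f x * indicator {a..c n} x)" by simp
  qed
  also have "\<dots> = (SUP n. \<integral>\<^sup>+x. f x * indicator {a..c n} x \<partial>lborel)"
  proof (rule nn_integral_monotone_convergence_SUP)
    show "incseq (\<lambda>n x. f x * indicator {a..c n} x)"
      by (auto simp: incseq_def le_fun_def indicator_def intro: order_trans[OF _ mono])
  qed measurable
  also have "\<dots> \<le> B" by (rule SUP_least) (use le c in auto)
  finally show ?thesis .
qed


text \<open>At height y the set is the segment a <= x < b, on which 1-|z|^2 = b^2 - x^2, so the
  one-dimensional inequality applies and is integrated over y. The numbers 19/20 and 3/4 give a^2 >=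
  0.9025 - 0.5625 > 1/4, hence the bound 1/2 <= a that \<open>hardy_interval\<close>
  requires.\<close>

lemma weighted_integral_strip:
  assumes hol: "P holomorphic_on ball 0 1" and p: "1 < p"
    and S: "\<And>z. z \<in> ball 0 1 \<Longrightarrow> S z = deriv P z - (P z)\<^sup>2 / 2"
    and R: "19/20 \<le> R" "R < 1"
    and small: "\<And>z. R \<le> norm z \<Longrightarrow> norm z < 1 \<Longrightarrow> norm (P z) * (1 - norm z) \<le> (p - 1) / (4 * p)"
    and fin: "weighted_integral p (2 * p - 2) S < \<infinity>"
  shows "(\<integral>\<^sup>+z. ennreal (norm (P z) powr p * (1 - norm z ^ 2) powr (p - 2)) *
      indicator {z. R \<le> norm z \<and> norm z < 1 \<and> 0 < Re z \<and> \<bar>Im z\<bar> \<le> 3/4} z \<partial>lborel) < \<infinity>"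
proof -
  define E where "E = {z. R \<le> norm z \<and> norm z < 1 \<and> 0 < Re z \<and> \<bar>Im z\<bar> \<le> 3/4}"
  \<comment> \<open>A positive smooth majorant of |P|. The norm itself may fail to be differentiable
    at zeros of P, while the derivative of \<open>Q\<close> along a segment is still at most
    |P'|.\<close>
  define Q where "Q z = sqrt (1 + (norm (P z))\<^sup>2)" for z
  have Emeas [measurable]: "E \<in> sets borel" unfolding E_def by measurable
  have Esub: "E \<subseteq> ball 0 1" by (auto simp: E_def)
  have cP: "continuous_on (ball 0 1) P" by (rule holomorphic_on_imp_continuous_on[OF hol])
  have hS: "S holomorphic_on ball 0 1"
    by (subst holomorphic_cong[OF refl S]) (auto intro!: holomorphic_intros hol holomorphic_deriv)
  have cS: "continuous_on (ball 0 1) S" by (rule holomorphic_on_imp_continuous_on[OF hS])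
  have Q1: "Q z \<ge> 1" "norm (P z) \<le> Q z" for z
    by (auto simp: Q_def intro: real_le_rsqrt)
  have cQ: "continuous_on (ball 0 1) Q" unfolding Q_def by (intro continuous_intros cP)
  define H1 where "H1 z = ennreal (norm (complex_of_real (Q z)) powr p * (1 - norm z ^ 2) powr (p - 2)) * indicator (ball 0 1) z" for z
  define H2 where "H2 z = ennreal (norm (S z) powr p * (1 - norm z ^ 2) powr (2 * p - 2)) * indicator (ball 0 1) z" for z
  have [measurable]: "H1 \<in> borel_measurable borel" unfolding H1_def
    by (rule borel_measurable_weighted[OF _ p]) (intro continuous_intros cQ)
  have [measurable]: "H2 \<in> borel_measurable borel" unfolding H2_def
    by (rule borel_measurable_weighted[OF cS p])
  have "compact (sphere (0::complex) R)" by simp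
  moreover have "continuous_on (sphere 0 R) Q"
    by (rule continuous_on_subset[OF cQ]) (use R in auto)
  ultimately have "bounded (Q ` sphere 0 R)"
    by (intro compact_imp_bounded compact_continuous_image)
  then obtain C where "\<forall>x\<in>Q ` sphere 0 R. norm x \<le> C"
    unfolding bounded_iff by blast
  then have C: "Q z \<le> C" if "norm z = R" for z
  proof -
    have "\<bar>Q z\<bar> \<le> C" using \<open>\<forall>x\<in>Q ` sphere 0 R. norm x \<le> C\<close> that by auto
    then show ?thesis by simp
  qed
  \<comment> \<open>The Hardy inequality is solved for its left integral. Its initial term is
    bounded uniformly in y, because each segment starts on |z| = R, where b^2 - a^2 = 1 - R^2 and Q
    <= C.\<close>
  define A where "A = 2 / (p - 1) * (C powr p * (1 - R\<^sup>2) powr (p - 1))"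
  define M where "M = 2 / (p - 1) * (p * ((p - 1) / (4 * p)) powr (1 - p))"
  have M0: "M \<ge> 0" using p by (simp add: M_def)
  \<comment> \<open>The indicator keeps the constant term integrable in y.\<close>
  have line: "(\<integral>\<^sup>+x. H1 (Complex x y) * indicator E (Complex x y) \<partial>lborel)
      \<le> ennreal A * indicator {-1..1} y + ennreal M * (\<integral>\<^sup>+x. H2 (Complex x y) \<partial>lborel)" for y
  proof (cases "\<bar>y\<bar> \<le> 3/4")
    case False
    then have "indicator E (Complex x y) = (0::ennreal)" for x by (simp add: E_def)
    then show ?thesis by simp
  next
    case y: True
    define a where "a = sqrt (R\<^sup>2 - y\<^sup>2)"
    define b where "b = sqrt (1 - y\<^sup>2)"
    have y2: "y\<^sup>2 \<le> (3/4)\<^sup>2" using y by (metis abs_le_square_iff abs_of_nonneg divide_nonneg_nonneg zero_le_numeral)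
    have R2: "(19/20)\<^sup>2 \<le> R\<^sup>2" "R\<^sup>2 < 1" using R power_strict_mono[of R 1 2] by (auto intro: power_mono)
    have a2: "a\<^sup>2 = R\<^sup>2 - y\<^sup>2" and b2: "b\<^sup>2 = 1 - y\<^sup>2"
      unfolding a_def b_def using y2 R2 by (auto simp: power2_eq_square)
    have ah: "1/2 \<le> a" unfolding a_def using y2 R2 by (intro real_le_rsqrt) (auto simp: power2_eq_square)
    have ab: "a < b" unfolding a_def b_def using R2 by simp
    have nrm: "(norm (Complex x y))\<^sup>2 = x\<^sup>2 + y\<^sup>2" for x by (simp add: cmod_power2)
    have wt: "1 - (norm (Complex x y))\<^sup>2 = b\<^sup>2 - x\<^sup>2" for x using b2 nrm[of x] by simp
    have inE: "Complex x y \<in> E \<longleftrightarrow> x \<in> {a..<b}" for x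
    proof -
      have "R \<le> norm (Complex x y) \<longleftrightarrow> R\<^sup>2 \<le> x\<^sup>2 + y\<^sup>2"
        unfolding nrm[symmetric] using R by (intro power_mono_iff[symmetric]) auto
      moreover have "norm (Complex x y) < 1 \<longleftrightarrow> x\<^sup>2 + y\<^sup>2 < 1"
        unfolding nrm[symmetric] using power_strict_mono[of "norm (Complex x y)" 1 2] 
          power_mono[of 1 "norm (Complex x y)" 2] by (auto simp: not_less[symmetric])
      moreover have "R\<^sup>2 \<le> x\<^sup>2 + y\<^sup>2 \<longleftrightarrow> a \<le> x" if "0 < x"
        using a2 power_mono_iff[of a x 2] ah that by auto
      moreover have "x\<^sup>2 + y\<^sup>2 < 1 \<longleftrightarrow> x < b" if "0 < x"
        using b2 power_mono_iff[of b x 2] ah ab that by (auto simp: not_le[symmetric])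
      ultimately show ?thesis using ah y by (auto simp: E_def)
    qed
    define q where "q x = Q (Complex x y)" for x
    define s where "s x = norm (S (Complex x y))" for x
    define q' where "q' x = (P (Complex x y) \<bullet> deriv P (Complex x y)) / q x" for x
    have ball: "Complex x y \<in> ball 0 1" if "a \<le> x" "x < b" for x
      using inE[of x] that by (auto simp: E_def)
    have cl: "continuous_on A (\<lambda>x. Complex x y)" for A
      unfolding Complex_eq by (intro continuous_intros)
    have dq: "(q has_real_derivative q' x) (at x)" if x: "a \<le> x" "x < b" for x
    proof -
      have "((\<lambda>x. Complex x y) has_vector_derivative 1) (at x)"
        unfolding Complex_eq by (rule derivative_eq_intros refl | simp)+
      from field_vector_diff_chain_at[OF this holomorphic_derivI[OF hol open_ball ball[OF x]]]
      have "((\<lambda>x. P (Complex x y)) has_vector_derivative deriv P (Complex x y)) (at x)"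
        by (simp add: o_def)
      then have "((\<lambda>x. P (Complex x y)) has_derivative (\<lambda>h. h *\<^sub>R deriv P (Complex x y))) (at x)"
        by (simp add: has_vector_derivative_def)
      from has_derivative_inner[OF this this]
      have "((\<lambda>x. P (Complex x y) \<bullet> P (Complex x y)) has_derivative 
        (\<lambda>h. 2 * (P (Complex x y) \<bullet> deriv P (Complex x y)) * h)) (at x)"
        by (rule has_derivative_eq_rhs) (auto simp: fun_eq_iff inner_commute)
      then have 1: "((\<lambda>x. P (Complex x y) \<bullet> P (Complex x y)) has_real_derivative 
         2 * (P (Complex x y) \<bullet> deriv P (Complex x y))) (at x)"
        unfolding has_field_derivative_def by (rule has_derivative_eq_rhs) (auto simp: fun_eq_iff)
      have pos: "0 < 1 + P (Complex x y) \<bullet> P (Complex x y)" by (simp add: add_pos_nonneg)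
      have "((\<lambda>x. 1 + P (Complex x y) \<bullet> P (Complex x y)) has_real_derivative
         0 + 2 * (P (Complex x y) \<bullet> deriv P (Complex x y))) (at x)"
        by (intro DERIV_add DERIV_const 1)
      from DERIV_chain2[where f = sqrt and g = "\<lambda>x. 1 + P (Complex x y) \<bullet> P (Complex x y)", OF DERIV_real_sqrt[OF pos] this]
      have 2: "((\<lambda>x. sqrt (1 + P (Complex x y) \<bullet> P (Complex x y))) has_real_derivative
         inverse (sqrt (1 + P (Complex x y) \<bullet> P (Complex x y))) / 2 * (0 + 2 * (P (Complex x y) \<bullet> deriv P (Complex x y)))) (at x)" .
      have q: "q = (\<lambda>x. sqrt (1 + P (Complex x y) \<bullet> P (Complex x y)))"
        unfolding q_def Q_def power2_norm_eq_inner ..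
      have "q' x = inverse (sqrt (1 + P (Complex x y) \<bullet> P (Complex x y))) / 2 * (0 + 2 * (P (Complex x y) \<bullet> deriv P (Complex x y)))"
        unfolding q'_def q by (simp only: divide_inverse) simp
      with 2 show ?thesis unfolding q by simp
    qed
    have bnd: "\<bar>q' x\<bar> \<le> s x + (p - 1) / (4 * p) / (b\<^sup>2 - x\<^sup>2) * q x" if x: "a \<le> x" "x < b" for x
    proof -
      let ?z = "Complex x y"
      have z: "R \<le> norm ?z" "norm ?z < 1" using inE[of x] x by (auto simp: E_def)
      have q0: "q x > 0" using Q1(1)[of ?z] by (simp add: q_def)
      have "\<bar>P ?z \<bullet> deriv P ?z\<bar> \<le> q x * norm (deriv P ?z)"
        using Cauchy_Schwarz_ineq2[of "P ?z" "deriv P ?z"] mult_right_mono[OF Q1(2)[of ?z] norm_ge_zero[of "deriv P ?z"]]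
        by (simp add: q_def)
      then have "\<bar>q' x\<bar> \<le> norm (deriv P ?z)" using q0 by (simp add: q'_def field_simps)
      also have "deriv P ?z = S ?z + (P ?z)\<^sup>2 / 2" using S[OF ball[OF x]] by simp
      also have "norm \<dots> \<le> s x + norm (P ?z) * norm (P ?z) / 2"
        using norm_triangle_ineq[of "S ?z" "(P ?z)\<^sup>2 / 2"] by (simp add: s_def norm_divide norm_mult power2_eq_square)
      \<comment> \<open>The 2 from 1-|z|^2 <= 2 (1-|z|) cancels the 1/2 of P^2/2, which leaves
        exactly the constant allowed in \<open>hardy_interval\<close>.\<close>
      also have "norm (P ?z) * norm (P ?z) / 2 \<le> (p - 1) / (4 * p) / (b\<^sup>2 - x\<^sup>2) * q x"
      proof -
        note w = disk_weight_bounds[OF z(2)]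
        have "norm (P ?z) * (1 - (norm ?z)\<^sup>2) \<le> norm (P ?z) * (2 * (1 - norm ?z))"
          by (rule mult_left_mono[OF w(2)]) simp
        also have "\<dots> = 2 * (norm (P ?z) * (1 - norm ?z))" by simp
        also have "\<dots> \<le> 2 * ((p - 1) / (4 * p))" by (rule mult_left_mono[OF small[OF z]]) simp
        finally have "norm (P ?z) * (1 - (norm ?z)\<^sup>2) \<le> 2 * ((p - 1) / (4 * p))" .
        moreover have "x / 2 \<le> t / D" if "x * D \<le> 2 * t" "D > 0" for x t D :: real
          using that by (simp add: field_simps)
        ultimately have "norm (P ?z) / 2 \<le> (p - 1) / (4 * p) / (1 - (norm ?z)\<^sup>2)"
          using w(3) by blast
        then have "norm (P ?z) / 2 * norm (P ?z) \<le> (p - 1) / (4 * p) / (1 - (norm ?z)\<^sup>2) * q x"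
          using Q1(2)[of ?z] w(3) p by (intro mult_mono) (auto simp: q_def)
        then show ?thesis unfolding wt by simp
      qed
      finally show ?thesis by simp
    qed
    have "(\<integral>\<^sup>+x. H1 (Complex x y) * indicator E (Complex x y) \<partial>lborel) = (\<integral>\<^sup>+x. H1 (Complex x y) * indicator {a..<b} x \<partial>lborel)"
      by (simp add: inE indicator_def)
    also have "\<dots> \<le> ennreal A + ennreal M * (\<integral>\<^sup>+x. H2 (Complex x y) \<partial>lborel)"
    proof (rule nn_integral_Ico_le_of_Icc[OF _ ab])
      have [measurable]: "(\<lambda>x. Complex x y) \<in> borel_measurable borel" 
        unfolding Complex_eq by measurable
      show "(\<lambda>x. H1 (Complex x y)) \<in> borel_measurable borel" by measurable
      fix c assume c: "a \<le> c" "c < b"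
      have cs: "continuous_on {a..c} s"
        unfolding s_def 
        by (intro continuous_intros continuous_on_compose2[OF cS cl]) (use ball c in force)
      have cq: "continuous_on {a..c} q"
        unfolding q_def
        by (intro continuous_on_compose2[OF cQ cl]) (use ball c in force)
      have D: "b\<^sup>2 - x\<^sup>2 > 0" if "a \<le> x" "x \<le> c" for x
        using that c ah power_strict_mono[of x b 2] by simp
      have nzD: "\<forall>x\<in>{a..c}. b\<^sup>2 - x\<^sup>2 \<noteq> 0" using D by force
      have nzq: "\<forall>x\<in>{a..c}. q x \<noteq> 0"
      proof
        fix x show "q x \<noteq> 0" using Q1(1)[of "Complex x y"] by (simp add: q_def)
      qed
      have cD: "continuous_on {a..c} (\<lambda>x. b\<^sup>2 - x\<^sup>2)" by (intro continuous_intros)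
      define I1 where "I1 = integral {a..c} (\<lambda>x. q x powr p * (b\<^sup>2 - x\<^sup>2) powr (p - 2))"
      define I2 where "I2 = integral {a..c} (\<lambda>x. s x powr p * (b\<^sup>2 - x\<^sup>2) powr (2 * p - 2))"
      have c1: "continuous_on {a..c} (\<lambda>x. q x powr p * (b\<^sup>2 - x\<^sup>2) powr (p - 2))"
        by (intro continuous_on_mult continuous_on_powr cq cD continuous_on_const)
           (use nzq nzD in auto)
      have c2: "continuous_on {a..c} (\<lambda>x. s x powr p * (b\<^sup>2 - x\<^sup>2) powr (2 * p - 2))"
        by (intro continuous_on_mult continuous_on_powr'[OF cs] continuous_on_powr[OF cD] continuous_on_const)
           (use nzD p in \<open>auto simp: s_def\<close>)
      have h1: "((\<lambda>x. q x powr p * (b\<^sup>2 - x\<^sup>2) powr (p - 2)) has_integral I1) {a..c}"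
        unfolding I1_def by (intro integrable_integral integrable_continuous_interval c1)
      have h2: "((\<lambda>x. s x powr p * (b\<^sup>2 - x\<^sup>2) powr (2 * p - 2)) has_integral I2) {a..c}"
        unfolding I2_def by (intro integrable_integral integrable_continuous_interval c2)
      have I20: "I2 \<ge> 0" by (rule has_integral_nonneg[OF h2]) simp
      have "(p - 1) / 2 * I1 \<le> q a powr p * (b\<^sup>2 - a\<^sup>2) powr (p - 1)
        + p * ((p - 1) / (4 * p)) powr (1 - p) * I2"
        unfolding I1_def I2_def
      proof (rule hardy_interval[OF p ah c])
        show "(q has_real_derivative q' x) (at x)" if "a \<le> x" "x \<le> c" for x using dq that c by simp
        show "q x > 0" for x using Q1(1)[of "Complex x y"] by (simp add: q_def)
        show "\<bar>q' x\<bar> \<le> s x + (p - 1) / (4 * p) / (b\<^sup>2 - x\<^sup>2) * q x" if "a \<le> x" "x \<le> c" for x using bnd that c by simp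
      qed (use cs in \<open>auto simp: s_def\<close>)
      also have "q a powr p * (b\<^sup>2 - a\<^sup>2) powr (p - 1) \<le> C powr p * (1 - R\<^sup>2) powr (p - 1)"
      proof -
        have "b\<^sup>2 - a\<^sup>2 = 1 - R\<^sup>2" using a2 b2 by simp
        moreover have "norm (Complex a y) = R"
          using nrm[of a] a2 R by (metis diff_add_cancel norm_ge_zero power2_eq_imp_eq order_trans zero_le_divide_iff zero_le_numeral)
        then have "q a powr p \<le> C powr p"
          using C[of "Complex a y"] Q1(1)[of "Complex a y"] p by (intro powr_mono2) (auto simp: q_def)
        ultimately show ?thesis by (simp add: mult_right_mono)
      qed
      finally have "2 / (p - 1) * ((p - 1) / 2 * I1) \<le> 2 / (p - 1) * (C powr p * (1 - R\<^sup>2) powr (p - 1)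
          + p * ((p - 1) / (4 * p)) powr (1 - p) * I2)"
        using p by (intro mult_left_mono) auto
      then have "I1 \<le> A + M * I2"
        using p by (simp add: A_def M_def distrib_left mult.assoc)
      moreover have "(\<integral>\<^sup>+x. H1 (Complex x y) * indicator {a..c} x \<partial>lborel) = ennreal I1"
      proof -
        have "(\<integral>\<^sup>+x. ennreal (q x powr p * (b\<^sup>2 - x\<^sup>2) powr (p - 2)) * indicator {a..c} x \<partial>lborel) = ennreal I1"
          by (rule nn_integral_has_integral_lebesgue'[OF _ h1]) simp
        moreover have "H1 (Complex x y) * indicator {a..c} x 
           = ennreal (q x powr p * (b\<^sup>2 - x\<^sup>2) powr (p - 2)) * indicator {a..c} x" for x
          using ball[of x] c Q1(1)[of "Complex x y"] unfolding H1_def q_def wt by (auto simp: indicator_def)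
        ultimately show ?thesis by simp
      qed
      moreover have "ennreal I2 \<le> (\<integral>\<^sup>+x. H2 (Complex x y) \<partial>lborel)"
      proof -
        have "(\<integral>\<^sup>+x. ennreal (s x powr p * (b\<^sup>2 - x\<^sup>2) powr (2 * p - 2)) * indicator {a..c} x \<partial>lborel) = ennreal I2"
          by (rule nn_integral_has_integral_lebesgue'[OF _ h2]) simp
        moreover have "ennreal (s x powr p * (b\<^sup>2 - x\<^sup>2) powr (2 * p - 2)) * indicator {a..c} x \<le> H2 (Complex x y)" for x
          using ball[of x] c unfolding H2_def s_def wt by (auto simp: indicator_def)
        ultimately show ?thesis by (metis (no_types, lifting) nn_integral_mono)
      qed
      moreover have "ennreal (A + M * I2) = ennreal A + ennreal M * ennreal I2"
        using p I20 M0 by (simp add: A_def ennreal_mult)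
      ultimately show "(\<integral>\<^sup>+x. H1 (Complex x y) * indicator {a..c} x \<partial>lborel) \<le> ennreal A + ennreal M * (\<integral>\<^sup>+x. H2 (Complex x y) \<partial>lborel)"
        by (smt (verit, best) add_left_mono ennreal_leI mult_left_mono order_trans zero_le)
    qed
    moreover have "y \<in> {-1..1}" using y by auto
    ultimately show ?thesis by simp
  qed
  have [measurable]: "(\<lambda>z. H1 z * indicator E z) \<in> borel_measurable borel" by measurable
  have H2y: "(\<lambda>y. \<integral>\<^sup>+x. H2 (Complex x y) \<partial>lborel) \<in> borel_measurable lborel"
  proof (rule lborel.borel_measurable_nn_integral)
    show "(\<lambda>(y, x). H2 (Complex x y)) \<in> borel_measurable (lborel \<Otimes>\<^sub>M lborel)"
      unfolding Complex_eq by measurable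
  qed
  have "(\<integral>\<^sup>+z. H1 z * indicator E z \<partial>lborel) = (\<integral>\<^sup>+y. \<integral>\<^sup>+x. H1 (Complex x y) * indicator E (Complex x y) \<partial>lborel \<partial>lborel)"
    by (rule nn_integral_complex_eq) measurable
  also have "\<dots> \<le> (\<integral>\<^sup>+y. ennreal A * indicator {-1..1} y + ennreal M * (\<integral>\<^sup>+x. H2 (Complex x y) \<partial>lborel) \<partial>lborel)"
    by (rule nn_integral_mono) (rule line)
  also have "\<dots> = (\<integral>\<^sup>+y. ennreal A * indicator {-1..1} (y::real) \<partial>lborel) + (\<integral>\<^sup>+y. ennreal M * (\<integral>\<^sup>+x. H2 (Complex x y) \<partial>lborel) \<partial>lborel)"
    using H2y by (intro nn_integral_add) auto
  also have "\<dots> = ennreal A * 2 + ennreal M * (\<integral>\<^sup>+z. H2 z \<partial>lborel)"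
    using H2y by (subst nn_integral_complex_eq[of H2]) (auto simp: nn_integral_cmult nn_integral_cmult_indicator)
  also have "\<dots> < \<infinity>"
    using fin by (auto simp: H2_def[abs_def] weighted_integral_def ennreal_mult_less_top)
  finally have fin1: "(\<integral>\<^sup>+z. H1 z * indicator E z \<partial>lborel) < \<infinity>" .
  have "(\<integral>\<^sup>+z. ennreal (norm (P z) powr p * (1 - norm z ^ 2) powr (p - 2)) * indicator E z \<partial>lborel) \<le> (\<integral>\<^sup>+z. H1 z * indicator E z \<partial>lborel)"
  proof (rule nn_integral_mono)
    fix z
    show "ennreal (norm (P z) powr p * (1 - norm z ^ 2) powr (p - 2)) * indicator E z \<le> H1 z * indicator E z"
    proof (cases "z \<in> E")
      case True
      have "norm (P z) powr p \<le> norm (complex_of_real (Q z)) powr p"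
        using Q1[of z] p by (intro powr_mono2) auto
      moreover have "z \<in> ball 0 1" using True Esub by blast
      ultimately show ?thesis using True
        by (auto simp: H1_def intro!: ennreal_leI mult_right_mono)
    qed simp
  qed
  then show ?thesis using fin1 unfolding E_def by (rule le_less_trans)
qed

text \<open>Quarter-turns of the strip cover the annulus R <= |z| < 1, because one of |Re z|, |Im z|
  is at most 1/sqrt 2 < 3/4. The hypotheses carry over to u P(u z) and u^2 S(u z) for |u| = 1, and
  on |z| <= R the integrand is bounded.\<close>

lemma weighted_integral_pre_schwarzian:
  assumes hol: "P holomorphic_on ball 0 1" and p: "1 < p"
    and S: "\<And>z. z \<in> ball 0 1 \<Longrightarrow> S z = deriv P z - (P z)\<^sup>2 / 2"
    and small: "\<And>\<eta>. \<eta> > 0 \<Longrightarrow> \<exists>R<1. \<forall>z. R \<le> norm z \<and> norm z < 1 \<longrightarrow> norm (P z) * (1 - norm z) \<le> \<eta>"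
    and fin: "weighted_integral p (2 * p - 2) S < \<infinity>"
  shows "weighted_integral p (p - 2) P < \<infinity>"
proof -
  have "(p - 1) / (4 * p) > 0" using p by simp
  then obtain R0 where R0: "R0 < 1"
    "\<And>z. R0 \<le> norm z \<Longrightarrow> norm z < 1 \<Longrightarrow> norm (P z) * (1 - norm z) \<le> (p - 1) / (4 * p)"
    using small by meson
  define R where "R = max R0 (19/20)"
  have R: "19/20 \<le> R" "R < 1" "R0 \<le> R" using R0 by (auto simp: R_def)
  define E where "E = {z::complex. R \<le> norm z \<and> norm z < 1 \<and> 0 < Re z \<and> \<bar>Im z\<bar> \<le> 3/4}"
  have [measurable]: "E \<in> sets borel" unfolding E_def by measurable
  define K where "K z = ennreal (norm (P z) powr p * (1 - norm z ^ 2) powr (p - 2)) * indicator (ball 0 1) z" for z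
  have cP: "continuous_on (ball 0 1) P" by (rule holomorphic_on_imp_continuous_on[OF hol])
  have hS: "S holomorphic_on ball 0 1"
    by (subst holomorphic_cong[OF refl S]) (auto intro!: holomorphic_intros hol holomorphic_deriv)
  have cS: "continuous_on (ball 0 1) S" by (rule holomorphic_on_imp_continuous_on[OF hS])
  have [measurable]: "K \<in> borel_measurable borel"
    unfolding K_def by (rule borel_measurable_weighted[OF cP p])
  have rot: "(\<integral>\<^sup>+z. K z * indicator E (cnj u * z) \<partial>lborel) < \<infinity>" if u: "norm u = 1" for u
  proof -
    have uu: "cnj u * (u * z) = z" for z
      using u complex_norm_square[of u] by (simp add: mult.commute mult.left_commute)
    have ub: "u * z \<in> ball 0 1" if "z \<in> ball 0 1" for z
      using that u by (simp add: norm_mult)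
    have du: "((\<lambda>z. u * P (u * z)) has_field_derivative u\<^sup>2 * deriv P (u * z)) (at z)" if z: "z \<in> ball 0 1" for z
    proof -
      have "((\<lambda>z. P (u * z)) has_field_derivative deriv P (u * z) * u) (at z)"
        by (rule DERIV_chain2[where g = "\<lambda>z. u * z"], rule holomorphic_derivI[OF hol open_ball ub[OF z]])
           (auto intro!: derivative_eq_intros)
      from DERIV_cmult[OF this, of u] show ?thesis by (simp add: power2_eq_square mult_ac)
    qed
    have "(\<integral>\<^sup>+z. ennreal (norm (u * P (u * z)) powr p * (1 - norm z ^ 2) powr (p - 2)) *
        indicator {z. R \<le> norm z \<and> norm z < 1 \<and> 0 < Re z \<and> \<bar>Im z\<bar> \<le> 3/4} z \<partial>lborel) < \<infinity>"
    proof (rule weighted_integral_strip[OF _ p _ R(1,2)])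
      show "(\<lambda>z. u * P (u * z)) holomorphic_on ball 0 1"
        using du by (subst holomorphic_on_open) (auto intro!: exI)
      show "(\<lambda>z. u\<^sup>2 * S (u * z)) z = deriv (\<lambda>z. u * P (u * z)) z - (u * P (u * z))\<^sup>2 / 2" if z: "z \<in> ball 0 1" for z
      proof -
        have "deriv P (u * z) = S (u * z) + (P (u * z))\<^sup>2 / 2" using S[OF ub[OF z]] by simp
        then have "deriv (\<lambda>z. u * P (u * z)) z = u\<^sup>2 * (S (u * z) + (P (u * z))\<^sup>2 / 2)"
          using DERIV_imp_deriv[OF du[OF z]] by simp
        then show ?thesis by (simp add: power_mult_distrib distrib_left)
      qed
      show "norm (u * P (u * z)) * (1 - norm z) \<le> (p - 1) / (4 * p)" if "R \<le> norm z" "norm z < 1" for z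
        using R0(2)[of "u * z"] that R u by (simp add: norm_mult)
      define W where "W z = ennreal (norm (S z) powr p * (1 - norm z ^ 2) powr (2 * p - 2)) * indicator (ball 0 1) z" for z
      have W: "W \<in> borel_measurable borel"
        unfolding W_def by (rule borel_measurable_weighted[OF cS p])
      have "weighted_integral p (2 * p - 2) (\<lambda>z. u\<^sup>2 * S (u * z)) = (\<integral>\<^sup>+z. W (u * z) \<partial>lborel)"
        unfolding weighted_integral_def W_def using u
        by (intro nn_integral_cong) (simp add: norm_mult norm_power indicator_def)
      also have "\<dots> = weighted_integral p (2 * p - 2) S"
        unfolding nn_integral_rotate[OF W u] by (simp add: W_def[abs_def] weighted_integral_def)
      finally show "weighted_integral p (2 * p - 2) (\<lambda>z. u\<^sup>2 * S (u * z)) < \<infinity>" using fin by simp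
    qed
    also have "(\<integral>\<^sup>+z. ennreal (norm (u * P (u * z)) powr p * (1 - norm z ^ 2) powr (p - 2)) *
        indicator {z. R \<le> norm z \<and> norm z < 1 \<and> 0 < Re z \<and> \<bar>Im z\<bar> \<le> 3/4} z \<partial>lborel)
      = (\<integral>\<^sup>+z. (\<lambda>z. K z * indicator E (cnj u * z)) (u * z) \<partial>lborel)"
      using u by (intro nn_integral_cong) (auto simp: uu K_def E_def norm_mult indicator_def)
    also have "\<dots> = (\<integral>\<^sup>+z. K z * indicator E (cnj u * z) \<partial>lborel)"
      by (rule nn_integral_rotate[OF _ u]) measurable
    finally show ?thesis .
  qed
  have "continuous_on (cball 0 R) (\<lambda>z. norm (P z) powr p * (1 - norm z ^ 2) powr (p - 2))"
  proof (intro continuous_on_mult)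
    have sub: "cball 0 R \<subseteq> ball (0::complex) 1" using R by auto
    show "continuous_on (cball 0 R) (\<lambda>z. norm (P z) powr p)"
      by (rule continuous_on_powr') (use p in \<open>auto intro!: continuous_intros continuous_on_subset[OF cP sub]\<close>)
    have "1 - norm z ^ 2 \<noteq> 0" if "z \<in> cball 0 R" for z :: complex
      using disk_weight_bounds(3)[of z] that R by auto
    then show "continuous_on (cball 0 R) (\<lambda>z::complex. (1 - norm z ^ 2) powr (p - 2))"
      by (intro continuous_on_powr continuous_on_diff continuous_on_power continuous_on_norm continuous_on_const continuous_on_id ballI)
  qed
  then have "bounded ((\<lambda>z. norm (P z) powr p * (1 - norm z ^ 2) powr (p - 2)) ` cball 0 R)"
    by (intro compact_imp_bounded compact_continuous_image compact_cball)
  then obtain C where C: "\<forall>x\<in>(\<lambda>z. norm (P z) powr p * (1 - norm z ^ 2) powr (p - 2)) ` cball 0 R. norm x \<le> C"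
    unfolding bounded_iff by blast
  \<comment> \<open>The part of the integrand on the strip turned by u.\<close>
  define I where "I u z = K z * indicator E (cnj u * z)" for u z
  have Im [measurable]: "I u \<in> borel_measurable borel" for u unfolding I_def by measurable
  have pt: "K z \<le> ennreal C * indicator (cball 0 R) z + (I 1 z + I (-1) z + (I \<i> z + I (-\<i>) z))" for z
  proof (cases "z \<in> ball 0 1")
    case False
    then show ?thesis by (simp add: K_def)
  next
    case z: True
    show ?thesis
    proof (cases "norm z \<le> R")
      case True
      then have "K z \<le> ennreal C * indicator (cball 0 R) z"
        using C z by (auto simp: K_def intro!: ennreal_leI)
      then show ?thesis by (rule order_trans) simp
    next
      case False
      have sq: "(Re z)\<^sup>2 + (Im z)\<^sup>2 < 1"
        using z power_strict_mono[of "norm z" 1 2] by (simp add: cmod_power2)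
      have half: "\<bar>t\<bar> \<le> 3/4" if "t\<^sup>2 \<le> 1/2" for t :: real
      proof -
        have "\<bar>t\<bar>\<^sup>2 \<le> (3/4)\<^sup>2" using that by (simp add: power2_eq_square)
        then show ?thesis by (rule power2_le_imp_le) simp
      qed
      have nz: "z \<noteq> 0" using False R by auto
      have "z \<in> E \<or> - z \<in> E \<or> cnj \<i> * z \<in> E \<or> cnj (-\<i>) * z \<in> E"
      proof (cases "(Im z)\<^sup>2 \<le> (Re z)\<^sup>2")
        case True
        then have "\<bar>Im z\<bar> \<le> 3/4" using sq by (intro half) simp
        moreover have "Re z \<noteq> 0" using True nz by (auto simp: complex_eq_iff)
        ultimately show ?thesis using False z by (auto simp: E_def)
      next
        case f: False
        then have "\<bar>Re z\<bar> \<le> 3/4" using sq by (intro half) simp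
        moreover have "Im z \<noteq> 0" using f by auto
        ultimately show ?thesis using False z by (auto simp: E_def norm_mult)
      qed
      then have "K z = I 1 z \<or> K z = I (-1) z \<or> K z = I \<i> z \<or> K z = I (-\<i>) z"
        by (auto simp: I_def)
      then show ?thesis
        by (elim disjE) (simp_all add: add_increasing add_increasing2)
    qed
  qed
  have "weighted_integral p (p - 2) P = (\<integral>\<^sup>+z. K z \<partial>lborel)"
    by (simp add: weighted_integral_def K_def[abs_def])
  also have "\<dots> \<le> (\<integral>\<^sup>+z. ennreal C * indicator (cball 0 R) z + (I 1 z + I (-1) z + (I \<i> z + I (-\<i>) z)) \<partial>lborel)"
    by (rule nn_integral_mono) (rule pt)
  also have "\<dots> = ennreal C * emeasure lborel (cball (0::complex) R) + (integral\<^sup>N lborel (I 1) + integral\<^sup>N lborel (I (-1))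
      + (integral\<^sup>N lborel (I \<i>) + integral\<^sup>N lborel (I (-\<i>))))"
  proof -
    have J: "(\<lambda>z. I u z + I v z) \<in> borel_measurable lborel"
      "(\<lambda>z. I u z + I v z + (I u' z + I v' z)) \<in> borel_measurable lborel" for u v u' v' by measurable
    have IM: "I u \<in> borel_measurable lborel" for u by measurable
    have [measurable]: "cball (0::complex) R \<in> sets borel" by (rule borel_closed) simp
    have C: "(\<lambda>z. ennreal C * indicator (cball (0::complex) R) z) \<in> borel_measurable lborel" by measurable
    show ?thesis
      unfolding nn_integral_add[OF C J(2)] nn_integral_add[OF J(1) J(1)] nn_integral_add[OF IM IM]
      by (subst nn_integral_cmult_indicator) auto
  qed
  also have "\<dots> < \<infinity>"
    using rot[of 1] rot[of "-1"] rot[of \<i>] rot[of "-\<i>"] emeasure_bounded_finite[of "cball (0::complex) R"]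
    by (simp add: I_def[abs_def] ennreal_mult_less_top)
  finally show ?thesis .
qed

section \<open>Comparison of weighted integrals\<close>

lemma powr_add_le:
  assumes "0 \<le> (x::real)" "0 \<le> y" "0 \<le> p"
  shows "(x + y) powr p \<le> 2 powr p * (x powr p + y powr p)"
proof -
  have "(x + y) powr p \<le> (2 * max x y) powr p" using assms by (intro powr_mono2) auto
  also have "\<dots> = 2 powr p * (max x y) powr p" using assms by (simp add: powr_mult)
  also have "(max x y) powr p \<le> x powr p + y powr p" by (simp add: max_def)
  finally show ?thesis by simp
qed

lemma weighted_integral_dominated:
  assumes c: "continuous_on (ball 0 1) B" "continuous_on (ball 0 1) D" and p: "1 < p"
    and le: "\<And>z. z \<in> ball 0 1 \<Longrightarrow> norm (A z) \<le> C * (norm (B z) + norm (D z))"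
    and fin: "weighted_integral p a B < \<infinity>" "weighted_integral p a D < \<infinity>"
  shows "weighted_integral p a A < \<infinity>"
proof -
  define W where "W G z = ennreal (norm (G z) powr p * (1 - norm z ^ 2) powr a) * indicator (ball 0 1) z" 
    for G :: "complex \<Rightarrow> complex" and z
  have [measurable]: "W B \<in> borel_measurable borel" "W D \<in> borel_measurable borel"
    unfolding W_def[abs_def] by (rule borel_measurable_weighted[OF _ p], fact)+
  define M where "M = (2 * \<bar>C\<bar>) powr p"
  have "W A z \<le> ennreal M * (W B z + W D z)" for z
  proof (cases "z \<in> ball 0 1")
    case True
    have "norm (A z) powr p \<le> (\<bar>C\<bar> * (norm (B z) + norm (D z))) powr p"
      using p by (intro powr_mono2 order_trans[OF le[OF True]] mult_right_mono) auto
    also have "\<dots> \<le> \<bar>C\<bar> powr p * (2 powr p * (norm (B z) powr p + norm (D z) powr p))"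
      using p by (subst powr_mult) (auto intro!: mult_left_mono powr_add_le)
    also have "\<dots> = M * (norm (B z) powr p + norm (D z) powr p)" by (simp add: M_def powr_mult)
    finally have "norm (A z) powr p * (1 - norm z ^ 2) powr a
       \<le> M * (norm (B z) powr p + norm (D z) powr p) * (1 - norm z ^ 2) powr a"
      by (rule mult_right_mono) simp
    then show ?thesis using True
      by (simp add: W_def ennreal_mult'[symmetric] ennreal_plus[symmetric] ennreal_leI distrib_left distrib_right mult.assoc
            M_def del: ennreal_plus)
  qed (simp add: W_def)
  then have "weighted_integral p a A \<le> (\<integral>\<^sup>+z. ennreal M * (W B z + W D z) \<partial>lborel)"
    unfolding weighted_integral_def W_def[symmetric] by (rule nn_integral_mono)
  also have "\<dots> = ennreal M * (weighted_integral p a B + weighted_integral p a D)"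
    unfolding weighted_integral_def W_def[symmetric] by (simp add: nn_integral_cmult nn_integral_add)
  also have "\<dots> < \<infinity>" using fin by (simp add: ennreal_mult_less_top)
  finally show ?thesis .
qed

lemma continuous_on_divide_weight:
  assumes "continuous_on (ball 0 1) (G :: complex \<Rightarrow> complex)"
  shows "continuous_on (ball 0 1) (\<lambda>z. G z / of_real (1 - norm z ^ 2))"
proof (rule continuous_on_divide[OF assms])
  show "continuous_on (ball 0 1) (\<lambda>z::complex. complex_of_real (1 - norm z ^ 2))"
    by (intro continuous_on_of_real continuous_on_diff continuous_on_power continuous_on_norm continuous_on_const continuous_on_id)
  show "\<forall>z\<in>ball (0::complex) 1. complex_of_real (1 - norm z ^ 2) \<noteq> 0"
  proof
    fix z :: complex assume "z \<in> ball 0 1"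
    then have "1 - norm z ^ 2 \<noteq> 0" using disk_weight_bounds(3)[of z] by simp
    then show "complex_of_real (1 - norm z ^ 2) \<noteq> 0" by (simp only: of_real_eq_0_iff not_False_eq_True)
  qed
qed

text \<open>Division by the weight turns a first-order quantity into one of second order. Products
  such as P w' or Q^2, with one factor of size 1/(1-|z|^2), can thus be estimated alongside w'' and
  Q'.\<close>

lemma weighted_integral_divide_weight:
  "weighted_integral p (2 * p - 2) (\<lambda>z. G z / of_real (1 - norm z ^ 2)) = weighted_integral p (p - 2) G"
  unfolding weighted_integral_def
proof (rule nn_integral_cong)
  fix z :: complex
  show "ennreal (norm (G z / of_real (1 - norm z ^ 2)) powr p * (1 - norm z ^ 2) powr (2 * p - 2)) * indicator (ball 0 1) z
      = ennreal (norm (G z) powr p * (1 - norm z ^ 2) powr (p - 2)) * indicator (ball 0 1) z"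
  proof (cases "norm z < 1")
    case True
    define d where "d = 1 - norm z ^ 2"
    have d: "d > 0" using disk_weight_bounds(3)[OF True] by (simp add: d_def)
    have "d powr (2 * p - 2) = d powr p * d powr (p - 2)" by (simp add: powr_add[symmetric])
    then have "norm (G z / of_real d) powr p * d powr (2 * p - 2) = norm (G z) powr p * d powr (p - 2)"
      using d by (simp only: norm_divide norm_of_real) (simp add: powr_divide)
    then show ?thesis by (simp only: d_def)
  qed simp
qed

text \<open>Cauchy's estimate on the disc of half the distance to the circle. It serves twice: for
  \<phi>, as the growth bound that excludes the value 2 on rays, and for w with bound 1.\<close>

lemma bounded_holomorphic_deriv_bound:
  assumes hol: "u holomorphic_on ball 0 1" and B: "\<And>z. z \<in> ball 0 1 \<Longrightarrow> norm (u z) \<le> B" and z: "z \<in> ball 0 1"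
  shows "norm (deriv u z) * (1 - norm z) \<le> 2 * B"
proof -
  define s where "s = (1 - norm z) / 2"
  have s: "s > 0" using z by (simp add: s_def)
  have sub: "cball z s \<subseteq> ball 0 1"
  proof
    fix x assume "x \<in> cball z s"
    then have "norm x \<le> norm z + s" using norm_triangle_sub[of x z] by (simp add: dist_norm norm_minus_commute)
    then have "norm x < 1" using z by (simp add: s_def field_simps)
    then show "x \<in> ball 0 1" by simp
  qed
  have "norm ((deriv ^^ 1) u z) \<le> fact 1 * B / s ^ 1"
  proof (rule Cauchy_inequality)
    show "u holomorphic_on ball z s" by (rule holomorphic_on_subset[OF hol]) (use sub in auto)
    show "continuous_on (cball z s) u"
      by (rule holomorphic_on_imp_continuous_on, rule holomorphic_on_subset[OF hol sub])
    fix x assume "norm (z - x) = s"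
    then show "norm (u x) \<le> B" using B[of x] sub by (auto simp: dist_norm)
  qed (rule s)
  then show ?thesis using s by (simp add: s_def field_simps)
qed

section \<open>Wirtinger calculus for the log-Jacobian\<close>

text \<open>A and B are the complex-linear and conjugate-linear coefficients of the real derivative,
  that is, the two Wirtinger derivatives. The predicate carries differentiability along with the
  values, which equations for \<open>dz\<close> and \<open>dzbar\<close> alone would not.\<close>

definition has_wirtinger :: "(complex \<Rightarrow> complex) \<Rightarrow> complex \<Rightarrow> complex \<Rightarrow> complex \<Rightarrow> bool" where
  "has_wirtinger G z A B \<longleftrightarrow> (G has_derivative (\<lambda>h. A * h + B * cnj h)) (at z)"

lemma has_wirtinger_dz: "has_wirtinger G z A B \<Longrightarrow> dz G z = A"
  and has_wirtinger_dzbar: "has_wirtinger G z A B \<Longrightarrow> dzbar G z = B"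
  by (auto simp: has_wirtinger_def dz_def dzbar_def algebra_simps dest!: frechet_derivative_at[symmetric])

lemma has_wirtinger_cong:
  assumes "has_wirtinger G z A B" "open S" "z \<in> S" "\<And>x. x \<in> S \<Longrightarrow> G x = H x"
  shows "has_wirtinger H z A B"
  using assms unfolding has_wirtinger_def by (rule has_derivative_transform_within_open)

lemma has_wirtinger_holomorphic:
  assumes "f holomorphic_on S" "open S" "z \<in> S"
  shows "has_wirtinger f z (deriv f z) 0"
  using holomorphic_derivI[OF assms] by (simp add: has_wirtinger_def has_field_derivative_def)

lemma has_wirtinger_cnj:
  assumes "has_wirtinger f z A B"
  shows "has_wirtinger (\<lambda>z. cnj (f z)) z (cnj B) (cnj A)"
  using has_derivative_cnj[OF assms[unfolded has_wirtinger_def]]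
  by (simp add: has_wirtinger_def add.commute)

lemma has_wirtinger_add:
  assumes "has_wirtinger f z A B" "has_wirtinger g z A' B'"
  shows "has_wirtinger (\<lambda>z. f z + g z) z (A + A') (B + B')"
  using has_derivative_add[OF assms[unfolded has_wirtinger_def]]
  by (simp add: has_wirtinger_def algebra_simps)

lemma has_wirtinger_diff:
  assumes "has_wirtinger f z A B" "has_wirtinger g z A' B'"
  shows "has_wirtinger (\<lambda>z. f z - g z) z (A - A') (B - B')"
  using has_derivative_diff[OF assms[unfolded has_wirtinger_def]]
  by (simp add: has_wirtinger_def algebra_simps)

lemma has_wirtinger_mult:
  assumes "has_wirtinger f z A B" "has_wirtinger g z A' B'"
  shows "has_wirtinger (\<lambda>z. f z * g z) z (A * g z + f z * A') (B * g z + f z * B')"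
  using has_derivative_mult[OF assms[unfolded has_wirtinger_def]]
  by (simp add: has_wirtinger_def algebra_simps)

lemma has_wirtinger_compose_field:
  assumes "has_wirtinger f z A B" "(\<phi> has_field_derivative D) (at (f z))"
  shows "has_wirtinger (\<lambda>z. \<phi> (f z)) z (D * A) (D * B)"
  using has_derivative_compose[OF assms(1)[unfolded has_wirtinger_def] assms(2)[unfolded has_field_derivative_def]]
  by (simp add: has_wirtinger_def algebra_simps)

lemma has_wirtinger_inverse:
  assumes "has_wirtinger f z A B" "f z \<noteq> 0"
  shows "has_wirtinger (\<lambda>z. inverse (f z)) z (- A * (inverse (f z))\<^sup>2) (- B * (inverse (f z))\<^sup>2)"
  using has_wirtinger_compose_field[OF assms(1) DERIV_inverse[OF assms(2)]]
  by (simp add: mult.commute numeral_2_eq_2)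

lemma has_wirtinger_divide:
  assumes "has_wirtinger f z A B" "has_wirtinger g z A' B'" "g z \<noteq> 0"
  shows "has_wirtinger (\<lambda>z. f z / g z) z ((A * g z - f z * A') / (g z)\<^sup>2) ((B * g z - f z * B') / (g z)\<^sup>2)"
  using has_wirtinger_mult[OF assms(1) has_wirtinger_inverse[OF assms(2,3)]] assms(3)
  by (simp add: divide_inverse[symmetric] field_simps power2_eq_square)

text \<open>The real logarithm is exchanged for \<open>Ln\<close>, which is holomorphic near the
  positive reals, so that the chain rule with a complex derivative applies.\<close>

lemma has_wirtinger_ln:
  assumes "has_wirtinger (\<lambda>z. of_real (\<phi> z)) z A B" "\<phi> z > 0" 
    and pos: "open S" "z \<in> S" "\<And>x. x \<in> S \<Longrightarrow> \<phi> x > 0"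
  shows "has_wirtinger (\<lambda>z. of_real (ln (\<phi> z))) z (A / of_real (\<phi> z)) (B / of_real (\<phi> z))"
proof -
  have "(Ln has_field_derivative inverse (of_real (\<phi> z))) (at (of_real (\<phi> z)))"
    using assms(2) by (intro has_field_derivative_Ln) (auto simp: complex_nonpos_Reals_iff)
  from has_wirtinger_compose_field[OF assms(1) this]
  have "has_wirtinger (\<lambda>z. Ln (of_real (\<phi> z))) z (A / of_real (\<phi> z)) (B / of_real (\<phi> z))"
    by (simp add: field_simps)
  then show ?thesis
    by (rule has_wirtinger_cong[OF _ pos(1,2)]) (use pos in \<open>auto simp: Ln_of_real\<close>)
qed

text \<open>The algebra generated by holomorphic functions, their conjugates and $1/J$ is stable under both
  Wirtinger derivatives, so every function with derivatives in it is smooth.\<close>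

inductive wirtinger_algebra :: "complex set \<Rightarrow> (complex \<Rightarrow> complex) \<Rightarrow> (complex \<Rightarrow> complex) \<Rightarrow> (complex \<Rightarrow> complex) \<Rightarrow> bool"
  for S h g where
  hol: "f holomorphic_on S \<Longrightarrow> wirtinger_algebra S h g f"
| cnj: "f holomorphic_on S \<Longrightarrow> wirtinger_algebra S h g (\<lambda>z. cnj (f z))"
| add: "\<lbrakk>wirtinger_algebra S h g a; wirtinger_algebra S h g b\<rbrakk> \<Longrightarrow> wirtinger_algebra S h g (\<lambda>z. a z + b z)"
| mult: "\<lbrakk>wirtinger_algebra S h g a; wirtinger_algebra S h g b\<rbrakk> \<Longrightarrow> wirtinger_algebra S h g (\<lambda>z. a z * b z)"
| inv: "wirtinger_algebra S h g (\<lambda>z. inverse (of_real (jac h g z)))"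

lemma jac_eq: "complex_of_real (jac h g z) = deriv h z * cnj (deriv h z) - deriv g z * cnj (deriv g z)"
  by (simp only: jac_def of_real_diff complex_norm_square)

lemma has_wirtinger_jac:
  assumes "h holomorphic_on S" "g holomorphic_on S" "open S" "z \<in> S"
  shows "has_wirtinger (\<lambda>z. of_real (jac h g z)) z
      (deriv (deriv h) z * cnj (deriv h z) - deriv (deriv g) z * cnj (deriv g z))
      (deriv h z * cnj (deriv (deriv h) z) - deriv g z * cnj (deriv (deriv g) z))"
proof -
  note hol = has_wirtinger_holomorphic[OF holomorphic_deriv[OF _ assms(3)] assms(3,4)]
  show ?thesis
    using has_wirtinger_diff[OF has_wirtinger_mult[OF hol has_wirtinger_cnj[OF hol], OF assms(1) assms(1)]
        has_wirtinger_mult[OF hol has_wirtinger_cnj[OF hol], OF assms(2) assms(2)]]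
    by (simp add: jac_eq)
qed

lemma wirtinger_algebra_uminus: 
  assumes "wirtinger_algebra S h g a"
  shows "wirtinger_algebra S h g (\<lambda>z. - a z)"
  using wirtinger_algebra.mult[OF wirtinger_algebra.hol[of "\<lambda>_. -1"] assms] by simp

lemma wirtinger_algebra_jac_deriv:
  assumes "h holomorphic_on S" "g holomorphic_on S" "open S"
  shows "wirtinger_algebra S h g (\<lambda>z. deriv (deriv h) z * cnj (deriv h z) - deriv (deriv g) z * cnj (deriv g z))"
    and "wirtinger_algebra S h g (\<lambda>z. deriv h z * cnj (deriv (deriv h) z) - deriv g z * cnj (deriv (deriv g) z))"
  unfolding diff_conv_add_uminus
  by (intro wirtinger_algebra.add wirtinger_algebra_uminus wirtinger_algebra.mult;
      (rule wirtinger_algebra.cnj wirtinger_algebra.hol); intro holomorphic_deriv assms)+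

lemma wirtinger_algebra_derivs:
  assumes "wirtinger_algebra S h g G" and hg: "h holomorphic_on S" "g holomorphic_on S" "open S"
    and nz: "\<And>z. z \<in> S \<Longrightarrow> jac h g z \<noteq> 0"
  shows "\<exists>A B. wirtinger_algebra S h g A \<and> wirtinger_algebra S h g B \<and>
    (\<forall>z\<in>S. has_wirtinger G z (A z) (B z))"
  using assms(1)
proof induction
  case (hol f)
  have "wirtinger_algebra S h g (deriv f)" "wirtinger_algebra S h g (\<lambda>_. 0)"
    using hol hg by (auto intro: wirtinger_algebra.hol holomorphic_deriv)
  then show ?case using has_wirtinger_holomorphic[OF hol hg(3)] by blast
next
  case (cnj f)
  have "wirtinger_algebra S h g (\<lambda>z. cnj (deriv f z))" "wirtinger_algebra S h g (\<lambda>_. 0)"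
    using cnj hg by (auto intro: wirtinger_algebra.intros holomorphic_deriv)
  moreover have "has_wirtinger (\<lambda>z. cnj (f z)) z 0 (cnj (deriv f z))" if "z \<in> S" for z
    using has_wirtinger_cnj[OF has_wirtinger_holomorphic[OF cnj hg(3) that]] by simp
  ultimately show ?case by (intro exI conjI ballI) 
next
  case (add a b)
  then obtain A B A' B' where "wirtinger_algebra S h g A" "wirtinger_algebra S h g B"
    "wirtinger_algebra S h g A'" "wirtinger_algebra S h g B'"
    "\<And>z. z \<in> S \<Longrightarrow> has_wirtinger a z (A z) (B z)" "\<And>z. z \<in> S \<Longrightarrow> has_wirtinger b z (A' z) (B' z)"
    by blast
  then show ?case
    by (intro exI[of _ "\<lambda>z. A z + A' z"] exI[of _ "\<lambda>z. B z + B' z"] conjI ballI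
        has_wirtinger_add wirtinger_algebra.add)
next
  case (mult a b)
  then obtain A B A' B' where "wirtinger_algebra S h g A" "wirtinger_algebra S h g B"
    "wirtinger_algebra S h g A'" "wirtinger_algebra S h g B'"
    "\<And>z. z \<in> S \<Longrightarrow> has_wirtinger a z (A z) (B z)" "\<And>z. z \<in> S \<Longrightarrow> has_wirtinger b z (A' z) (B' z)"
    by blast
  with mult.hyps show ?case
    by (intro exI[of _ "\<lambda>z. A z * b z + a z * A' z"] exI[of _ "\<lambda>z. B z * b z + a z * B' z"] conjI ballI
        has_wirtinger_mult wirtinger_algebra.add wirtinger_algebra.mult)
next
  case inv
  let ?A = "\<lambda>z. deriv (deriv h) z * cnj (deriv h z) - deriv (deriv g) z * cnj (deriv g z)"
  let ?B = "\<lambda>z. deriv h z * cnj (deriv (deriv h) z) - deriv g z * cnj (deriv (deriv g) z)"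
  let ?I = "\<lambda>z. inverse (complex_of_real (jac h g z))"
  show ?case
  proof (intro exI conjI ballI)
    show "wirtinger_algebra S h g (\<lambda>z. - ?A z * (?I z * ?I z))" "wirtinger_algebra S h g (\<lambda>z. - ?B z * (?I z * ?I z))"
      by (intro wirtinger_algebra.mult wirtinger_algebra.inv wirtinger_algebra_uminus
          wirtinger_algebra_jac_deriv hg)+
    fix z assume z: "z \<in> S"
    show "has_wirtinger ?I z (- ?A z * (?I z * ?I z)) (- ?B z * (?I z * ?I z))"
      using has_wirtinger_inverse[OF has_wirtinger_jac[OF hg z]] nz[OF z]
      by (simp add: power2_eq_square)
  qed
qed

lemma smooth_on_if_wirtinger_algebra:
  assumes "wirtinger_algebra S h g A" "wirtinger_algebra S h g B" "\<And>z. z \<in> S \<Longrightarrow> has_wirtinger G z (A z) (B z)"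
    and hg: "h holomorphic_on S" "g holomorphic_on S" "open S"
    and nz: "\<And>z. z \<in> S \<Longrightarrow> jac h g z \<noteq> 0"
  shows "smooth_on S G"
proof -
  have "\<exists>A B. wirtinger_algebra S h g A \<and> wirtinger_algebra S h g B \<and>
    (\<forall>z\<in>S. has_wirtinger (wirt bs G) z (A z) (B z))" for bs
  proof (induction bs)
    case Nil
    then show ?case using assms by auto
  next
    case (Cons b bs)
    then obtain A B where AB: "wirtinger_algebra S h g A" "wirtinger_algebra S h g B"
      "\<And>z. z \<in> S \<Longrightarrow> has_wirtinger (wirt bs G) z (A z) (B z)" by blast
    \<comment> \<open>The iterated derivative agrees with a member of the algebra only on
      \<open>S\<close>; openness of \<open>S\<close> lets the next derivative be taken from that
      member.\<close>
    define E where "E = (if b then A else B)"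
    have eq: "E z = wirt (b # bs) G z" if "z \<in> S" for z
      using has_wirtinger_dz[OF AB(3)[OF that]] has_wirtinger_dzbar[OF AB(3)[OF that]] by (simp add: E_def)
    have "wirtinger_algebra S h g E" using AB by (simp add: E_def)
    then obtain A' B' where "wirtinger_algebra S h g A'" "wirtinger_algebra S h g B'"
      "\<And>z. z \<in> S \<Longrightarrow> has_wirtinger E z (A' z) (B' z)"
      using wirtinger_algebra_derivs[OF _ hg nz] by blast
    then show ?case
      using has_wirtinger_cong[OF _ hg(3), of E _ _ _ "wirt (b # bs) G"] eq by blast
  qed
  then show ?thesis
    unfolding smooth_on_def has_wirtinger_def differentiable_def by blast
qed

lemma smooth_on_logjac:
  assumes hg: "h holomorphic_on S" "g holomorphic_on S" "open S"
    and pos: "\<And>z. z \<in> S \<Longrightarrow> jac h g z > 0"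
  shows "smooth_on S (logjac h g)"
proof (rule smooth_on_if_wirtinger_algebra)
  let ?A = "\<lambda>z. deriv (deriv h) z * cnj (deriv h z) - deriv (deriv g) z * cnj (deriv g z)"
  let ?B = "\<lambda>z. deriv h z * cnj (deriv (deriv h) z) - deriv g z * cnj (deriv (deriv g) z)"
  let ?I = "\<lambda>z. inverse (complex_of_real (jac h g z))"
  show "wirtinger_algebra S h g (\<lambda>z. ?A z * ?I z)" "wirtinger_algebra S h g (\<lambda>z. ?B z * ?I z)"
    by (intro wirtinger_algebra.mult wirtinger_algebra.inv wirtinger_algebra_jac_deriv hg)+
  show "has_wirtinger (logjac h g) z (?A z * ?I z) (?B z * ?I z)" if "z \<in> S" for z
    using has_wirtinger_ln[OF has_wirtinger_jac[OF hg that] pos[OF that] hg(3) that pos]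
    unfolding logjac_def divide_inverse by blast
  show "jac h g z \<noteq> 0" if "z \<in> S" for z using pos[OF that] by simp
qed (use hg in auto)

text \<open>Since g' = w h', the Jacobian is |h'|^2 (1-|w|^2), so log J splits into log |h'|^2,
  which contributes P, and log (1 - w cnj w), which contributes the correction. As log J is real,
  its two Wirtinger derivatives are conjugate.\<close>

lemma logjac_derivatives:
  fixes h g :: "complex \<Rightarrow> complex"
  assumes hg: "h holomorphic_on S" "g holomorphic_on S" "open S" 
    and h': "\<And>z. z \<in> S \<Longrightarrow> deriv h z \<noteq> 0"
    and pos: "\<And>z. z \<in> S \<Longrightarrow> norm (deriv g z) < norm (deriv h z)"
    and w: "w = (\<lambda>z. deriv g z / deriv h z)" and P: "P = (\<lambda>z. deriv (deriv h) z / deriv h z)"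
    and z: "z \<in> S"
  shows "dz (logjac h g) z = P z - deriv w z * cnj (w z) / (1 - w z * cnj (w z))" (is "_ = ?F z")
    and "dzbar (logjac h g) z = cnj (P z - deriv w z * cnj (w z) / (1 - w z * cnj (w z)))"
    and "harm_schwarzian h g z = deriv P z - (P z)\<^sup>2 / 2
       + cnj (w z) / (1 - w z * cnj (w z)) * (deriv w z * P z - deriv (deriv w) z)
       - 3 / 2 * (deriv w z * cnj (w z) / (1 - w z * cnj (w z)))\<^sup>2"
proof -
  have hw: "w holomorphic_on S" and hP: "P holomorphic_on S"
    unfolding w P by (intro holomorphic_on_divide holomorphic_deriv hg h'; simp)+
  have nw: "1 - w x * cnj (w x) \<noteq> 0" if "x \<in> S" for x
  proof -
    have "norm (w x * cnj (w x)) < 1 * 1"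
      unfolding norm_mult w using pos[OF that] h'[OF that]
      by (intro mult_strict_mono') (auto simp: norm_divide field_simps)
    then show ?thesis by (metis diff_eq_diff_eq diff_self less_irrefl mult_1 norm_one)
  qed
  have jp: "jac h g x > 0" if "x \<in> S" for x
    using pos[OF that] by (simp add: jac_def power_strict_mono)
  have F: "has_wirtinger (logjac h g) x (?F x) (cnj (?F x))" if x: "x \<in> S" for x
  proof -
    have g1: "deriv g x = w x * deriv h x" if "x \<in> S" for x using h'[OF that] by (simp add: w)
    have g2: "deriv (deriv g) x = deriv w x * deriv h x + w x * deriv (deriv h) x"
    proof (rule DERIV_imp_deriv)
      have "((\<lambda>x. w x * deriv h x) has_field_derivative deriv w x * deriv h x + deriv (deriv h) x * w x) (at x)"
        by (rule DERIV_mult[OF holomorphic_derivI[OF hw hg(3) x] holomorphic_derivI[OF holomorphic_deriv[OF hg(1,3)] hg(3) x]])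
      then have "((\<lambda>x. w x * deriv h x) has_field_derivative deriv w x * deriv h x + w x * deriv (deriv h) x) (at x)"
        by (simp add: mult.commute)
      then show "(deriv g has_field_derivative deriv w x * deriv h x + w x * deriv (deriv h) x) (at x)"
        by (rule has_field_derivative_transform_within_open[OF _ hg(3) x]) (simp add: g1)
    qed
    have J: "complex_of_real (jac h g x) = deriv h x * cnj (deriv h x) * (1 - w x * cnj (w x))"
      by (simp add: jac_eq g1[OF x] algebra_simps)
    have A: "(deriv (deriv h) x * cnj (deriv h x) - deriv (deriv g) x * cnj (deriv g x)) / of_real (jac h g x) = ?F x"
      unfolding J g2 g1[OF x] P using h'[OF x] nw[OF x] by (simp add: field_simps)
    have B: "(deriv h x * cnj (deriv (deriv h) x) - deriv g x * cnj (deriv (deriv g) x)) / of_real (jac h g x) = cnj (?F x)"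
      unfolding A[symmetric] by (simp add: mult.commute)
    from has_wirtinger_ln[OF has_wirtinger_jac[OF hg x] jp[OF x] hg(3) x jp]
    show ?thesis unfolding A B logjac_def by blast
  qed
  show 1: "dz (logjac h g) z = ?F z" and "dzbar (logjac h g) z = cnj (?F z)"
    using has_wirtinger_dz[OF F[OF z]] has_wirtinger_dzbar[OF F[OF z]] .
  have W: "has_wirtinger w z (deriv w z) 0" "has_wirtinger P z (deriv P z) 0" 
    "has_wirtinger (deriv w) z (deriv (deriv w) z) 0" 
    using hw hP hg z by (auto intro!: has_wirtinger_holomorphic holomorphic_deriv)
  have one: "has_wirtinger (\<lambda>_. 1) z 0 0" by (simp add: has_wirtinger_def)
  note D = has_wirtinger_diff[OF W(2) has_wirtinger_divide[OF has_wirtinger_mult[OF W(3) has_wirtinger_cnj[OF W(1)]]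
    has_wirtinger_diff[OF one has_wirtinger_mult[OF W(1) has_wirtinger_cnj[OF W(1)]]] nw[OF z]]]
  have eq: "?F x = dz (logjac h g) x" if "x \<in> S" for x
    using has_wirtinger_dz[OF F[OF that]] by simp
  note D' = has_wirtinger_dz[OF has_wirtinger_cong[where H = "dz (logjac h g)", OF D hg(3) z eq]]
  show "harm_schwarzian h g z = deriv P z - (P z)\<^sup>2 / 2
       + cnj (w z) / (1 - w z * cnj (w z)) * (deriv w z * P z - deriv (deriv w) z)
       - 3 / 2 * (deriv w z * cnj (w z) / (1 - w z * cnj (w z)))\<^sup>2"
  proof -
    define X where "X = cnj (w z) / (1 - w z * cnj (w z))"
    \<comment> \<open>Quotient rule, using that the z-derivative of cnj w is zero: w' cnj w/(1 - w
      cnj w) has z-derivative w'' X + (w' X)^2.\<close>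
    have ddz: "dz (dz (logjac h g)) z = deriv P z - (deriv (deriv w) z * X + (deriv w z * X)\<^sup>2)"
    proof -
      have "(a * c * q - b * c * (- (b * c))) / q\<^sup>2 = a * (c / q) + (b * (c / q))\<^sup>2" if "q \<noteq> 0" for a b c q :: complex
        using that by (simp add: field_simps power2_eq_square)
      from this[OF nw[OF z], of "deriv (deriv w) z" "cnj (w z)" "deriv w z"] show ?thesis using D' unfolding X_def by simp
    qed
    then show ?thesis
      unfolding harm_schwarzian_def ddz 1 times_divide_eq_right[symmetric] X_def[symmetric]
      by (simp add: field_simps power2_eq_square)
  qed
qed

section \<open>The equivalence\<close>

theorem theorem2:
  fixes p :: real and h g :: "complex \<Rightarrow> complex" and lam :: complex
  assumes p: "1 < p"
    and hol_h: "h holomorphic_on unit_disk" and hol_g: "g holomorphic_on unit_disk"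
    and h0: "h 0 = 0" and g0: "g 0 = 0"
    and h'_nz: "\<forall>z\<in>unit_disk. deriv h z \<noteq> 0"
    and sense_pres: "\<forall>z\<in>unit_disk. norm (deriv g z) < norm (deriv h z)"
    and univalent: "inj_on (\<lambda>z. h z + cnj (g z)) unit_disk"
    and w_besov: "besov p (\<lambda>z. deriv g z / deriv h z)"
    and w_norm: "(SUP z\<in>unit_disk. norm (deriv g z / deriv h z)) < 1"
    and lam: "norm lam = 1"
    and phi_conf: "inj_on (\<lambda>z. h z + lam * g z) unit_disk"
    and phi_jordan: "\<exists>\<Phi>. continuous_on (cball 0 1) \<Phi>
                        \<and> (\<forall>z\<in>unit_disk. \<Phi> z = h z + lam * g z)
                        \<and> inj_on \<Phi> (sphere 0 1)"
  shows "besov_tilde p (logjac h g) \<longleftrightarrow>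
         (\<integral>\<^sup>+ z. ennreal (norm (harm_schwarzian h g z) powr p * (1 - norm z ^ 2) powr (2 * p - 2))
            * indicator unit_disk z \<partial>lborel) < \<infinity>"
proof -
  define w where "w = (\<lambda>z. deriv g z / deriv h z)"
  \<comment> \<open>\<open>F\<close>, \<open>Q\<close> and \<open>S\<close> are the derivative, the
    pre-Schwarzian and the Schwarzian of \<phi> = h + \<open>lam\<close> g, whereas \<open>P\<close>
    belongs to h. The coefficients \<open>A\<close> and \<open>X\<close> play parallel roles: Q = P
    + A w', and the z-derivative of log J is P - X w'.\<close>
  define P where "P = (\<lambda>z. deriv (deriv h) z / deriv h z)"
  define A where "A z = lam / (1 + lam * w z)" for z
  define X where "X z = cnj (w z) / (1 - w z * cnj (w z))" for z
  define F where "F z = deriv h z * (1 + lam * w z)" for z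
  define Q where "Q z = P z + A z * deriv w z" for z
  define S where "S z = deriv Q z - (Q z)\<^sup>2 / 2" for z
  define k where "k = (SUP z\<in>unit_disk. norm (w z))"
  \<comment> \<open>One bound for both coefficients, since |1 + \<open>lam\<close> w| and 1-|w|^2
    are at least 1 - k.\<close>
  define c where "c = 1 / (1 - k)"
  let ?Fz = "\<lambda>z. P z - X z * deriv w z"
  let ?Sf = "\<lambda>z. deriv P z - (P z)\<^sup>2 / 2 - X z * (deriv (deriv w) z - P z * deriv w z) - 3/2 * (X z)\<^sup>2 * (deriv w z)\<^sup>2"
  have h': "deriv h z \<noteq> 0" if "z \<in> unit_disk" for z using h'_nz that by blast
  have w1: "norm (w z) < 1" if "z \<in> unit_disk" for z
    using sense_pres h'[OF that] that by (auto simp: w_def norm_divide field_simps)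
  have k1: "k < 1" using w_norm by (simp add: k_def w_def)
  have wk: "norm (w z) \<le> k" if "z \<in> unit_disk" for z
    unfolding k_def using that w1 by (intro cSUP_upper bdd_aboveI[of _ 1]) (auto intro: less_imp_le)
  have c0: "c > 0" using k1 by (simp add: c_def)
  have holw: "w holomorphic_on unit_disk" and holP: "P holomorphic_on unit_disk"
    unfolding w_def P_def by (intro holomorphic_on_divide holomorphic_deriv hol_h hol_g open_ball h'; simp)+
  have den: "1 - k \<le> norm (1 + lam * w z)" "1 - k \<le> norm (1 - w z * cnj (w z))" if z: "z \<in> unit_disk" for z
  proof -
    have "norm (lam * w z) \<le> k" using wk[OF z] lam by (simp add: norm_mult)
    then show "1 - k \<le> norm (1 + lam * w z)" using norm_diff_ineq[of 1 "lam * w z"] by simp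
    have "norm (w z * cnj (w z)) \<le> k * 1"
      unfolding norm_mult using wk[OF z] w1[OF z] order_trans[OF norm_ge_zero wk[OF z]] by (intro mult_mono) auto
    then show "1 - k \<le> norm (1 - w z * cnj (w z))" using norm_triangle_ineq2[of 1 "w z * cnj (w z)"] by simp
  qed
  have nz: "1 + lam * w z \<noteq> 0" "1 - w z * cnj (w z) \<noteq> 0" if "z \<in> unit_disk" for z
    using den[OF that] k1 by auto
  have Ac: "norm (A z) \<le> c" if "z \<in> unit_disk" for z
    using den(1)[OF that] k1 lam by (simp add: A_def c_def norm_divide frac_le)
  have Xc: "norm (X z) \<le> c" if "z \<in> unit_disk" for z
    using den(2)[OF that] k1 w1[OF that] by (simp add: X_def c_def norm_divide frac_le)
  have holA: "A holomorphic_on unit_disk"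
    unfolding A_def by (intro holomorphic_intros holw nz(1))
  have holw': "deriv w holomorphic_on unit_disk" "deriv (deriv w) holomorphic_on unit_disk"
    by (intro holomorphic_deriv holw open_ball)+
  have holQ: "Q holomorphic_on unit_disk"
    unfolding Q_def by (intro holomorphic_intros holP holA holw')
  have holS: "S holomorphic_on unit_disk"
    unfolding S_def by (intro holomorphic_intros holomorphic_deriv holQ open_ball) simp
  have holF: "F holomorphic_on unit_disk"
    unfolding F_def by (intro holomorphic_intros holomorphic_deriv hol_h holw open_ball)
  have Fnz: "F z \<noteq> 0" if "z \<in> unit_disk" for z using h'[OF that] nz(1)[OF that] by (simp add: F_def)

  \<comment> \<open>The conformal map \<phi>: derivative, pre-Schwarzian and growth\<close>
  define \<phi> where "\<phi> z = h z + lam * g z" for z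
  have hol\<phi>: "\<phi> holomorphic_on unit_disk" unfolding \<phi>_def by (intro holomorphic_intros hol_h hol_g)
  have d\<phi>: "deriv \<phi> z = F z" if z: "z \<in> unit_disk" for z
  proof (rule DERIV_imp_deriv)
    have "(\<phi> has_field_derivative deriv h z + lam * deriv g z) (at z)"
      unfolding \<phi>_def by (intro DERIV_add DERIV_cmult holomorphic_derivI[OF hol_h open_ball z] holomorphic_derivI[OF hol_g open_ball z])
    moreover have "F z = deriv h z + lam * deriv g z"
      using h'[OF z] by (simp add: F_def w_def field_simps)
    ultimately show "(\<phi> has_field_derivative F z) (at z)" by simp
  qed
  have QF: "Q z = deriv F z / F z" if z: "z \<in> unit_disk" for z
  proof -
    have "(F has_field_derivative deriv h z * (lam * deriv w z) + deriv (deriv h) z * (1 + lam * w z)) (at z)"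
      unfolding F_def
      by (rule derivative_eq_intros holomorphic_derivI[OF holw open_ball z] 
          holomorphic_derivI[OF holomorphic_deriv[OF hol_h open_ball] open_ball z] refl | simp)+
    then have "deriv F z = deriv h z * (lam * deriv w z) + deriv (deriv h) z * (1 + lam * w z)"
      by (rule DERIV_imp_deriv)
    then show ?thesis
      using h'[OF z] nz(1)[OF z] by (simp add: Q_def P_def A_def F_def add_divide_distrib)
  qed
  have d2\<phi>: "deriv (deriv \<phi>) z / deriv \<phi> z = Q z" if z: "z \<in> unit_disk" for z
  proof -
    have "eventually (\<lambda>x. deriv \<phi> x = F x) (nhds z)"
      using eventually_nhds_in_open[OF open_ball z] by eventually_elim (rule d\<phi>)
    then have "deriv (deriv \<phi>) z = deriv F z" by (rule deriv_cong_ev) simp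
    then show ?thesis using d\<phi>[OF z] QF[OF z] by simp
  qed
  obtain K :: real where K: "K > 0" 
    "\<And>f z. \<lbrakk>f holomorphic_on ball 0 1; inj_on f (ball 0 1); z \<in> ball 0 1\<rbrakk>
      \<Longrightarrow> norm (deriv (deriv f) z / deriv f z) * (1 - norm z) \<le> K"
    using univalent_pre_schwarzian_bound by blast
  have QK: "norm (Q z) * (1 - norm z) \<le> K" if z: "z \<in> unit_disk" for z
    using K(2)[OF hol\<phi> _ z] phi_conf d2\<phi>[OF z] unfolding \<phi>_def by simp
  obtain B where B: "norm (\<phi> z) \<le> B" if "z \<in> unit_disk" for z
  proof -
    obtain \<Phi> where \<Phi>: "continuous_on (cball 0 1) \<Phi>" "\<forall>z\<in>unit_disk. \<Phi> z = h z + lam * g z"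
      using phi_jordan by blast
    have "bounded (\<Phi> ` cball 0 1)"
      by (intro compact_imp_bounded compact_continuous_image \<Phi> compact_cball)
    then obtain B where B: "\<forall>x\<in>\<Phi> ` cball 0 1. norm x \<le> B" unfolding bounded_iff by blast
    show ?thesis
    proof (rule that[of B])
      fix z :: complex assume "z \<in> unit_disk"
      then show "norm (\<phi> z) \<le> B" using B \<Phi>(2) by (auto simp: \<phi>_def dest!: bspec[of _ _ z])
    qed
  qed
  have Fgrowth: "norm (F z) * (1 - norm z) \<le> 2 * B" if z: "z \<in> unit_disk" for z
    using bounded_holomorphic_deriv_bound[OF hol\<phi> B z] d\<phi>[OF z] by simp
  have w'2: "norm (deriv w z) * (1 - norm z) \<le> 2" if z: "z \<in> unit_disk" for z
    using bounded_holomorphic_deriv_bound[OF holw _ z, of 1] w1 by (simp add: less_imp_le)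
  have inv_weight: "norm u \<le> 2 * M / (1 - norm z ^ 2)" if "norm u * (1 - norm z) \<le> M" "z \<in> unit_disk" for u z :: complex and M
  proof -
    note d = disk_weight_bounds[of z]
    have "norm u * (1 - norm z ^ 2) \<le> norm u * (2 * (1 - norm z))"
      using d that by (intro mult_left_mono) auto
    also have "\<dots> = 2 * (norm u * (1 - norm z))" by simp
    also have "\<dots> \<le> 2 * M" using that by simp
    finally show ?thesis using d that by (simp add: pos_le_divide_eq)
  qed
  \<comment> \<open>Because A' = -A^2 w', this is \<open>?Sf\<close> with A in place of -X. The
    terms in P' and P^2 therefore cancel in the difference of the two Schwarzians.\<close>
  have S_eq: "S z = deriv P z - (P z)\<^sup>2 / 2 + A z * (deriv (deriv w) z - P z * deriv w z) - 3/2 * (A z)\<^sup>2 * (deriv w z)\<^sup>2"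
    if z: "z \<in> unit_disk" for z
  proof -
    have "(A has_field_derivative - (A z)\<^sup>2 * deriv w z) (at z)"
      unfolding A_def
      by (rule derivative_eq_intros holomorphic_derivI[OF holw open_ball z] refl nz(1)[OF z]
         | simp add: power2_eq_square)+
    from DERIV_add[OF holomorphic_derivI[OF holP open_ball z] DERIV_mult[OF this holomorphic_derivI[OF holw'(1) open_ball z]]]
    have dQ: "deriv Q z = deriv P z + (- (A z)\<^sup>2 * deriv w z * deriv w z + deriv (deriv w) z * A z)"
      unfolding Q_def by (rule DERIV_imp_deriv)
    show ?thesis unfolding S_def dQ unfolding Q_def by (simp add: field_simps power2_eq_square)
  qed
  have cA: "continuous_on unit_disk A" and cw: "continuous_on unit_disk w" 
    and cw': "continuous_on unit_disk (deriv w)" and cw'': "continuous_on unit_disk (deriv (deriv w))"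
    and cP: "continuous_on unit_disk P" and cP': "continuous_on unit_disk (deriv P)" 
    and cQ: "continuous_on unit_disk Q" and cQ': "continuous_on unit_disk (deriv Q)"
    and cS: "continuous_on unit_disk S"
    using holA holw holw' holP holQ holS 
    by (auto intro!: holomorphic_on_imp_continuous_on holomorphic_deriv)
  have cX: "continuous_on unit_disk X"
    unfolding X_def using nz(2) by (intro continuous_intros cw) auto
  have fin_w: "weighted_integral p (p - 2) (deriv w) < \<infinity>"
    using w_besov by (simp add: besov_def weighted_integral_def w_def)
  have fin_w': "weighted_integral p (2 * p - 2) (deriv (deriv w)) < \<infinity>"
    by (rule weighted_integral_deriv[OF holw'(1) p fin_w])
  let ?wd = "\<lambda>z. deriv w z / of_real (1 - norm z ^ 2)"
  have fin_wd: "weighted_integral p (2 * p - 2) ?wd < \<infinity>"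
    unfolding weighted_integral_divide_weight by (rule fin_w)
  have cwd: "continuous_on unit_disk ?wd"
    by (rule continuous_on_divide_weight[OF cw'])
  have cSf: "continuous_on unit_disk ?Sf" by (intro continuous_intros cP cP' cX cw' cw'') auto

  \<comment> \<open>The two integrals of the statement in terms of \<open>P\<close>,
    \<open>X\<close> and \<open>w\<close>\<close>
  note ders = logjac_derivatives[OF hol_h hol_g open_ball h' _ w_def P_def]
  have sp: "norm (deriv g z) < norm (deriv h z)" if "z \<in> unit_disk" for z using sense_pres that by blast
  have Fz: "dz (logjac h g) z = ?Fz z" "dzbar (logjac h g) z = cnj (?Fz z)"
    and Sf: "harm_schwarzian h g z = ?Sf z" if z: "z \<in> unit_disk" for z
  proof -
    have e: "deriv w z * cnj (w z) / (1 - w z * cnj (w z)) = X z * deriv w z" by (simp add: X_def)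
    show "dz (logjac h g) z = ?Fz z" "dzbar (logjac h g) z = cnj (?Fz z)"
      using ders(1,2)[OF _ sp z] unfolding e by simp_all
    have "harm_schwarzian h g z = deriv P z - (P z)\<^sup>2 / 2
       + X z * (deriv w z * P z - deriv (deriv w) z) - 3 / 2 * (X z * deriv w z)\<^sup>2"
      using ders(3)[OF _ sp z] unfolding e X_def[symmetric] by simp
    then show "harm_schwarzian h g z = ?Sf z" by (simp add: algebra_simps power_mult_distrib)
  qed
  have smooth: "smooth_on unit_disk (logjac h g)"
    by (rule smooth_on_logjac[OF hol_h hol_g open_ball]) (use sp in \<open>auto simp: jac_def power_strict_mono\<close>)
  \<comment> \<open>The two first derivatives of log J are conjugate, so the sum of their norms is
    the norm of twice one of them.\<close>
  have bt: "besov_tilde p (logjac h g) \<longleftrightarrow> weighted_integral p (p - 2) (\<lambda>z. 2 * ?Fz z) < \<infinity>"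
  proof -
    have "(\<integral>\<^sup>+ z. ennreal ((norm (dz (logjac h g) z) + norm (dzbar (logjac h g) z)) powr p * (1 - norm z ^ 2) powr (p - 2))
        * indicator unit_disk z \<partial>lborel) = weighted_integral p (p - 2) (\<lambda>z. 2 * ?Fz z)"
      unfolding weighted_integral_def
    proof (rule nn_integral_cong)
      fix z :: complex
      show "ennreal ((norm (dz (logjac h g) z) + norm (dzbar (logjac h g) z)) powr p * (1 - norm z ^ 2) powr (p - 2)) * indicator unit_disk z
        = ennreal (norm (2 * ?Fz z) powr p * (1 - norm z ^ 2) powr (p - 2)) * indicator unit_disk z"
      proof (cases "z \<in> unit_disk")
        case True
        have "norm u + norm (cnj u) = norm (2 * u)" for u :: complex
          by (simp add: norm_mult)
        then show ?thesis by (simp only: Fz[OF True])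
      qed simp
    qed
    then show ?thesis using smooth by (simp add: besov_tilde_def)
  qed
  have If: "(\<integral>\<^sup>+ z. ennreal (norm (harm_schwarzian h g z) powr p * (1 - norm z ^ 2) powr (2 * p - 2))
            * indicator unit_disk z \<partial>lborel) = weighted_integral p (2 * p - 2) ?Sf"
    unfolding weighted_integral_def
  proof (rule nn_integral_cong)
    fix z :: complex
    show "ennreal (norm (harm_schwarzian h g z) powr p * (1 - norm z ^ 2) powr (2 * p - 2)) * indicator unit_disk z
      = ennreal (norm (?Sf z) powr p * (1 - norm z ^ 2) powr (2 * p - 2)) * indicator unit_disk z"
      by (cases "z \<in> unit_disk") (simp_all only: Sf indicator_simps not_False_eq_True mult_zero_right)
  qed

  \<comment> \<open>Pointwise errors between f and \<phi>\<close>
  have cmpF: "norm (Q z - ?Fz z) \<le> 2 * c * norm (deriv w z)" if z: "z \<in> unit_disk" for z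
  proof -
    have "Q z - ?Fz z = (A z + X z) * deriv w z" by (simp add: Q_def algebra_simps)
    moreover have "norm (A z + X z) \<le> 2 * c" using norm_triangle_ineq[of "A z" "X z"] Ac[OF z] Xc[OF z] by simp
    ultimately show ?thesis by (simp add: norm_mult mult_right_mono)
  qed
  \<comment> \<open>The summands belong to (A + X) P w' with |P| <= 2 (K + 2c)/(1-|z|^2), to the
    quadratic term in w' with 3/2 times 2 c^2 times 4, and to (A + X) w''.\<close>
  define M where "M = 2 * (K + 2 * c) * (2 * c) + 12 * c\<^sup>2 + 2 * c"
  have cmpS: "norm (S z - ?Sf z) \<le> M * (norm (deriv (deriv w) z) + norm (?wd z))" if z: "z \<in> unit_disk" for z
  proof -
    define \<delta> where "\<delta> = 1 - norm z ^ 2"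
    have d: "\<delta> > 0" using disk_weight_bounds(3)[of z] z by (simp add: \<delta>_def)
    have wd: "norm (?wd z) = norm (deriv w z) / \<delta>" using d by (simp only: norm_divide norm_of_real \<delta>_def[symmetric] abs_of_pos)
    have dp: "0 \<le> 1 - norm z" using z by simp
    \<comment> \<open>Injectivity is known for \<phi> and not for h, so the bound on P is taken from
      the one on Q, at the cost of a term in w'.\<close>
    have "norm (P z) \<le> norm (Q z) + c * norm (deriv w z)"
      using norm_triangle_ineq4[of "Q z" "A z * deriv w z"] mult_right_mono[OF Ac[OF z] norm_ge_zero[of "deriv w z"]]
      by (simp add: Q_def norm_mult)
    then have "norm (P z) * (1 - norm z) \<le> (norm (Q z) + c * norm (deriv w z)) * (1 - norm z)"
      using dp by (rule mult_right_mono)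
    also have "\<dots> \<le> K + c * 2"
      unfolding distrib_right mult.assoc
      by (rule add_mono[OF QK[OF z] mult_left_mono[OF w'2[OF z]]]) (use c0 in simp)
    also have "\<dots> = K + 2 * c" by simp
    finally have Pd: "norm (P z) \<le> 2 * (K + 2 * c) / \<delta>"
      unfolding \<delta>_def by (rule inv_weight[OF _ z])
    have wdd: "norm (deriv w z) \<le> 2 * 2 / \<delta>"
      unfolding \<delta>_def by (rule inv_weight[OF w'2[OF z] z])
    have AX: "norm (A z + X z) \<le> 2 * c" using norm_triangle_ineq[of "A z" "X z"] Ac[OF z] Xc[OF z] by simp
    have AX2: "norm ((A z)\<^sup>2 - (X z)\<^sup>2) \<le> 2 * c\<^sup>2"
    proof -
      have "norm ((A z)\<^sup>2 - (X z)\<^sup>2) \<le> norm (A z) ^ 2 + norm (X z) ^ 2"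
        using norm_triangle_ineq4[of "(A z)\<^sup>2" "(X z)\<^sup>2"] by (simp add: norm_power)
      also have "\<dots> \<le> c\<^sup>2 + c\<^sup>2" by (intro add_mono power_mono Ac[OF z] Xc[OF z]) auto
      finally show ?thesis by simp
    qed
    have "S z - ?Sf z = (A z + X z) * (deriv (deriv w) z - P z * deriv w z) - 3/2 * ((A z)\<^sup>2 - (X z)\<^sup>2) * (deriv w z)\<^sup>2"
      unfolding S_eq[OF z] by (simp add: algebra_simps)
    then have "norm (S z - ?Sf z) \<le> norm ((A z + X z) * (deriv (deriv w) z - P z * deriv w z)) + norm (3/2 * ((A z)\<^sup>2 - (X z)\<^sup>2) * (deriv w z)\<^sup>2)"
      by (metis norm_triangle_ineq4)
    also have "norm ((A z + X z) * (deriv (deriv w) z - P z * deriv w z))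
        \<le> 2 * c * (norm (deriv (deriv w) z) + 2 * (K + 2 * c) / \<delta> * norm (deriv w z))"
      unfolding norm_mult
    proof (rule mult_mono[OF AX])
      have "norm (P z * deriv w z) \<le> 2 * (K + 2 * c) / \<delta> * norm (deriv w z)"
        unfolding norm_mult by (rule mult_right_mono[OF Pd]) simp
      then show "norm (deriv (deriv w) z - P z * deriv w z) \<le> norm (deriv (deriv w) z) + 2 * (K + 2 * c) / \<delta> * norm (deriv w z)"
        using norm_triangle_ineq4[of "deriv (deriv w) z" "P z * deriv w z"] by linarith
    qed (use c0 in auto)
    also have "norm (3/2 * ((A z)\<^sup>2 - (X z)\<^sup>2) * (deriv w z)\<^sup>2) \<le> 3/2 * (2 * c\<^sup>2) * (2 * 2 / \<delta> * norm (deriv w z))"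
    proof -
      have ww: "norm (deriv w z) * norm (deriv w z) \<le> 2 * 2 / \<delta> * norm (deriv w z)"
        by (rule mult_right_mono[OF wdd]) simp
      have n: "norm (3/2 * a * b\<^sup>2) = 3/2 * (norm a * (norm b * norm b))" for a b :: complex
        by (simp add: norm_mult norm_power power2_eq_square)
      have "norm (3/2 * ((A z)\<^sup>2 - (X z)\<^sup>2) * (deriv w z)\<^sup>2) \<le> 3/2 * (2 * c\<^sup>2 * (2 * 2 / \<delta> * norm (deriv w z)))"
        unfolding n by (rule mult_left_mono[OF mult_mono[OF AX2 ww]]) auto
      then show ?thesis by (simp only: mult.assoc)
    qed
    also have "2 * c * (norm (deriv (deriv w) z) + 2 * (K + 2 * c) / \<delta> * norm (deriv w z))
        + 3/2 * (2 * c\<^sup>2) * (2 * 2 / \<delta> * norm (deriv w z))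
      = 2 * c * norm (deriv (deriv w) z) + (2 * (K + 2 * c) * (2 * c) + 12 * c\<^sup>2) * norm (?wd z)"
      unfolding wd by (simp add: algebra_simps add_divide_distrib)
    also have "\<dots> \<le> M * norm (deriv (deriv w) z) + M * norm (?wd z)"
      using c0 K by (intro add_mono mult_right_mono) (auto simp: M_def)
    finally show ?thesis by (simp add: distrib_left)
  qed
  have zero: "weighted_integral p a (\<lambda>_. 0) < \<infinity>" for a
    using p by (simp add: weighted_integral_def)

  \<comment> \<open>The equivalence for the conformal map \<phi>\<close>
  have QS: "weighted_integral p (p - 2) Q < \<infinity> \<longleftrightarrow> weighted_integral p (2 * p - 2) S < \<infinity>"
  proof
    assume fin: "weighted_integral p (p - 2) Q < \<infinity>"
    let ?Qd = "\<lambda>z. Q z / of_real (1 - norm z ^ 2)"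
    show "weighted_integral p (2 * p - 2) S < \<infinity>"
    proof (rule weighted_integral_dominated[OF cQ' _ p _ weighted_integral_deriv[OF holQ p fin]])
      show "continuous_on unit_disk ?Qd"
        by (rule continuous_on_divide_weight[OF cQ])
      show "weighted_integral p (2 * p - 2) ?Qd < \<infinity>"
        unfolding weighted_integral_divide_weight by (rule fin)
      fix z :: complex assume z: "z \<in> unit_disk"
      define \<delta> where "\<delta> = 1 - norm z ^ 2"
      have d: "\<delta> > 0" using disk_weight_bounds(3)[of z] z by (simp add: \<delta>_def)
      have Qd: "norm (?Qd z) = norm (Q z) / \<delta>" using d by (simp only: norm_divide norm_of_real \<delta>_def[symmetric] abs_of_pos)
      have "norm (S z) \<le> norm (deriv Q z) + norm (Q z) * norm (Q z) / 2"
        using norm_triangle_ineq4[of "deriv Q z" "(Q z)\<^sup>2 / 2"] by (simp add: S_def norm_divide norm_mult power2_eq_square)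
      \<comment> \<open>The univalence bound makes the quadratic term linear in Q/(1-|z|^2), which
        has finite second-order integral by assumption on Q.\<close>
      also have "norm (Q z) * norm (Q z) \<le> 2 * K / \<delta> * norm (Q z)"
        using inv_weight[OF QK[OF z] z] by (intro mult_right_mono) (auto simp: \<delta>_def)
      also have "norm (deriv Q z) + 2 * K / \<delta> * norm (Q z) / 2 = norm (deriv Q z) + K * norm (?Qd z)"
        unfolding Qd by simp
      also have "\<dots> \<le> (1 + K) * norm (deriv Q z) + (1 + K) * norm (?Qd z)"
        using K by (intro add_mono mult_right_mono) (auto simp: mult_le_cancel_right1)
      finally show "norm (S z) \<le> (1 + K) * (norm (deriv Q z) + norm (?Qd z))"
        by (simp add: distrib_left)
    qed
  next
    assume fin: "weighted_integral p (2 * p - 2) S < \<infinity>"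
    show "weighted_integral p (p - 2) Q < \<infinity>"
    proof (rule weighted_integral_pre_schwarzian[OF holQ p S_def _ fin])
      fix \<eta> :: real assume "\<eta> > 0"
      then show "\<exists>R<1. \<forall>z. R \<le> norm z \<and> norm z < 1 \<longrightarrow> norm (Q z) * (1 - norm z) \<le> \<eta>"
        using pre_schwarzian_vanishes_at_boundary[where F = F and P = Q and S = S and C = "2 * B",
            OF holF Fnz Fgrowth QF S_def weighted_integral_imp_vanishing[OF holS p fin]]
        by simp
    qed
  qed

  \<comment> \<open>Transfer from \<phi> back to f\<close>
  have "weighted_integral p (p - 2) (\<lambda>z. 2 * ?Fz z) < \<infinity> \<longleftrightarrow> weighted_integral p (p - 2) Q < \<infinity>"
  proof
    assume fin: "weighted_integral p (p - 2) (\<lambda>z. 2 * ?Fz z) < \<infinity>"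
    show "weighted_integral p (p - 2) Q < \<infinity>"
    proof (rule weighted_integral_dominated[OF _ cw' p _ fin fin_w])
      show "continuous_on unit_disk (\<lambda>z. 2 * ?Fz z)" by (intro continuous_intros cP cX cw')
      fix z :: complex assume z: "z \<in> unit_disk"
      have "norm (Q z) \<le> norm (?Fz z) + norm (Q z - ?Fz z)" by (rule norm_triangle_sub)
      also have "\<dots> \<le> norm (2 * ?Fz z) + 2 * c * norm (deriv w z)"
      proof (rule add_mono[OF _ cmpF[OF z]])
        have "norm u \<le> norm (2 * u)" for u :: complex by (simp add: norm_mult)
        then show "norm (?Fz z) \<le> norm (2 * ?Fz z)" .
      qed
      also have "\<dots> \<le> (1 + 2 * c) * norm (2 * ?Fz z) + (1 + 2 * c) * norm (deriv w z)"
        using c0 by (intro add_mono mult_right_mono) (auto simp: mult_le_cancel_right1)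
      finally show "norm (Q z) \<le> (1 + 2 * c) * (norm (2 * ?Fz z) + norm (deriv w z))"
        by (simp add: distrib_left)
    qed
  next
    assume fin: "weighted_integral p (p - 2) Q < \<infinity>"
    show "weighted_integral p (p - 2) (\<lambda>z. 2 * ?Fz z) < \<infinity>"
    proof (rule weighted_integral_dominated[OF cQ cw' p _ fin fin_w])
      fix z :: complex assume z: "z \<in> unit_disk"
      have "norm (?Fz z) \<le> norm (Q z) + norm (?Fz z - Q z)" by (rule norm_triangle_sub)
      also have "norm (?Fz z - Q z) \<le> 2 * c * norm (deriv w z)"
        using cmpF[OF z] by (simp add: norm_minus_commute)
      also have "norm (Q z) + 2 * c * norm (deriv w z) \<le> (1 + 2 * c) * norm (Q z) + (1 + 2 * c) * norm (deriv w z)"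
        using c0 by (intro add_mono mult_right_mono) (auto simp: mult_le_cancel_right1)
      finally have "norm (?Fz z) \<le> (1 + 2 * c) * (norm (Q z) + norm (deriv w z))"
        by (simp add: distrib_left)
      moreover have "norm (2 * u) = 2 * norm u" for u :: complex by (simp add: norm_mult)
      ultimately show "norm (2 * ?Fz z) \<le> (2 * (1 + 2 * c)) * (norm (Q z) + norm (deriv w z))"
        by (simp only: mult.assoc)
    qed
  qed
  moreover have "weighted_integral p (2 * p - 2) S < \<infinity> \<longleftrightarrow> weighted_integral p (2 * p - 2) ?Sf < \<infinity>"
  proof -
    let ?D = "\<lambda>z. S z - ?Sf z"
    have cD: "continuous_on unit_disk ?D" by (intro continuous_on_diff cS cSf)
    have finD: "weighted_integral p (2 * p - 2) ?D < \<infinity>"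
      by (rule weighted_integral_dominated[OF cw'' cwd p cmpS fin_w' fin_wd])
    have tri: "norm s \<le> 1 * (norm t + norm (s - t))" "norm t \<le> 1 * (norm s + norm (s - t))" for s t :: complex
      using norm_triangle_sub[of s t] norm_triangle_sub[of t s] norm_minus_commute[of s t] by simp_all
    have 1: "norm (S z) \<le> 1 * (norm (?Sf z) + norm (?D z))" and 2: "norm (?Sf z) \<le> 1 * (norm (S z) + norm (?D z))" for z
      by (rule tri)+
    show ?thesis
      by (rule iffI[OF weighted_integral_dominated[OF cS cD p 2 _ finD] weighted_integral_dominated[OF cSf cD p 1 _ finD]])
  qed
  ultimately show ?thesis unfolding bt If using QS by blast
qed

end
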